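(* Let $N$ be a fixed positive integer. Let $m,n$ be natural numbers and $k$ an even natural number such that $$\left|\frac{4\pi\sqrt{mn}}{N}-(k-1)\right|<(k-1)^{1/3}.$$ Then (i) $$\Delta_{k,N}(m,n)=\delta(m,n)+2\pi i^k\frac{S(m,n,N)}{N}J_{k-1}\!\left(\frac{4\pi\sqrt{mn}}{N}\right)+O\!\left(\frac{e^{(k-1)\left(1-\frac49-\log\frac95\right)}}{(k-1)^{1/3}}\right).$$ (ii) Furthermore, if $S(m,n,N)\neq 0$, then $$\big|\Delta_{k,N}(m,n)-\delta(m,n)\big|\gg (k-1)^{-1/3}.$$ (Here the implied constants may depend on $N$, and the estimates are as $k\to\infty$.)
   Context: For an even positive integer $k$ and positive integer $N$, $S_k(N)$ is the space of cusp forms of weight $k$ on $\Gamma_0(N)$, and $\mathcal{F}_k(N)$ is an orthonormal basis (for the Petersson inner product) of $S_k(N)$ consisting of joint eigenfunctions of the Hecke operators $T_n$, $(n,N)=1$. Each $f\in S_k(N)$ is written $f(z)=\sum_{n\ge1}a_n(f)n^{\frac{k-1}{2}}e^{2\pi i n z}$. Put $\rho_n(f)=\big(\frac{\Gamma(k-1)}{(4\pi)^{k-1}}\big)^{1/2}a_n(f)$ and $\Delta_{k,N}(m,n)=\sum_{f\in\mathcal{F}_k(N)}\overline{\rho_m(f)}\rho_n(f)$. $\delta(m,n)$ is the Kronecker delta. For integers $m,n$ and natural $c$, the Kloosterman sum is $S(m,n,c)=\sum_{x \bmod c,\ \gcd(x,c)=1}e\big(\frac{mx+n\overline{x}}{c}\big)$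 with $\overline{x}$ the inverse of $x$ modulo $c$ and $e(x)=e^{2\pi i x}$. $J_a$ is the Bessel function of the first kind, $J_a(x)=\sum_{j\ge0}\frac{(-1)^j}{\Gamma(j+1)\Gamma(a+j+1)}(x/2)^{a+2j}$. *)

theory Defs
  imports
    "HOL-Complex_Analysis.Complex_Analysis"
    "HOL-Number_Theory.Modular_Inverse"
    "HOL-Library.Function_Algebras"
begin

section \<open>Cusp forms on \<open>\<Gamma>\<^sub>0(N)\<close>\<close>

definition upper_half_plane :: "complex set" where
  "upper_half_plane = {z. Im z > 0}"

text \<open>Indices of \<^typ>\<open>int ^ 2 ^ 2\<close> are \<open>1\<close> and \<open>2\<close>; the lower left entry is \<open>A $ 2 $ 1\<close>.\<close>

definition SL2Z :: "(int ^ 2 ^ 2) set" where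
  "SL2Z = {A. det A = 1}"

definition Gamma0 :: "nat \<Rightarrow> (int ^ 2 ^ 2) set" where
  "Gamma0 N = {A \<in> SL2Z. int N dvd A $ 2 $ 1}"

definition aut_factor :: "int ^ 2 ^ 2 \<Rightarrow> complex \<Rightarrow> complex" where
  "aut_factor A z = of_int (A $ 2 $ 1) * z + of_int (A $ 2 $ 2)"

definition moebius :: "int ^ 2 ^ 2 \<Rightarrow> complex \<Rightarrow> complex" where
  "moebius A z = (of_int (A $ 1 $ 1) * z + of_int (A $ 1 $ 2)) / aut_factor A z"

definition slash :: "nat \<Rightarrow> (complex \<Rightarrow> complex) \<Rightarrow> int ^ 2 ^ 2 \<Rightarrow> complex \<Rightarrow> complex" where
  "slash k f A z = f (moebius A z) / aut_factor A z ^ k"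

text \<open>
  Forms are functions on the upper half plane. They are represented by total functions that vanish
  off the upper half plane, so that equality of forms is equality of functions. A form vanishes at
  all cusps if each of its transforms under \<^const>\<open>SL2Z\<close> tends to \<open>0\<close> at \<open>i\<infinity>\<close>.
\<close>

definition cusp_forms :: "nat \<Rightarrow> nat \<Rightarrow> (complex \<Rightarrow> complex) set" where
  "cusp_forms k N = {f.
     f holomorphic_on upper_half_plane \<and>
     (\<forall>z. z \<notin> upper_half_plane \<longrightarrow> f z = 0) \<and>
     (\<forall>A\<in>Gamma0 N. \<forall>z\<in>upper_half_plane. slash k f A z = f z) \<and>
     (\<forall>A\<in>SL2Z. (slash k f A \<longlongrightarrow> 0) (filtercomap Im at_top))}"

text \<open>
  The Ford fundamental domain of \<open>\<Gamma>\<^sub>0(N)\<close>: since \<open>Im (A z) = Im z / \<bar>cz + d\<bar>\<^sup>2\<close>, it consists of the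
  points with \<open>\<bar>Re z\<bar> \<le> 1/2\<close> whose imaginary part is maximal in their orbit. It meets every
  orbit, and distinct points of it are equivalent only if both lie on the lines \<open>\<bar>Re z\<bar> = 1/2\<close> or on
  the circles \<open>\<bar>cz + d\<bar> = 1\<close> with \<open>c \<noteq> 0\<close>, a null set.
\<close>

definition Ford_domain :: "nat \<Rightarrow> complex set" where
  "Ford_domain N = {z \<in> upper_half_plane. \<bar>Re z\<bar> \<le> 1 / 2 \<and> (\<forall>A\<in>Gamma0 N. norm (aut_factor A z) \<ge> 1)}"

text \<open>
  The integral of \<open>f(z) \<cdot> cnj (g(z)) \<cdot> y\<^sup>k\<close> over the quotient of the upper half plane by \<open>\<Gamma>\<^sub>0(N)\<close>, with
  respect to the measure \<open>dx dy / y\<^sup>2\<close>, not divided by the volume or the index.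
\<close>

definition petersson :: "nat \<Rightarrow> nat \<Rightarrow> (complex \<Rightarrow> complex) \<Rightarrow> (complex \<Rightarrow> complex) \<Rightarrow> complex" where
  "petersson k N f g =
     (LINT z:Ford_domain N|lborel. f z * cnj (g z) * of_real (Im z ^ k / Im z ^ 2))"

text \<open>\<open>T\<^sub>n\<close> in weight \<open>k\<close> on \<open>\<Gamma>\<^sub>0(N)\<close>; this formula is only used for \<open>n\<close> coprime to \<open>N\<close>.\<close>

definition hecke :: "nat \<Rightarrow> nat \<Rightarrow> (complex \<Rightarrow> complex) \<Rightarrow> complex \<Rightarrow> complex" where
  "hecke k n f z = of_nat n ^ (k - 1) *
     (\<Sum>d | d dvd n. (\<Sum>b<d. f ((of_nat (n div d) * z + of_nat b) / of_nat d)) / of_nat d ^ k)"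

definition hecke_basis :: "nat \<Rightarrow> nat \<Rightarrow> (complex \<Rightarrow> complex) set \<Rightarrow> bool" where
  "hecke_basis k N F \<longleftrightarrow>
     F \<subseteq> cusp_forms k N \<and>
     module.span (\<lambda>c f z. c * f z) F = cusp_forms k N \<and>
     (\<forall>f\<in>F. \<forall>g\<in>F. petersson k N f g = of_bool (f = g)) \<and>
     (\<forall>f\<in>F. \<forall>n>0. coprime n N \<longrightarrow> (\<exists>l. \<forall>z\<in>upper_half_plane. hecke k n f z = l * f z))"

section \<open>Fourier coefficients\<close>

text \<open>
  The unique sequence \<open>a\<close> with \<open>f(z) = \<Sum>\<^sub>n\<^sub>\<ge>\<^sub>1 a\<^sub>n n\<^bsup>(k-1)/2\<^esup> e\<^bsup>2\<pi>inz\<^esup>\<close>. The term for \<open>n = 0\<close> below is \<open>0\<close>,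
  and \<open>a 0 = 0\<close> is a convention that makes the sequence unique.
\<close>

definition fourier_coeff :: "nat \<Rightarrow> (complex \<Rightarrow> complex) \<Rightarrow> nat \<Rightarrow> complex" where
  "fourier_coeff k f = (THE a. a 0 = 0 \<and>
     (\<forall>z\<in>upper_half_plane.
        (\<lambda>n. a n * of_real (real n powr ((real k - 1) / 2)) * exp (2 * of_real pi * \<i> * of_nat n * z))
          sums f z))"

definition rho :: "nat \<Rightarrow> nat \<Rightarrow> (complex \<Rightarrow> complex) \<Rightarrow> complex" where
  "rho k n f = of_real (sqrt (Gamma (real k - 1) / (4 * pi) powr (real k - 1))) * fourier_coeff k f n"

text \<open>
  \<open>F\<close> will be a \<^const>\<open>hecke_basis\<close>. Spaces of cusp forms are finite-dimensional, so this is then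
  a finite sum; the infinite-sum operator is used only because \<^const>\<open>hecke_basis\<close> does not include
  finiteness as a separate condition.
\<close>

definition Delta :: "nat \<Rightarrow> (complex \<Rightarrow> complex) set \<Rightarrow> nat \<Rightarrow> nat \<Rightarrow> complex" where
  "Delta k F m n = (\<Sum>\<^sub>\<infinity>f\<in>F. cnj (rho k m f) * rho k n f)"

section \<open>Kloosterman sums and Bessel functions\<close>

definition kloosterman :: "int \<Rightarrow> int \<Rightarrow> nat \<Rightarrow> complex" where
  "kloosterman m n c = (\<Sum>x | x \<in> {0..<int c} \<and> coprime x (int c).
     exp (2 * of_real pi * \<i> * (of_int (m * x + n * modular_inverse (int c) x) / of_nat c)))"

text \<open>For positive \<open>x\<close>. At poles of the Gamma function, \<open>1 / Gamma = 0\<close> as it should be.\<close>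

definition bessel_J :: "real \<Rightarrow> real \<Rightarrow> real" where
  "bessel_J a x =
     (\<Sum>j. (-1) ^ j / (Gamma (real j + 1) * Gamma (a + real j + 1)) * (x / 2) powr (a + 2 * real j))"

end

theory Submission
  imports Defs "HOL-Real_Asymp.Real_Asymp" "HOL-Probability.Distributions"
begin

no_notation fps_nth (infixl "$" 75)

text \<open>
  The inner product of a cusp form with the Poincare series of index \<open>m\<close> unfolds to its \<open>m\<close>-th
  Fourier coefficient. Expanding the Poincare series in the given orthonormal basis therefore
  expresses \<open>\<Delta>(m,n)\<close> through the \<open>n\<close>-th Fourier coefficient of that series, which the Lipschitz
  formula evaluates as a sum of Kloosterman sums and Bessel functions over the moduli \<open>c = Nq\<close>. For
  \<open>q \<ge> 2\<close> the argument of \<open>J\<^sub>k\<^sub>-\<^sub>1\<close> is at most about \<open>(k-1)/2\<close>, where the power series gives an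
  exponentially small bound; only the term \<open>q = 1\<close> remains. It is in the transition range, where
  \<open>J\<^sub>v(x)\<close> is at least of order \<open>v\<^bsup>-1/3\<^esup>\<close>: up to the turning point \<open>x = v\<close>, a WKB approximation is a
  subsolution of Bessel's equation and bounds \<open>J\<^sub>v\<close> from below, and just beyond it \<open>J\<^sub>v\<close> cannot yet
  have decreased by more than a factor of \<open>2\<close>.
\<close>

section \<open>Bessel functions in the transition range\<close>

text \<open>Finite dimension of the space of cusp forms is bypassed. The Poincare series is a finite
  combination of elements of \<open>F\<close> because \<open>F\<close> spans; every other element of
  \<open>F\<close> is orthogonal to it, so its \<open>m\<close>-th coefficient vanishes and the
  infinite sum \<open>Delta\<close> collapses. In the same spirit, convergence of the Petersson
  integrals is read off from orthonormality: a divergent Bochner integral would be 0, not 1. The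
  lower bound has to hold on the whole window of width \<open>v^(1/3)\<close> around the turning
  point, where an asymptotic formula would need uniform error terms. One-sided comparisons for the
  differential equation give explicit constants instead. The Kloosterman sum enters only through
  \<open>m\<close> and \<open>n\<close> modulo \<open>N\<close>, so its nonzero values have a
  positive minimum depending on \<open>N\<close>. The discarded moduli contribute at most a constant
  times \<open>exp (- (k - 1) / 4)\<close>, whereas \<open>1 - 4/9 - ln (9/5)\<close> is about
  \<open>- 0.032\<close>. So crude bounds are enough for the error term.\<close>

definition bessel_coeff :: "nat \<Rightarrow> nat \<Rightarrow> real" where
  "bessel_coeff v j = (-1) ^ j / (fact j * fact (v + j))"

text \<open>The entire function with \<open>J_v(x) = (x / 2)^v * F((x / 2)^2)\<close>. Splitting off
  the power leaves a function that is regular where Bessel's equation is singular.\<close>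

definition bessel_F :: "nat \<Rightarrow> real \<Rightarrow> real" where
  "bessel_F v u = (\<Sum>j. bessel_coeff v j * u ^ j)"

definition bessel_F' :: "nat \<Rightarrow> real \<Rightarrow> real" where
  "bessel_F' v u = (\<Sum>j. diffs (bessel_coeff v) j * u ^ j)"

text \<open>This recursion is the equation \<open>u F'' + (v + 1) F' + F = 0\<close> read
  coefficient by coefficient.\<close>

lemma bessel_coeff_Suc: "real (Suc j) * real (v + Suc j) * bessel_coeff v (Suc j) = - bessel_coeff v j"
proof -
  have *: "a * b * (- e / ((a * p) * (b * q))) = - (e / (p * q))" if "a \<noteq> 0" "b \<noteq> 0" for a b p q e :: real
    using that by simp
  have "bessel_coeff v (Suc j) = - ((-1) ^ j) / ((real (Suc j) * fact j) * (real (v + Suc j) * fact (v + j)))"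
    by (simp only: bessel_coeff_def fact_Suc add_Suc_right power_Suc mult_minus_left mult_1_left)
  then show ?thesis
    using *[of "real (Suc j)" "real (v + Suc j)"] by (simp only: bessel_coeff_def)
qed

text \<open>Each of the \<open>j\<close> factors by which \<open>(v + j)!\<close> exceeds
  \<open>v!\<close> is at least \<open>v + 1\<close>. The Bessel series is thereby dominated by an
  exponential series in \<open>|u| / (v + 1)\<close>, which stays moderate for arguments of order
  \<open>v\<close>.\<close>

lemma abs_bessel_coeff_le: "\<bar>bessel_coeff v j\<bar> \<le> (1 / fact v) * ((1 / (real v + 1)) ^ j / fact j)"
proof -
  have "fact v * (real v + 1) ^ j \<le> fact (v + j)"
  proof (induction j)
    case (Suc j)
    have "fact v * (real v + 1) ^ Suc j = (fact v * (real v + 1) ^ j) * (real v + 1)" by simp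
    also have "\<dots> \<le> fact (v + j) * (real (v + Suc j))"
      by (intro mult_mono Suc) auto
    also have "\<dots> = fact (v + Suc j)" by (simp add: algebra_simps)
    finally show ?case .
  qed auto
  then have "1 / fact (v + j) \<le> 1 / (fact v * (real v + 1) ^ j)"
    by (intro divide_left_mono) (auto intro!: mult_pos_pos)
  then have "1 / fact j * (1 / fact (v + j)) \<le> 1 / fact j * (1 / (fact v * (real v + 1) ^ j))"
    by (intro mult_left_mono) auto
  then show ?thesis
    by (simp add: bessel_coeff_def abs_mult power_one_over field_simps)
qed

lemma summable_abs_bessel: "summable (\<lambda>j. \<bar>bessel_coeff v j * u ^ j\<bar>)"
proof (rule summable_comparison_test')
  show "summable (\<lambda>j. (1 / fact v) * ((\<bar>u\<bar> / (real v + 1)) ^ j / fact j))"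
    using summable_exp_generic[of "\<bar>u\<bar> / (real v + 1)"]
    by (intro summable_mult) (simp add: field_simps)
  show "norm \<bar>bessel_coeff v j * u ^ j\<bar> \<le> (1 / fact v) * ((\<bar>u\<bar> / (real v + 1)) ^ j / fact j)" for j
    using mult_right_mono[OF abs_bessel_coeff_le[of v j], of "\<bar>u\<bar> ^ j"]
    by (simp add: abs_mult power_abs power_divide field_simps)
qed

lemma summable_bessel: "summable (\<lambda>j. bessel_coeff v j * u ^ j)"
  by (rule summable_rabs_cancel[OF summable_abs_bessel])

lemma abs_bessel_F_le: "\<bar>bessel_F v u\<bar> \<le> exp (\<bar>u\<bar> / (real v + 1)) / fact v"
proof -
  have "\<bar>bessel_F v u\<bar> \<le> (\<Sum>j. \<bar>bessel_coeff v j * u ^ j\<bar>)"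
    unfolding bessel_F_def by (rule summable_rabs[OF summable_abs_bessel])
  also have "\<dots> \<le> (\<Sum>j. (1 / fact v) * ((\<bar>u\<bar> / (real v + 1)) ^ j / fact j))"
  proof (rule suminf_le[OF _ summable_abs_bessel])
    show "summable (\<lambda>j. (1 / fact v) * ((\<bar>u\<bar> / (real v + 1)) ^ j / fact j))"
      using summable_exp_generic[of "\<bar>u\<bar> / (real v + 1)"]
      by (intro summable_mult) (simp add: field_simps)
    show "\<bar>bessel_coeff v j * u ^ j\<bar> \<le> (1 / fact v) * ((\<bar>u\<bar> / (real v + 1)) ^ j / fact j)" for j
      using mult_right_mono[OF abs_bessel_coeff_le[of v j], of "\<bar>u\<bar> ^ j"]
      by (simp add: abs_mult power_abs power_divide field_simps)
  qed
  also have "\<dots> = (1 / fact v) * (\<Sum>j. (\<bar>u\<bar> / (real v + 1)) ^ j / fact j)"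
    using summable_exp_generic[of "\<bar>u\<bar> / (real v + 1)"]
    by (intro suminf_mult) (simp add: field_simps)
  also have "(\<Sum>j. (\<bar>u\<bar> / (real v + 1)) ^ j / fact j) = exp (\<bar>u\<bar> / (real v + 1))"
    unfolding exp_def by (simp add: field_simps)
  finally show ?thesis by simp
qed

lemma bessel_J_eq_F:
  assumes "x > 0"
  shows "bessel_J (real v) x = (x / 2) ^ v * bessel_F v ((x / 2)\<^sup>2)"
proof -
  have eq: "(-1) ^ j / (Gamma (real j + 1) * Gamma (real v + real j + 1)) * (x / 2) powr (real v + 2 * real j)
      = bessel_coeff v j * (x / 2) ^ (v + 2 * j)" for j
  proof -
    have "Gamma (real j + 1) = fact j" using Gamma_fact[of j, where 'a = real] by (simp add: add_ac)
    moreover have "Gamma (real v + real j + 1) = fact (v + j)"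
      using Gamma_fact[of "v + j", where 'a = real] by (simp add: add_ac)
    moreover have "(x / 2) powr (real v + 2 * real j) = (x / 2) ^ (v + 2 * j)"
      using assms by (subst powr_realpow[symmetric]) auto
    ultimately show ?thesis by (simp add: bessel_coeff_def)
  qed
  have "(\<lambda>j. (x / 2) ^ v * (bessel_coeff v j * ((x / 2)\<^sup>2) ^ j)) sums ((x / 2) ^ v * bessel_F v ((x / 2)\<^sup>2))"
    unfolding bessel_F_def by (intro sums_mult summable_sums summable_bessel)
  then have "(\<lambda>j. bessel_coeff v j * (x / 2) ^ (v + 2 * j)) sums ((x / 2) ^ v * bessel_F v ((x / 2)\<^sup>2))"
    by (simp add: power_add mult_ac flip: power_mult)
  then show ?thesis unfolding bessel_J_def eq by (simp add: sums_iff)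
qed

lemma abs_bessel_J_le:
  assumes "x > 0"
  shows "\<bar>bessel_J (real v) x\<bar> \<le> (x / 2) ^ v * (exp ((x / 2)\<^sup>2 / (real v + 1)) / fact v)"
proof -
  have "\<bar>bessel_F v ((x / 2)\<^sup>2)\<bar> \<le> exp ((x / 2)\<^sup>2 / (real v + 1)) / fact v"
    using abs_bessel_F_le[of v "(x / 2)\<^sup>2"] by (simp only: abs_power2)
  moreover have "\<bar>(x / 2) ^ v\<bar> = (x / 2) ^ v" using assms by simp
  ultimately show ?thesis
    unfolding bessel_J_eq_F[OF assms] abs_mult using assms by (simp only:) (intro mult_left_mono; simp)
qed

lemma bessel_F_deriv: "(bessel_F v has_field_derivative bessel_F' v u) (at u)"
  unfolding bessel_F_def[abs_def] bessel_F'_def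
  by (rule termdiffs_strong_converges_everywhere) (rule summable_bessel)

lemma bessel_F_ode:
  obtains D where "(bessel_F' v has_field_derivative D) (at u)"
    "u * D + (real v + 1) * bessel_F' v u + bessel_F v u = 0"
proof -
  let ?c = "bessel_coeff v"
  have s1: "summable (\<lambda>j. diffs ?c j * y ^ j)" for y
    by (rule termdiff_converges_all) (rule summable_bessel)
  have s2: "summable (\<lambda>j. diffs (diffs ?c) j * y ^ j)" for y
    by (rule termdiff_converges_all) (rule s1)
  let ?D = "\<Sum>j. diffs (diffs ?c) j * u ^ j"
  have d: "(bessel_F' v has_field_derivative ?D) (at u)"
    unfolding bessel_F'_def[abs_def] by (rule termdiffs_strong_converges_everywhere) (rule s1)
  have "(\<lambda>j. diffs (diffs ?c) j * u ^ j) sums ?D" using s2 by (rule summable_sums)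
  then have "(\<lambda>j. u * (diffs (diffs ?c) j * u ^ j)) sums (u * ?D)" by (rule sums_mult)
  then have "(\<lambda>j. real (Suc j) * diffs ?c (Suc j) * u ^ Suc j) sums (u * ?D)"
    by (simp add: diffs_def mult_ac)
  then have A: "(\<lambda>j. real j * diffs ?c j * u ^ j) sums (u * ?D)"
    by (subst (asm) sums_Suc_iff) simp
  have B: "(\<lambda>j. (real v + 1) * (diffs ?c j * u ^ j)) sums ((real v + 1) * bessel_F' v u)"
    unfolding bessel_F'_def by (intro sums_mult summable_sums s1)
  have C: "(\<lambda>j. ?c j * u ^ j) sums bessel_F v u"
    unfolding bessel_F_def by (intro summable_sums summable_bessel)
  have "(\<lambda>j. real j * diffs ?c j * u ^ j + (real v + 1) * (diffs ?c j * u ^ j) + ?c j * u ^ j) sums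
     (u * ?D + (real v + 1) * bessel_F' v u + bessel_F v u)"
    by (intro sums_add A B C)
  moreover have "real j * diffs ?c j * u ^ j + (real v + 1) * (diffs ?c j * u ^ j) + ?c j * u ^ j = 0" for j
  proof -
    have "real j * diffs ?c j * u ^ j + (real v + 1) * (diffs ?c j * u ^ j) + ?c j * u ^ j
      = (real (Suc j) * real (v + Suc j) * ?c (Suc j) + ?c j) * u ^ j"
      by (simp add: diffs_def algebra_simps)
    then show ?thesis unfolding bessel_coeff_Suc by simp
  qed
  ultimately have "(\<lambda>j. 0) sums (u * ?D + (real v + 1) * bessel_F' v u + bessel_F v u)" by simp
  then have "u * ?D + (real v + 1) * bessel_F' v u + bessel_F v u = 0"
    using sums_unique2[OF _ sums_zero] by blast
  with d that show ?thesis by blast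
qed

lemma bessel_F_0 [simp]: "bessel_F v 0 = 1 / fact v"
  unfolding bessel_F_def powser_zero by (simp add: bessel_coeff_def)

section \<open>Bessel's equation in the logarithmic variable \<open>s = ln (x / v)\<close>\<close>

definition bessel_log :: "nat \<Rightarrow> real \<Rightarrow> real" where
  "bessel_log v s = (real v / 2) ^ v * exp (v * s) * bessel_F v ((real v)\<^sup>2 / 4 * exp (2 * s))"

definition bessel_log' :: "nat \<Rightarrow> real \<Rightarrow> real" where
  "bessel_log' v s = (real v / 2) ^ v * exp (v * s) *
     (v * bessel_F v ((real v)\<^sup>2 / 4 * exp (2 * s)) + 2 * ((real v)\<^sup>2 / 4 * exp (2 * s)) * bessel_F' v ((real v)\<^sup>2 / 4 * exp (2 * s)))"

lemma bessel_J_eq_log: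
  assumes "v > 0" shows "bessel_J (real v) (v * exp s) = bessel_log v s"
proof -
  have "exp (2 * s) = (exp s)\<^sup>2" by (simp add: exp_double)
  then have 1: "(real v * exp s / 2)\<^sup>2 = (real v)\<^sup>2 / 4 * exp (2 * s)"
    by (simp add: power_mult_distrib power_divide)
  have 2: "(real v * exp s / 2) ^ v = (real v / 2) ^ v * exp (v * s)"
    by (simp add: power_mult_distrib power_divide exp_of_nat_mult)
  show ?thesis
    unfolding bessel_log_def using assms by (subst bessel_J_eq_F) (simp_all only: 1 2, simp_all)
qed

lemma bessel_log_deriv: "(bessel_log v has_real_derivative bessel_log' v s) (at s)"
proof -
  have *: "A * (e * w) * F + F' * (c * (E * 2)) * (A * e) = A * e * (w * F + 2 * (c * E) * F')"
    for A e w F F' c E :: real by (simp add: algebra_simps)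
  have F: "((\<lambda>s. bessel_F v ((real v)\<^sup>2 / 4 * exp (2 * s))) has_real_derivative
      bessel_F' v ((real v)\<^sup>2 / 4 * exp (2 * s)) * ((real v)\<^sup>2 / 4 * (exp (2 * s) * 2))) (at s)"
    by (rule DERIV_chain2[OF bessel_F_deriv]) (auto intro!: derivative_eq_intros)
  have E: "((\<lambda>s. (real v / 2) ^ v * exp (v * s)) has_real_derivative (real v / 2) ^ v * (exp (v * s) * v)) (at s)"
    by (auto intro!: derivative_eq_intros)
  show ?thesis
    unfolding bessel_log_def[abs_def] bessel_log'_def
    by (rule DERIV_cong[OF DERIV_mult[OF E F]]) (rule *)
qed

text \<open>The substitution \<open>x = v * exp s\<close> removes the first-order term of Bessel's
  equation. The sign of \<open>1 - exp (2 * s)\<close> makes a positive solution convex before the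
  turning point \<open>s = 0\<close> and concave after it.\<close>

lemma bessel_log'_deriv:
  "(bessel_log' v has_real_derivative (real v)\<^sup>2 * (1 - exp (2 * s)) * bessel_log v s) (at s)"
proof -
  define u where "u = (real v)\<^sup>2 / 4 * exp (2 * s)"
  obtain D where D: "(bessel_F' v has_field_derivative D) (at u)"
    and eq: "u * D + (real v + 1) * bessel_F' v u + bessel_F v u = 0"
    by (rule bessel_F_ode)
  let ?A = "(real v / 2) ^ v * exp (v * s)"
  have *: "4 * u = (real v)\<^sup>2 * exp (2 * s)" by (simp add: u_def)
  have **: "A * (w * F + 4 * u * - F) = w * (1 - E) * (A * F)" if "4 * u = w * E" for A w F E
    unfolding that by (simp add: algebra_simps)
  have ***: "?A * ((real v)\<^sup>2 * bessel_F v u + 4 * u * - bessel_F v u) = (real v)\<^sup>2 * (1 - exp (2 * s)) * bessel_log v s"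
    unfolding bessel_log_def u_def[symmetric] by (rule **[OF *])
  have F: "((\<lambda>s. bessel_F v ((real v)\<^sup>2 / 4 * exp (2 * s))) has_real_derivative
      bessel_F' v u * (2 * u)) (at s)"
    using bessel_F_deriv unfolding u_def by (rule DERIV_chain2) (auto intro!: derivative_eq_intros)
  have E: "((\<lambda>s. (real v / 2) ^ v * exp (v * s)) has_real_derivative ?A * v) (at s)"
    by (auto intro!: derivative_eq_intros)
  have U: "((\<lambda>s. 2 * ((real v)\<^sup>2 / 4 * exp (2 * s))) has_real_derivative 2 * (2 * u)) (at s)"
    by (auto intro!: derivative_eq_intros simp: u_def)
  have F': "((\<lambda>s. bessel_F' v ((real v)\<^sup>2 / 4 * exp (2 * s))) has_real_derivative D * (2 * u)) (at s)"
    by (rule DERIV_chain2[where f = "bessel_F' v" and g = "\<lambda>s. (real v)\<^sup>2 / 4 * exp (2 * s)"])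
      (use D in \<open>auto intro!: derivative_eq_intros simp: u_def\<close>)
  have "(bessel_log' v has_real_derivative
     ?A * v * (v * bessel_F v u + 2 * u * bessel_F' v u) +
     ?A * (v * (2 * u * bessel_F' v u) + 4 * u * bessel_F' v u + 2 * u * (2 * u * D))) (at s)"
    unfolding bessel_log'_def[abs_def]
    by (rule DERIV_cong[OF DERIV_mult[OF E DERIV_add[OF DERIV_cmult[OF F] DERIV_mult[OF U F']]]])
      (unfold u_def[symmetric], simp only: algebra_simps)
  also have "?A * v * (v * bessel_F v u + 2 * u * bessel_F' v u) +
     ?A * (v * (2 * u * bessel_F' v u) + 4 * u * bessel_F' v u + 2 * u * (2 * u * D))
     = ?A * ((real v)\<^sup>2 * bessel_F v u + 4 * u * (u * D + (real v + 1) * bessel_F' v u))"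
    by (simp only: algebra_simps power2_eq_square)
  also have "u * D + (real v + 1) * bessel_F' v u = - bessel_F v u" using eq by simp
  also note ***
  finally show ?thesis .
qed

text \<open>Minus infinity corresponds to \<open>x = 0\<close>. After division by
  \<open>exp (v * s)\<close> these positive limits serve as initial values at the singular point for
  the comparisons below.\<close>

lemma bessel_log_at_bot:
  assumes "v > 0"
  shows "((\<lambda>s::real. exp (- (v * s)) * bessel_log v s) \<longlongrightarrow> (real v / 2) ^ v / fact v) at_bot"
    and "((\<lambda>s::real. exp (- (v * s)) * bessel_log' v s) \<longlongrightarrow> (real v / 2) ^ v * v / fact v) at_bot"
proof -
  have u: "((\<lambda>s. (real v)\<^sup>2 / 4 * exp (2 * s)) \<longlongrightarrow> 0) at_bot"
    by real_asymp
  have F: "((\<lambda>s. bessel_F v ((real v)\<^sup>2 / 4 * exp (2 * s))) \<longlongrightarrow> bessel_F v 0) at_bot"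
    by (rule isCont_tendsto_compose[OF _ u]) (rule DERIV_isCont[OF bessel_F_deriv])
  obtain D where "(bessel_F' v has_field_derivative D) (at 0)"
    by (rule bessel_F_ode)
  then have F': "((\<lambda>s. bessel_F' v ((real v)\<^sup>2 / 4 * exp (2 * s))) \<longlongrightarrow> bessel_F' v 0) at_bot"
    by (intro isCont_tendsto_compose[OF _ u]) (rule DERIV_isCont)
  have e: "exp (- (v * s)) * (a * exp (v * s) * b) = a * b" for a b s :: real
    by (simp add: exp_minus)
  have "((\<lambda>s. (real v / 2) ^ v * bessel_F v ((real v)\<^sup>2 / 4 * exp (2 * s))) \<longlongrightarrow> (real v / 2) ^ v * (1 / fact v)) at_bot"
    using F by (intro tendsto_mult_left) simp
  then show "((\<lambda>s::real. exp (- (v * s)) * bessel_log v s) \<longlongrightarrow> (real v / 2) ^ v / fact v) at_bot"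
    unfolding bessel_log_def e by simp
  have "((\<lambda>s. (real v / 2) ^ v * (v * bessel_F v ((real v)\<^sup>2 / 4 * exp (2 * s)) +
      2 * ((real v)\<^sup>2 / 4 * exp (2 * s)) * bessel_F' v ((real v)\<^sup>2 / 4 * exp (2 * s))))
      \<longlongrightarrow> (real v / 2) ^ v * (v * (bessel_F v 0) + 2 * 0 * bessel_F' v 0)) at_bot"
    by (intro tendsto_intros F F' u)
  then show "((\<lambda>s::real. exp (- (v * s)) * bessel_log' v s) \<longlongrightarrow> (real v / 2) ^ v * v / fact v) at_bot"
    unfolding bessel_log'_def e by simp
qed

text \<open>For \<open>s <= 0\<close> the product \<open>f f'\<close> has derivative
  \<open>f'^2 + v^2 (1 - exp (2 s)) f^2 >= 0\<close>, and it is positive near minus infinity. It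
  therefore stays positive, so neither factor can vanish.\<close>

lemma bessel_log_pos:
  assumes "v > 0" "s \<le> 0"
  shows "bessel_log v s > 0" "bessel_log' v s > 0"
proof -
  have "(real v / 2) ^ v / fact v > 0" "(real v / 2) ^ v * v / fact v > 0"
    using assms by auto
  then have "\<forall>\<^sub>F s::real in at_bot. 0 < exp (- (v * s)) * bessel_log v s"
    "\<forall>\<^sub>F s::real in at_bot. 0 < exp (- (v * s)) * bessel_log' v s"
    using order_tendstoD(1)[OF bessel_log_at_bot(1)[OF assms(1)]]
      order_tendstoD(1)[OF bessel_log_at_bot(2)[OF assms(1)]] by simp_all
  then have "\<forall>\<^sub>F s in at_bot. 0 < bessel_log v s \<and> 0 < bessel_log' v s"
    by eventually_elim (simp add: zero_less_mult_iff)
  then obtain s0 where s0: "\<And>t. t \<le> s0 \<Longrightarrow> 0 < bessel_log v t \<and> 0 < bessel_log' v t"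
    unfolding eventually_at_bot_linorder by blast
  have prod: "bessel_log v t * bessel_log' v t > 0" if "t \<le> 0" for t
  proof (cases "t \<le> s0")
    case False
    have "bessel_log v s0 * bessel_log' v s0 \<le> bessel_log v t * bessel_log' v t"
    proof (rule DERIV_nonneg_imp_nondecreasing[of s0 t "\<lambda>x. bessel_log v x * bessel_log' v x"])
      fix x assume x: "s0 \<le> x" "x \<le> t"
      then have "1 - exp (2 * x) \<ge> 0" using that by simp
      then have "(bessel_log' v x)\<^sup>2 + (real v)\<^sup>2 * (1 - exp (2 * x)) * (bessel_log v x)\<^sup>2 \<ge> 0"
        by simp
      moreover have "((\<lambda>x. bessel_log v x * bessel_log' v x) has_real_derivative
          (bessel_log' v x)\<^sup>2 + (real v)\<^sup>2 * (1 - exp (2 * x)) * (bessel_log v x)\<^sup>2) (at x)"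
        by (rule DERIV_cong[OF DERIV_mult[OF bessel_log_deriv bessel_log'_deriv]])
          (simp only: power2_eq_square algebra_simps)
      ultimately show "\<exists>y. ((\<lambda>x. bessel_log v x * bessel_log' v x) has_real_derivative y) (at x) \<and> 0 \<le> y"
        by blast
    qed (use False in auto)
    moreover have "bessel_log v s0 * bessel_log' v s0 > 0" using s0[of s0] by simp
    ultimately show ?thesis by linarith
  qed (use s0 in auto)
  have "bessel_log v s > 0"
  proof (rule ccontr)
    assume neg: "\<not> bessel_log v s > 0"
    then have "s0 \<le> s" using s0[of s] by force
    moreover have "continuous_on {s0..s} (bessel_log v)"
      using bessel_log_deriv by (intro DERIV_atLeastAtMost_imp_continuous_on) blast
    ultimately obtain x where "s0 \<le> x" "x \<le> s" "bessel_log v x = 0"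
      using IVT2'[of "bessel_log v" s 0 s0] neg s0[of s0] by auto
    with prod[of x] assms show False by simp
  qed
  then show "bessel_log v s > 0" "bessel_log' v s > 0"
    using prod[OF assms(2)] by (auto simp: zero_less_mult_iff)
qed

lemma bessel_log_mono:
  assumes "v > 0" "s \<le> t" "t \<le> 0" shows "bessel_log v s \<le> bessel_log v t"
  using assms(2)
proof (rule DERIV_nonneg_imp_nondecreasing)
  fix x assume "s \<le> x" "x \<le> t"
  then show "\<exists>y. (bessel_log v has_real_derivative y) (at x) \<and> 0 \<le> y"
    using bessel_log_deriv[of v x] bessel_log_pos(2)[of v x] assms by fastforce
qed

section \<open>Comparison with a WKB function before the turning point\<close>

text \<open>
  The second-order WKB approximation at \<open>s\<close> with \<open>T\<^sup>2 = 1 - e\<^sup>2\<^sup>s\<close>; \<open>wkb'\<close> is its logarithmic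
  derivative. The last term makes it a subsolution.
\<close>

definition wkb :: "real \<Rightarrow> real \<Rightarrow> real" where
  "wkb v s = (let T = sqrt (1 - exp (2 * s)) in
     exp (v * s + (v * (T - ln (1 + T)) - ln T / 2 - 5 / (24 * v * T ^ 3))))"

definition wkb' :: "real \<Rightarrow> real \<Rightarrow> real" where
  "wkb' v T = v * T + (1 - T\<^sup>2) / (2 * T\<^sup>2) - 5 / (8 * v) * (1 - T\<^sup>2) / T ^ 5"

lemma sqrt_exp_deriv:
  assumes "s < 0"
  shows "((\<lambda>s. sqrt (1 - exp (2 * s))) has_real_derivative
    - (1 - (sqrt (1 - exp (2 * s)))\<^sup>2) / sqrt (1 - exp (2 * s))) (at s)"
proof -
  have "1 - exp (2 * s) > 0" using assms by simp
  then show ?thesis by (auto intro!: derivative_eq_intros simp: field_simps)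
qed

text \<open>Since \<open>dT/ds = - (1 - T^2) / T\<close>, the phase
  \<open>v s + v (T - ln (1 + T))\<close> contributes \<open>v T\<close>, the amplitude
  \<open>T^(-1/2)\<close> contributes \<open>(1 - T^2) / (2 T^2)\<close>, and the correction gives
  the last term of \<open>wkb'\<close>.\<close>

lemma wkb_deriv:
  assumes "s < 0" "v > 0"
  shows "(wkb v has_real_derivative wkb' v (sqrt (1 - exp (2 * s))) * wkb v s) (at s)"
proof -
  define T where "T = sqrt (1 - exp (2 * s))"
  have T: "T > 0" using assms by (simp add: T_def)
  note D = sqrt_exp_deriv[OF assms(1), folded T_def]
  have "((\<lambda>T. v * (T - ln (1 + T)) - ln T / 2 - 5 / (24 * v * T ^ 3)) has_real_derivative
      v * T / (1 + T) - 1 / (2 * T) + 5 / (8 * v * T ^ 4)) (at T)"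
  proof -
    have "((\<lambda>T. v * (T - ln (1 + T))) has_real_derivative v * T / (1 + T)) (at T)"
      using T by (auto intro!: derivative_eq_intros simp: field_simps)
    moreover have "((\<lambda>T. ln T / 2) has_real_derivative 1 / (2 * T)) (at T)"
      using T by (auto intro!: derivative_eq_intros simp: field_simps)
    moreover have "((\<lambda>T. 5 / (24 * v * T ^ 3)) has_real_derivative - (5 / (8 * v * T ^ 4))) (at T)"
      using T assms by (auto intro!: derivative_eq_intros simp: field_simps eval_nat_numeral)
    ultimately show ?thesis
      by (rule DERIV_cong[OF DERIV_diff[OF DERIV_diff]]) simp
  qed
  from DERIV_chain2[OF this[unfolded T_def] sqrt_exp_deriv[OF assms(1)]]
  have D1: "((\<lambda>s. v * (sqrt (1 - exp (2 * s)) - ln (1 + sqrt (1 - exp (2 * s)))) - ln (sqrt (1 - exp (2 * s))) / 2 - 5 / (24 * v * sqrt (1 - exp (2 * s)) ^ 3))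
     has_real_derivative (v * T / (1 + T) - 1 / (2 * T) + 5 / (8 * v * T ^ 4)) * (- (1 - T\<^sup>2) / T)) (at s)"
    unfolding T_def .
  have D2: "((\<lambda>s. v * s) has_real_derivative v) (at s)" by (auto intro!: derivative_eq_intros)
  have "v + (v * T / (1 + T) - 1 / (2 * T) + 5 / (8 * v * T ^ 4)) * (- (1 - T\<^sup>2) / T) = wkb' v T"
  proof -
    have a: "v * T / (1 + T) * (- (1 - T\<^sup>2) / T) = - v * (1 - T)"
    proof -
      have 1: "1 - T\<^sup>2 = (1 + T) * (1 - T)" by (simp add: power2_eq_square algebra_simps)
      have 2: "v * T / w * (- (w * x) / T) = - v * x" if "w \<noteq> 0" for w x
        using T that by (simp add: field_simps)
      show ?thesis unfolding 1 using T by (intro 2) simp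
    qed
    have b: "1 / (2 * T) * (- (1 - T\<^sup>2) / T) = - ((1 - T\<^sup>2) / (2 * T\<^sup>2))"
      using T by (simp add: field_simps power2_eq_square)
    have c: "5 / (8 * v * T ^ 4) * (- (1 - T\<^sup>2) / T) = - (5 / (8 * v) * (1 - T\<^sup>2) / T ^ 5)"
      using T assms by (simp add: field_simps eval_nat_numeral)
    show ?thesis unfolding wkb'_def distrib_right left_diff_distrib a b c by (simp add: algebra_simps)
  qed
  with DERIV_chain2[OF DERIV_exp DERIV_add[OF D2 D1]] show ?thesis
    unfolding wkb_def[abs_def] Let_def T_def by (simp only: mult.commute)
qed

lemma wkb'_deriv:
  assumes "T > 0" "v > 0"
  shows "(wkb' v has_real_derivative v - 1 / T ^ 3 - 5 / (8 * v) * (- 5 / T ^ 6 + 3 / T ^ 4)) (at T)"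
proof -
  have eq: "wkb' v t = v * t + (1 / (2 * t\<^sup>2) - 1 / 2) - 5 / (8 * v) * (1 / t ^ 5 - 1 / t ^ 3)" if "t > 0" for t
    using that unfolding wkb'_def by (simp add: field_simps eval_nat_numeral)
  have "((\<lambda>t. v * t + (1 / (2 * t\<^sup>2) - 1 / 2) - 5 / (8 * v) * (1 / t ^ 5 - 1 / t ^ 3)) has_real_derivative
     v - 1 / T ^ 3 - 5 / (8 * v) * (- 5 / T ^ 6 + 3 / T ^ 4)) (at T)"
  proof -
    have 1: "((\<lambda>t. 1 / (2 * t\<^sup>2) - 1 / 2) has_real_derivative - 1 / T ^ 3) (at T)"
      using assms by (auto intro!: derivative_eq_intros simp: field_simps eval_nat_numeral)
    have 2: "((\<lambda>t. 1 / t ^ 5 - 1 / t ^ 3) has_real_derivative (- 5 / T ^ 6 + 3 / T ^ 4)) (at T)"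
      using assms by (auto intro!: derivative_eq_intros simp: field_simps eval_nat_numeral)
    have 3: "((\<lambda>t. v * t) has_real_derivative v) (at T)" by (auto intro!: derivative_eq_intros)
    show ?thesis
      by (rule DERIV_cong[OF DERIV_diff[OF DERIV_add[OF 3 1] DERIV_cmult[OF 2]]]) simp
  qed
  then show ?thesis
    by (rule has_field_derivative_transform_within_open[where S = "{0<..}"])
      (use assms eq in auto)
qed

text \<open>The left-hand side is \<open>g'' / g\<close> for \<open>g = wkb v\<close>. The terms of
  orders \<open>v^2\<close> and \<open>v\<close> cancel by the choice of phase and amplitude. The
  coefficient \<open>5/24\<close> in \<open>wkb\<close> is the most singular part of the first Debye
  coefficient \<open>(3 / T - 5 / T^3) / 24\<close>; with it the terms of order \<open>v^0\<close>
  add up to \<open>- y (1 - y) / (4 T^4)\<close>, where \<open>y = 1 - T^2\<close>. The lower bound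
  on \<open>T^3\<close> keeps the correction subordinate.\<close>

lemma wkb_subsolution:
  assumes T: "T > 0" "T \<le> 1" and v: "v > 0" "5 / (8 * v) \<le> T ^ 3"
  shows "- (1 - T\<^sup>2) / T * (v - 1 / T ^ 3 - 5 / (8 * v) * (- 5 / T ^ 6 + 3 / T ^ 4)) + (wkb' v T)\<^sup>2 \<le> v\<^sup>2 * T\<^sup>2"
proof -
  define b y where "b = 5 / (8 * v)" and "y = 1 - T\<^sup>2"
  have vb: "v * b = 5 / 8" using v by (simp add: b_def)
  have y: "0 \<le> y" "y \<le> 1" using T by (auto simp: y_def power_le_one)
  have b: "0 \<le> b" "b \<le> T ^ 3" using v by (auto simp: b_def)
  have W: "wkb' v T = v * T + y / (2 * T\<^sup>2) - b * y / T ^ 5"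
    by (simp add: wkb'_def b_def y_def)
  have "- y / T * (v - 1 / T ^ 3 - b * (- 5 / T ^ 6 + 3 / T ^ 4)) + (v * T + y / (2 * T\<^sup>2) - b * y / T ^ 5)\<^sup>2 - v\<^sup>2 * T\<^sup>2
     = y / T ^ 4 + y\<^sup>2 / (4 * T ^ 4) - 2 * (v * b) * y / T ^ 4 + b * y / T ^ 7 * (- 5 + 3 * T\<^sup>2 + b * y / T ^ 3 - y)"
    using T by (simp add: field_simps eval_nat_numeral)
  also have "\<dots> = - (y * (1 - y)) / (4 * T ^ 4) + b * y / T ^ 7 * (- 5 + 3 * T\<^sup>2 + b * y / T ^ 3 - y)"
    unfolding vb by (simp add: power2_eq_square diff_divide_distrib add_divide_distrib algebra_simps)
  also have "\<dots> \<le> 0"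
  proof -
    \<comment> \<open>Hence \<open>b * y / T^3 - y <= 0\<close>, and with \<open>T^2 <= 1\<close>
      the bracket is at most \<open>-2\<close>.\<close>
    have "b / T ^ 3 \<le> 1" using b T by simp
    then have "b / T ^ 3 * y \<le> 1 * y" using y by (intro mult_right_mono) auto
    moreover have "T\<^sup>2 \<le> 1" using T by (simp add: power_le_one)
    ultimately have "- 5 + 3 * T\<^sup>2 + b * y / T ^ 3 - y \<le> 0" by (simp add: mult_ac)
    then have "b * y / T ^ 7 * (- 5 + 3 * T\<^sup>2 + b * y / T ^ 3 - y) \<le> 0"
      using b y T by (intro mult_nonneg_nonpos) auto
    moreover have "- (y * (1 - y)) / (4 * T ^ 4) \<le> 0" using y T by simp
    ultimately show ?thesis by linarith
  qed
  finally show ?thesis unfolding W b_def[symmetric] y_def[symmetric] by simp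
qed

text \<open>Monotonicity on a half line, with the limit at minus infinity in place of the value at a
  left endpoint.\<close>

lemma deriv_nonneg_at_bot:
  fixes f :: "real \<Rightarrow> real"
  assumes "\<And>x. x \<le> b \<Longrightarrow> \<exists>y. (f has_real_derivative y) (at x) \<and> y \<ge> 0"
    and "(f \<longlongrightarrow> l) at_bot"
  shows "l \<le> f b"
proof (rule tendsto_upperbound[OF assms(2)])
  have "f x \<le> f b" if "x \<le> b" for x
    by (rule DERIV_nonneg_imp_nondecreasing[OF that]) (use assms(1) in auto)
  then show "\<forall>\<^sub>F x in at_bot. f x \<le> f b"
    unfolding eventually_at_bot_linorder by blast
qed simp

lemma wkb_at_bot:
  assumes "v > 0"
  shows "((\<lambda>s. exp (- (v * s)) * wkb v s) \<longlongrightarrow> exp (v * (1 - ln 2) - 5 / (24 * v))) at_bot"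
    and "((\<lambda>s. wkb' v (sqrt (1 - exp (2 * s)))) \<longlongrightarrow> v) at_bot"
proof -
  let ?T = "\<lambda>s::real. sqrt (1 - exp (2 * s))"
  have T: "(?T \<longlongrightarrow> 1) at_bot" by real_asymp
  have "((\<lambda>s. exp (v * (?T s - ln (1 + ?T s)) - ln (?T s) / 2 - 5 / (24 * v * ?T s ^ 3))) \<longlongrightarrow>
      exp (v * (1 - ln (1 + 1)) - ln 1 / 2 - 5 / (24 * v * 1 ^ 3))) at_bot"
    by (intro tendsto_intros T) (use assms in auto)
  moreover have "exp (- (v * s)) * wkb v s = exp (v * (?T s - ln (1 + ?T s)) - ln (?T s) / 2 - 5 / (24 * v * ?T s ^ 3))" for s
    unfolding wkb_def Let_def exp_add mult.assoc[symmetric] by (simp add: exp_minus)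
  ultimately show "((\<lambda>s. exp (- (v * s)) * wkb v s) \<longlongrightarrow> exp (v * (1 - ln 2) - 5 / (24 * v))) at_bot"
    by simp
  have "((\<lambda>s. wkb' v (?T s)) \<longlongrightarrow> v * 1 + (1 - 1\<^sup>2) / (2 * 1\<^sup>2) - 5 / (8 * v) * (1 - 1\<^sup>2) / 1 ^ 5) at_bot"
    unfolding wkb'_def by (intro tendsto_intros T) auto
  then show "((\<lambda>s. wkb' v (?T s)) \<longlongrightarrow> v) at_bot" by simp
qed

lemma wkb_pos: "wkb v s > 0"
  by (simp add: wkb_def Let_def)

text \<open>The Wronskian \<open>W = f' g - f g'\<close> has derivative
  \<open>f'' g - f g''\<close>, which is nonnegative by \<open>wkb_subsolution\<close>, and
  \<open>W\<close> tends to 0 at minus infinity. So \<open>W >= 0\<close> and \<open>f / g\<close>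
  is nondecreasing; the constant on the left is the limit of \<open>f / g\<close> at minus
  infinity.\<close>

lemma bessel_log_ge_wkb:
  assumes v: "v > 0" and b: "b < 0" "5 / (8 * real v) \<le> sqrt (1 - exp (2 * b)) ^ 3"
  shows "(real v / 2) ^ v / fact v / exp (v * (1 - ln 2) - 5 / (24 * real v)) * wkb v b \<le> bessel_log v b"
proof -
  let ?T = "\<lambda>s::real. sqrt (1 - exp (2 * s))"
  let ?f = "bessel_log v" and ?f' = "bessel_log' v" and ?g = "wkb v"
  let ?G = "\<lambda>s. wkb' v (?T s)"
  let ?W = "\<lambda>s. ?f' s * ?g s - ?f s * (?G s * ?g s)"
  note lf = bessel_log_at_bot[OF v] and lg = wkb_at_bot[of "real v"]
  have lim0: "((\<lambda>s::real. exp (2 * (v * s))) \<longlongrightarrow> 0) at_bot" using v by real_asymp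
  \<comment> \<open>Both functions are of order \<open>exp (v * s)\<close>, so each product in
    \<open>W\<close> is a vanishing exponential times a factor with a finite limit.\<close>
  have e: "x * y = exp (2 * (v * s)) * ((exp (- (v * s)) * x) * (exp (- (v * s)) * y))" for x y s :: real
  proof -
    have "exp (2 * (v * s)) * (exp (- (v * s)) * exp (- (v * s))) = 1"
      by (simp flip: exp_add)
    then show ?thesis by (simp add: mult_ac)
  qed
  have W_nonneg: "0 \<le> ?W x" if "x \<le> b" for x
  proof (rule deriv_nonneg_at_bot[of x ?W])
    have "((\<lambda>s::real. exp (2 * (v * s)) * ((exp (- (v * s)) * ?f' s) * (exp (- (v * s)) * ?g s)) -
        exp (2 * (v * s)) * ((exp (- (v * s)) * ?f s) * (exp (- (v * s)) * ?g s)) * ?G s) \<longlongrightarrow>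
        0 * (((real v / 2) ^ v * v / fact v) * exp (v * (1 - ln 2) - 5 / (24 * real v))) -
        0 * (((real v / 2) ^ v / fact v) * exp (v * (1 - ln 2) - 5 / (24 * real v))) * v) at_bot"
      using v by (intro tendsto_intros lim0 lf lg) simp_all
    then show "(?W \<longlongrightarrow> 0) at_bot"
      unfolding e[symmetric] by (simp add: mult_ac)
    fix s assume "s \<le> x"
    then have s: "s < 0" "s \<le> b" using that b by auto
    let ?Q = "(real v)\<^sup>2 * (1 - exp (2 * s))"
    let ?w = "real v - 1 / ?T s ^ 3 - 5 / (8 * real v) * (- 5 / ?T s ^ 6 + 3 / ?T s ^ 4)"
    let ?T' = "- (1 - (?T s)\<^sup>2) / ?T s"
    have T0: "?T s > 0" using s by simp
    have T1: "?T s \<le> 1" by simp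
    \<comment> \<open>\<open>T\<close> decreases as \<open>s\<close> approaches the turning point,
      so the hypothesis at \<open>b\<close> covers every earlier point.\<close>
    have "?T b ^ 3 \<le> ?T s ^ 3" using s b by (intro power_mono) auto
    with b have T2: "5 / (8 * real v) \<le> ?T s ^ 3" by linarith
    have G: "(?G has_real_derivative ?w * ?T') (at s)"
      using wkb'_deriv[OF T0, of "real v"] v
      by (intro DERIV_chain2[where f = "wkb' v"] sqrt_exp_deriv s) auto
    have g: "(?g has_real_derivative ?G s * ?g s) (at s)"
      using v s by (intro wkb_deriv) auto
    have D: "(?W has_real_derivative (?Q * ?f s * ?g s + (?G s * ?g s) * ?f' s)
        - (?f' s * (?G s * ?g s) + (?w * ?T' * ?g s + ?G s * ?g s * ?G s) * ?f s)) (at s)"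
      by (rule DERIV_diff[OF DERIV_mult[OF bessel_log'_deriv g] DERIV_mult[OF bessel_log_deriv DERIV_mult[OF G g]]])
    have eq: "(Q * f * g + (G * g) * f') - (f' * (G * g) + (w * T' * g + G * g * G) * f)
        = f * g * (Q - (T' * w + G\<^sup>2))" for Q f g f' G w T' :: real
      by (simp only: algebra_simps power2_eq_square)
    have "?T' * ?w + (?G s)\<^sup>2 \<le> (real v)\<^sup>2 * (?T s)\<^sup>2"
      using v T0 T1 T2 by (intro wkb_subsolution) auto
    moreover have "(real v)\<^sup>2 * (?T s)\<^sup>2 = ?Q" using s by simp
    ultimately have "?Q - (?T' * ?w + (?G s)\<^sup>2) \<ge> 0" by linarith
    moreover have "?f s * ?g s \<ge> 0" using bessel_log_pos(1)[OF v, of s] wkb_pos[of v s] s by simp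
    ultimately have "?f s * ?g s * (?Q - (?T' * ?w + (?G s)\<^sup>2)) \<ge> 0" by (rule mult_nonneg_nonneg[rotated])
    with D show "\<exists>y. (?W has_real_derivative y) (at s) \<and> 0 \<le> y" unfolding eq by blast
  qed
  have "(real v / 2) ^ v / fact v / exp (v * (1 - ln 2) - 5 / (24 * real v)) \<le> ?f b / ?g b"
  proof (rule deriv_nonneg_at_bot[of b "\<lambda>s. ?f s / ?g s"])
    have "((\<lambda>s::real. (exp (- (v * s)) * ?f s) / (exp (- (v * s)) * ?g s)) \<longlongrightarrow>
        (real v / 2) ^ v / fact v / exp (v * (1 - ln 2) - 5 / (24 * real v))) at_bot"
      using v by (intro tendsto_divide lf lg) auto
    then show "((\<lambda>s. ?f s / ?g s) \<longlongrightarrow> (real v / 2) ^ v / fact v / exp (v * (1 - ln 2) - 5 / (24 * real v))) at_bot"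
      by simp
    fix s assume s: "s \<le> b"
    have g: "(?g has_real_derivative ?G s * ?g s) (at s)"
      using v s b by (intro wkb_deriv) auto
    have "((\<lambda>s. ?f s / ?g s) has_real_derivative ?W s / (?g s * ?g s)) (at s)"
      using wkb_pos[of v s] by (intro DERIV_divide bessel_log_deriv g) simp
    moreover have "?W s / (?g s * ?g s) \<ge> 0" using W_nonneg[OF s] by simp
    ultimately show "\<exists>y. ((\<lambda>s. ?f s / ?g s) has_real_derivative y) (at s) \<and> 0 \<le> y" by blast
  qed
  then show ?thesis using wkb_pos[of v b] by (simp add: pos_le_divide_eq)
qed

section \<open>Stirling's upper bound and the size of the WKB function near the turning
  point\<close>

lemma ln_Suc_ge: "x > 0 \<Longrightarrow> (x + 1 / 2) * (ln (x + 1) - ln x) \<ge> (1 :: real)"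
proof -
  assume x: "x > 0"
  \<comment> \<open>For \<open>t = 1 / x\<close> the claim is
    \<open>ln (1 + t) >= 2 t / (2 + t)\<close>. The difference vanishes at 0 and has derivative
    \<open>t^2 / ((1 + t) (2 + t)^2)\<close>.\<close>
  have "ln (1 + 0) - 2 * 0 / (2 + 0) \<le> ln (1 + 1 / x) - 2 * (1 / x) / (2 + 1 / x)"
  proof (rule DERIV_nonneg_imp_nondecreasing[of 0 "1 / x" "\<lambda>t. ln (1 + t) - 2 * t / (2 + t)"])
    fix t assume t: "0 \<le> t" "t \<le> 1 / x"
    have "((\<lambda>t. ln (1 + t) - 2 * t / (2 + t)) has_real_derivative (1 / (1 + t) - 4 / (2 + t)\<^sup>2)) (at t)"
      using t by (auto intro!: derivative_eq_intros simp: power2_eq_square)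
    moreover have "1 / (1 + t) - 4 / (2 + t)\<^sup>2 = t\<^sup>2 / ((1 + t) * (2 + t)\<^sup>2)"
      using t by (simp add: divide_simps) (simp add: power2_eq_square algebra_simps)
    ultimately show "\<exists>y. ((\<lambda>t. ln (1 + t) - 2 * t / (2 + t)) has_real_derivative y) (at t) \<and> 0 \<le> y"
      using t by (intro exI[of _ "1 / (1 + t) - 4 / (2 + t)\<^sup>2"]) simp
  qed (use x in auto)
  moreover have "2 * (1 / x) / (2 + 1 / x) = 1 / (x + 1 / 2)" using x by (simp add: field_simps)
  moreover have "1 + 1 / x = (x + 1) / x" using x by (simp add: field_simps)
  ultimately have "1 / (x + 1 / 2) \<le> ln (x + 1) - ln x" using x by (simp add: ln_div)
  then have "(x + 1 / 2) * (1 / (x + 1 / 2)) \<le> (x + 1 / 2) * (ln (x + 1) - ln x)"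
    using x by (intro mult_left_mono) auto
  then show ?thesis using x by simp
qed

text \<open>Stirling in the form \<open>n! <= e * n^(n + 1/2) * exp (- n)\<close>. It is an equality
  at \<open>n = 1\<close>, and \<open>ln_Suc_ge\<close> is the induction step.\<close>

lemma ln_fact_le:
  assumes "n > 0" shows "ln (fact n) \<le> 1 + (real n + 1 / 2) * ln n - n"
  using assms
proof (induction n rule: nat_induct_non_zero)
  case (Suc n)
  have "ln (fact (Suc n)) = ln (real n + 1) + ln (fact n)"
    by (simp add: ln_mult add_ac)
  also have "\<dots> \<le> ln (real n + 1) + (1 + (real n + 1 / 2) * ln n - n)" using Suc by simp
  also have "\<dots> \<le> 1 + (real n + 1 + 1 / 2) * ln (real n + 1) - (real n + 1)"
    using ln_Suc_ge[of "real n"] Suc.hyps by (simp add: algebra_simps)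
  finally show ?case by (simp add: add_ac)
qed simp

text \<open>That is, \<open>artanh T <= T + T^3\<close>. The WKB exponent
  \<open>v * (T - artanh T)\<close> is therefore at least \<open>- v * T^3\<close>, which is
  constant when \<open>T\<close> is a multiple of \<open>v^(-1/3)\<close>.\<close>

lemma artanh_le:
  assumes "0 \<le> T" "T \<le> 1 / 2"
  shows "(ln (1 - T) - ln (1 + T)) / 2 + T + T ^ 3 \<ge> (0::real)"
proof -
  have "(ln (1 - 0) - ln (1 + 0)) / 2 + 0 + 0 ^ 3 \<le> (ln (1 - T) - ln (1 + T)) / 2 + T + T ^ 3"
    using assms(1)
  proof (rule DERIV_nonneg_imp_nondecreasing)
    fix t assume t: "0 \<le> t" "t \<le> T"
    then have t': "t < 1" "1 - t\<^sup>2 > 0" using assms by (auto simp: power_less_one_iff abs_square_less_1)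
    have D: "((\<lambda>T. (ln (1 - T) - ln (1 + T)) / 2 + T + T ^ 3) has_real_derivative
      (- (1 / (1 - t)) - 1 / (1 + t)) / 2 + 1 + 3 * t\<^sup>2) (at t)"
      using t t' by (auto intro!: derivative_eq_intros)
    have e1: "(- (1 / (1 - t)) - 1 / (1 + t)) / 2 = - (1 / (1 - t\<^sup>2))"
    proof -
      have *: "1 - t\<^sup>2 = (1 - t) * (1 + t)" by (simp add: power2_eq_square algebra_simps)
      show ?thesis unfolding * using t t' by (simp add: divide_simps)
    qed
    have e2: "- (1 / (1 - t\<^sup>2)) + 1 + 3 * t\<^sup>2 = t\<^sup>2 * (2 - 3 * t\<^sup>2) / (1 - t\<^sup>2)"
      using t' by (simp add: field_simps)
    have "t\<^sup>2 \<le> (1 / 2)\<^sup>2" using t assms by (intro power_mono) auto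
    then have nn: "t\<^sup>2 * (2 - 3 * t\<^sup>2) / (1 - t\<^sup>2) \<ge> 0"
      using t' by (intro divide_nonneg_nonneg mult_nonneg_nonneg) (auto simp: power2_eq_square)
    show "\<exists>y. ((\<lambda>T. (ln (1 - T) - ln (1 + T)) / 2 + T + T ^ 3) has_real_derivative y) (at t) \<and> 0 \<le> y"
      using D nn unfolding e1 e2 by blast
  qed
  then show ?thesis by simp
qed

text \<open>The choice of \<open>T\<close> gives \<open>v * T^3 = 8\<close>: large enough for
  \<open>bessel_log_ge_wkb\<close>, yet small enough to keep the WKB exponent bounded. Stirling
  contributes \<open>v^(-1/2)\<close> and the amplitude \<open>T^(-1/2)\<close> contributes
  \<open>v^(1/6)\<close>, together \<open>v^(-1/3)\<close>. The condition \<open>v >= 64\<close>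
  ensures \<open>T <= 1/2\<close> for \<open>artanh_le\<close>.\<close>

lemma bessel_log_transition_ge:
  assumes "v \<ge> 64"
  defines "T \<equiv> 2 * real v powr (- 1 / 3)"
  shows "bessel_log v (ln (1 - T\<^sup>2) / 2) \<ge> exp (- 11) * real v powr (- 1 / 3)"
proof -
  have v: "v > 0" using assms by simp
  have T0: "T > 0" using v by (simp add: T_def)
  have "real v powr (- 1 / 3) \<le> 64 powr (- 1 / 3)"
    using assms by (intro powr_mono2') auto
  also have "64 powr (- 1 / 3) = (1 / 4 :: real)"
  proof -
    have "(64::real) = 4 powr 3" by simp
    then have "(64::real) powr (- 1 / 3) = 4 powr (- 1)" by (simp only: powr_powr) simp
    then show ?thesis by (simp add: powr_minus_divide)
  qed
  finally have T1: "T \<le> 1 / 2" by (simp add: T_def)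
  have "T ^ 3 = 8 * (real v powr (- 1 / 3)) ^ 3" by (simp add: T_def power_mult_distrib)
  also have "(real v powr (- 1 / 3)) ^ 3 = real v powr (- 1 / 3 * 3)"
    using v by (subst powr_realpow[symmetric]) (auto simp: powr_powr)
  finally have T3: "T ^ 3 = 8 / v" using v by (simp add: powr_minus_divide)
  have T2: "T\<^sup>2 \<le> (1 / 2)\<^sup>2" using T0 T1 by (intro power_mono) auto
  then have T2': "0 < 1 - T\<^sup>2" by (simp add: power2_eq_square)
  define b where "b = ln (1 - T\<^sup>2) / 2"
  have eb: "exp (2 * b) = 1 - T\<^sup>2" using T2' by (simp add: b_def)
  have sq: "sqrt (1 - exp (2 * b)) = T" using T0 by (simp add: eb)
  have b0: "b < 0" using T2' T0 by (simp add: b_def ln_less_zero_iff)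
  have "1 - T\<^sup>2 = (1 - T) * (1 + T)" by (simp add: power2_eq_square algebra_simps)
  then have b_eq: "b = (ln (1 - T) + ln (1 + T)) / 2" using T0 T1 by (simp add: b_def ln_mult)
  have ge: "(real v / 2) ^ v / fact v / exp (v * (1 - ln 2) - 5 / (24 * real v)) * wkb v b \<le> bessel_log v b"
  proof (rule bessel_log_ge_wkb[OF v b0])
    show "5 / (8 * real v) \<le> sqrt (1 - exp (2 * b)) ^ 3"
      unfolding sq T3 using v by (simp add: field_simps)
  qed
  have "v * ((ln (1 - T) - ln (1 + T)) / 2 + T + T ^ 3) \<ge> 0"
    using artanh_le[of T] T0 T1 by (intro mult_nonneg_nonneg) auto
  moreover have "v * T ^ 3 = 8" using v T3 by simp
  ultimately have A: "v * ((ln (1 - T) - ln (1 + T)) / 2 + T) \<ge> - 8" by (simp add: algebra_simps)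
  have lnT: "ln T = ln 2 - ln v / 3" using v by (simp add: T_def ln_mult ln_powr)
  have ln2: "ln 2 \<le> (1::real)" using ln_le_minus_one[of "2::real"] by simp
  have "24 * v * T ^ 3 = 192" using v T3 by simp
  then have w: "wkb v b = exp (v * ((ln (1 - T) - ln (1 + T)) / 2 + T) - ln T / 2 - 5 / 192)"
    unfolding wkb_def Let_def sq by (simp add: b_eq algebra_simps)
  have "(real v / 2) ^ v = exp (v * ln (real v / 2))" using v by (simp add: exp_of_nat_mult)
  then have 1: "(real v / 2) ^ v = exp (v * ln v - v * ln 2)" using v by (simp add: ln_div algebra_simps)
  have 2: "fact v = exp (ln (fact v :: real))" by simp
  \<comment> \<open>The 11 covers 8 from the exponent, 1 from Stirling, at most \<open>1/2\<close>
    from \<open>ln 2 / 2\<close>, and \<open>5/192\<close>.\<close>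
  have "- 11 - ln v / 3 \<le> (v * ln v - v * ln 2) - ln (fact v) - (v * (1 - ln 2) - 5 / (24 * real v))
      + (v * ((ln (1 - T) - ln (1 + T)) / 2 + T) - ln T / 2 - 5 / 192)"
  proof -
    have "5 / (24 * real v) \<ge> 0" by simp
    moreover have "v * (1 - ln 2) = v - v * ln 2" by (simp add: algebra_simps)
    moreover have "ln (fact v) \<le> 1 + (v * ln v + ln v / 2) - real v"
      using ln_fact_le[OF v] by (simp add: algebra_simps)
    ultimately show ?thesis using A ln2 unfolding lnT by argo
  qed
  then have "exp (- 11 - ln v / 3) \<le> exp ((v * ln v - v * ln 2) - ln (fact v) - (v * (1 - ln 2) - 5 / (24 * real v))
      + (v * ((ln (1 - T) - ln (1 + T)) / 2 + T) - ln T / 2 - 5 / 192))"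
    by simp
  also have "\<dots> = (real v / 2) ^ v / fact v / exp (v * (1 - ln 2) - 5 / (24 * real v)) * wkb v b"
    unfolding w 1 by (simp add: exp_add exp_diff)
  also note ge
  also have "exp (- 11 - ln v / 3) = exp (- 11) * real v powr (- 1 / 3)"
    using v by (simp add: powr_def flip: exp_add)
  finally show ?thesis unfolding b_def .
qed

text \<open>While \<open>f >= 0\<close>, the equation makes \<open>f\<close> concave, so
  \<open>f\<close> lies below its tangent \<open>f0 + f1 x\<close> at 0. Inserting this into the
  equation and integrating twice bounds the loss:
  \<open>f(t) >= f0 (1 - a t^3 / 6) + f1 t (1 - a t^3 / 12)\<close> with
  \<open>a t^3 <= 11/5\<close>, and the first factor still exceeds \<open>1/2\<close>.\<close>

lemma bessel_log_concave:
  assumes v: "v > 0" and t: "0 \<le> t" "v\<^sup>2 * t ^ 3 \<le> 1" "t \<le> 1 / 20"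
    and nonneg: "\<And>x. 0 \<le> x \<Longrightarrow> x \<le> t \<Longrightarrow> bessel_log v x \<ge> 0"
  shows "bessel_log v t \<ge> bessel_log v 0 / 2"
proof -
  \<comment> \<open>The factor \<open>11/5\<close> comes from
    \<open>exp (2 y) - 1 <= 2 y + (2 y)^2 <= 11/5 * y\<close> for
    \<open>0 <= y <= 1/20\<close>.\<close>
  define a f0 f1 where "a = 11 / 5 * (real v)\<^sup>2" and "f0 = bessel_log v 0" and "f1 = bessel_log' v 0"
  have f0: "f0 > 0" "f1 > 0" using bessel_log_pos[OF v, of 0] by (auto simp: f0_def f1_def)
  have a0: "a \<ge> 0" by (simp add: a_def)
  have f'_le: "bessel_log' v x \<le> f1" if "0 \<le> x" "x \<le> t" for x
    unfolding f1_def
  proof (rule DERIV_nonpos_imp_nonincreasing[OF that(1)])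
    fix y assume "0 \<le> y" "y \<le> x"
    then have "(real v)\<^sup>2 * (1 - exp (2 * y)) * bessel_log v y \<le> 0"
      using that nonneg[of y] by (intro mult_nonpos_nonneg mult_nonneg_nonpos) auto
    then show "\<exists>z. (bessel_log' v has_real_derivative z) (at y) \<and> z \<le> 0"
      using bessel_log'_deriv by blast
  qed
  have f_le: "bessel_log v x \<le> f0 + f1 * x" if "0 \<le> x" "x \<le> t" for x
  proof -
    have "bessel_log v x - f1 * x \<le> bessel_log v 0 - f1 * 0"
    proof (rule DERIV_nonpos_imp_nonincreasing[OF that(1)])
      fix y assume y: "0 \<le> y" "y \<le> x"
      have "((\<lambda>x. bessel_log v x - f1 * x) has_real_derivative bessel_log' v y - f1) (at y)"
        by (rule DERIV_cong[OF DERIV_diff[OF bessel_log_deriv DERIV_cmult[OF DERIV_ident]]]) simp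
      then show "\<exists>z. ((\<lambda>x. bessel_log v x - f1 * x) has_real_derivative z) (at y) \<and> z \<le> 0"
        using f'_le[of y] y that by (intro exI conjI) auto
    qed
    then show ?thesis by (simp add: f0_def)
  qed
  have f'_ge: "bessel_log' v x \<ge> f1 - a * (f0 * x\<^sup>2 / 2 + f1 * x ^ 3 / 3)" if "0 \<le> x" "x \<le> t" for x
  proof -
    have "bessel_log' v 0 + a * (f0 * 0\<^sup>2 / 2 + f1 * 0 ^ 3 / 3) \<le> bessel_log' v x + a * (f0 * x\<^sup>2 / 2 + f1 * x ^ 3 / 3)"
    proof (rule DERIV_nonneg_imp_nondecreasing[OF that(1)])
      fix y assume y: "0 \<le> y" "y \<le> x"
      have P: "((\<lambda>x. a * (f0 * x\<^sup>2 / 2 + f1 * x ^ 3 / 3)) has_real_derivative a * (f0 * y + f1 * y\<^sup>2)) (at y)"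
        by (auto intro!: derivative_eq_intros)
      have "exp (2 * y) \<le> 1 + 2 * y + (2 * y)\<^sup>2" using y that t by (intro exp_bound) auto
      moreover have "(2 * y)\<^sup>2 \<le> y / 5"
      proof -
        have "y * y \<le> y * (1 / 20)" using y that t by (intro mult_left_mono) auto
        then show ?thesis by (simp add: power2_eq_square)
      qed
      ultimately have "exp (2 * y) - 1 \<le> 11 / 5 * y" by simp
      then have "(exp (2 * y) - 1) * bessel_log v y \<le> 11 / 5 * y * (f0 + f1 * y)"
        using y that nonneg[of y] f_le[of y] by (intro mult_mono) auto
      then have "(real v)\<^sup>2 * ((exp (2 * y) - 1) * bessel_log v y) \<le> (real v)\<^sup>2 * (11 / 5 * y * (f0 + f1 * y))"
        by (intro mult_left_mono) auto
      moreover have "a * (f0 * y + f1 * y\<^sup>2) = (real v)\<^sup>2 * (11 / 5 * y * (f0 + f1 * y))"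
        by (simp add: a_def algebra_simps power2_eq_square)
      moreover have "w * (1 - E) * F = - (w * ((E - 1) * F))" for w E F :: real
        by (simp add: algebra_simps)
      ultimately have "(real v)\<^sup>2 * (1 - exp (2 * y)) * bessel_log v y + a * (f0 * y + f1 * y\<^sup>2) \<ge> 0"
        by simp
      then show "\<exists>z. ((\<lambda>x. bessel_log' v x + a * (f0 * x\<^sup>2 / 2 + f1 * x ^ 3 / 3)) has_real_derivative z) (at y) \<and> 0 \<le> z"
        using DERIV_add[OF bessel_log'_deriv P] by blast
    qed
    then show ?thesis by (simp add: f1_def)
  qed
  have "bessel_log v 0 - f1 * 0 + a * (f0 * 0 ^ 3 / 6 + f1 * 0 ^ 4 / 12) \<le> bessel_log v t - f1 * t + a * (f0 * t ^ 3 / 6 + f1 * t ^ 4 / 12)"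
  proof (rule DERIV_nonneg_imp_nondecreasing[OF t(1)])
    fix y assume y: "0 \<le> y" "y \<le> t"
    have P: "((\<lambda>x. a * (f0 * x ^ 3 / 6 + f1 * x ^ 4 / 12)) has_real_derivative a * (f0 * y\<^sup>2 / 2 + f1 * y ^ 3 / 3)) (at y)"
      by (auto intro!: derivative_eq_intros)
    show "\<exists>z. ((\<lambda>x. bessel_log v x - f1 * x + a * (f0 * x ^ 3 / 6 + f1 * x ^ 4 / 12)) has_real_derivative z) (at y) \<and> 0 \<le> z"
      using DERIV_add[OF DERIV_diff[OF bessel_log_deriv DERIV_cmult[OF DERIV_ident, of f1]] P] f'_ge[OF y]
      by (intro exI conjI) auto
  qed
  then have ge: "bessel_log v t \<ge> f0 + f1 * t - (f0 * (a * t ^ 3) / 6 + f1 * t * (a * t ^ 3) / 12)"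
    by (simp add: f0_def algebra_simps eval_nat_numeral)
  have at: "a * t ^ 3 \<le> 11 / 5" using t by (simp add: a_def mult_ac)
  have lin: "l \<ge> f0 / 2" if "l \<ge> f0 + r - (p / 6 + q / 12)" "p \<le> f0 * (11 / 5)" "q \<le> r * (11 / 5)" "r \<ge> 0" for l p q r
    using that f0(1) by linarith
  have "f0 * (a * t ^ 3) \<le> f0 * (11 / 5)" "(f1 * t) * (a * t ^ 3) \<le> (f1 * t) * (11 / 5)" "f1 * t \<ge> 0"
    using at f0 t by (auto intro!: mult_left_mono)
  from lin[OF ge this] show ?thesis unfolding f0_def[symmetric] .
qed

text \<open>Up to the first point where \<open>f\<close> is nonpositive,
  \<open>bessel_log_concave\<close> applies and gives at least half of the positive value at 0, even
  at that point. So no such point exists and the sign hypothesis of that lemma is automatic.\<close>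

lemma bessel_log_after:
  assumes v: "v > 0" and t: "0 \<le> t" "v\<^sup>2 * t ^ 3 \<le> 1" "t \<le> 1 / 20"
  shows "bessel_log v t \<ge> bessel_log v 0 / 2"
proof -
  have f0: "bessel_log v 0 > 0" using bessel_log_pos[OF v, of 0] by simp
  have cont: "continuous_on A (bessel_log v)" for A
    using bessel_log_deriv by (meson DERIV_continuous_on has_field_derivative_at_within)
  have mono: "(real v)\<^sup>2 * x ^ 3 \<le> 1" if "0 \<le> x" "x \<le> t" for x
  proof -
    have "(real v)\<^sup>2 * x ^ 3 \<le> (real v)\<^sup>2 * t ^ 3" using that by (intro mult_left_mono power_mono) auto
    with t show ?thesis by simp
  qed
  have "bessel_log v x > 0" if x: "0 \<le> x" "x \<le> t" for x
  proof (rule ccontr)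
    assume neg: "\<not> bessel_log v x > 0"
    define S where "S = {y \<in> {0..t}. bessel_log v y \<le> 0}"
    have "S = {0..t} \<inter> bessel_log v -` {..0}" by (auto simp: S_def)
    then have "closed S" by (metis cont closed_atLeastAtMost closed_atMost continuous_closed_preimage)
    moreover have "bounded S" by (rule bounded_subset[OF bounded_closed_interval[of 0 t]]) (auto simp: S_def)
    ultimately have "compact S" by (simp add: compact_eq_bounded_closed)
    moreover have "S \<noteq> {}" using x neg by (auto simp: S_def)
    ultimately obtain z where z: "z \<in> S" "\<And>y. y \<in> S \<Longrightarrow> z \<le> y" using compact_attains_inf by metis
    have "bessel_log v y \<ge> 0" if "0 \<le> y" "y < z" for y
      using z(2)[of y] z(1) that by (force simp: S_def)
    moreover have "bessel_log v z \<ge> 0"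
    proof (rule ccontr)
      assume "\<not> bessel_log v z \<ge> 0"
      then obtain y where "0 \<le> y" "y \<le> z" "bessel_log v y = 0"
        using IVT2'[of "bessel_log v" z 0 0] z(1) f0 cont by (auto simp: S_def)
      then show False using z \<open>\<not> bessel_log v z \<ge> 0\<close> by (force simp: S_def)
    qed
    ultimately have "bessel_log v y \<ge> 0" if "0 \<le> y" "y \<le> z" for y using that by (cases "y = z") auto
    then have "bessel_log v z \<ge> bessel_log v 0 / 2"
      using v z(1) t mono by (intro bessel_log_concave) (auto simp: S_def)
    with z(1) f0 show False by (simp add: S_def)
  qed
  then show ?thesis using v t by (intro bessel_log_concave) (auto intro: less_imp_le)
qed

text \<open>With \<open>h = v^(-2/3)\<close> the window is \<open>|x / v - 1| < h\<close>. Up to the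
  turning point monotonicity carries the bound over from one point to its left; beyond it,
  \<open>s <= h\<close> and \<open>v^2 * h^3 = 1\<close> meet the hypothesis of
  \<open>bessel_log_after\<close>, at the cost of a factor 2. The size of \<open>v\<close> makes
  \<open>h <= 10^(-4)\<close>.\<close>

lemma bessel_J_transition_ge:
  assumes v: "v \<ge> 1000000" and x: "\<bar>x - real v\<bar> < real v powr (1 / 3)"
  shows "bessel_J v x \<ge> exp (- 11) / 2 * real v powr (- 1 / 3)"
proof -
  define h where "h = real v powr (- 2 / 3)"
  have v0: "v > 0" using v by simp
  have "h \<le> 1000000 powr (- 2 / 3)" unfolding h_def using v by (intro powr_mono2') auto
  also have "1000000 powr (- 2 / 3) = (1 / 10000 :: real)"
  proof -
    have "(1000000::real) = 100 powr 3" by simp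
    then have "(1000000::real) powr (- 2 / 3) = 100 powr (- 2)" by (simp only: powr_powr) simp
    then show ?thesis by (simp add: powr_minus_divide)
  qed
  finally have h: "0 < h" "h \<le> 1 / 10000" using v0 by (auto simp: h_def)
  have vh: "real v powr (1 / 3) = v * h"
    using v0 by (simp add: h_def powr_mult_base)
  have hv: "(real v)\<^sup>2 * h ^ 3 = 1"
  proof -
    have "h ^ 3 = real v powr (- 2)" using v0 h by (simp add: h_def powr_powr flip: powr_realpow)
    then show ?thesis using v0 by (simp add: powr_minus_divide)
  qed
  define s where "s = ln (x / v)"
  have xv: "x / v > 1 - h" "x / v < 1 + h" using x v0 unfolding vh by (auto simp: field_simps abs_less_iff)
  then have x0: "x / v > 0" using h by simp
  then have "x = v * exp s" using v0 by (simp add: s_def)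
  then have J: "bessel_J v x = bessel_log v s" using bessel_J_eq_log[OF v0] by simp
  define T where "T = 2 * real v powr (- 1 / 3)"
  have "T\<^sup>2 = 4 * h" using v0 by (simp add: T_def h_def power_mult_distrib powr_powr flip: powr_realpow)
  have "exp (- 11) * real v powr (- 1 / 3) \<le> bessel_log v (ln (1 - T\<^sup>2) / 2)"
    unfolding T_def using v by (intro bessel_log_transition_ge) simp
  \<comment> \<open>Since \<open>T^2 = 4 h\<close> and \<open>1 - 4 h <= (1 - h)^2\<close>, the
    point where the WKB bound is known lies to the left of the whole window.\<close>
  also have "ln (1 - T\<^sup>2) / 2 \<le> ln (1 - h)"
  proof -
    have "1 - 4 * h \<le> (1 - h)\<^sup>2" using h by (simp add: power2_eq_square algebra_simps)
    then have "ln (1 - 4 * h) \<le> ln ((1 - h)\<^sup>2)" using h by (subst ln_le_cancel_iff) auto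
    then show ?thesis using h \<open>T\<^sup>2 = 4 * h\<close> by (simp add: ln_realpow)
  qed
  then have "bessel_log v (ln (1 - T\<^sup>2) / 2) \<le> bessel_log v (min s 0)"
  proof (intro bessel_log_mono v0)
    have "ln (1 - h) \<le> ln (x / v)" "ln (1 - h) \<le> 0" using xv x0 h by auto
    then show "ln (1 - T\<^sup>2) / 2 \<le> min s 0" if "ln (1 - T\<^sup>2) / 2 \<le> ln (1 - h)"
      using that by (simp add: s_def)
  qed auto
  finally have *: "exp (- 11) * real v powr (- 1 / 3) \<le> bessel_log v (min s 0)" .
  show ?thesis
  proof (cases "s \<le> 0")
    case True
    then have "exp (- 11) / 2 * real v powr (- 1 / 3) \<le> exp (- 11) * real v powr (- 1 / 3)" by simp
    also note *
    finally show ?thesis using True by (simp add: J)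
  next
    case False
    have "s \<le> x / v - 1" unfolding s_def using x0 by (rule ln_le_minus_one)
    with xv have sh: "s \<le> h" by simp
    have "(real v)\<^sup>2 * s ^ 3 \<le> (real v)\<^sup>2 * h ^ 3"
      using False sh by (intro mult_left_mono power_mono) auto
    then have "bessel_log v 0 / 2 \<le> bessel_log v s"
      using False sh h hv v0 by (intro bessel_log_after) auto
    with * False show ?thesis by (simp add: J)
  qed
qed

section \<open>The modular group\<close>

abbreviation "HH \<equiv> upper_half_plane"

lemma HH_iff: "z \<in> HH \<longleftrightarrow> Im z > 0"
  by (simp add: upper_half_plane_def)

lemma open_HH: "open HH"
  unfolding upper_half_plane_def by (rule open_halfspace_Im_gt)

definition mat2 :: "int \<Rightarrow> int \<Rightarrow> int \<Rightarrow> int \<Rightarrow> int ^ 2 ^ 2" where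
  "mat2 a b c d = vector [vector [a, b], vector [c, d]]"

lemma mat2_nth [simp]:
  "mat2 a b c d $ 1 $ 1 = a" "mat2 a b c d $ 1 $ 2 = b"
  "mat2 a b c d $ 2 $ 1 = c" "mat2 a b c d $ 2 $ 2 = d"
  by (simp_all add: mat2_def)

lemma mat2_eqI:
  fixes A B :: "int ^ 2 ^ 2"
  assumes "A $ 1 $ 1 = B $ 1 $ 1" "A $ 1 $ 2 = B $ 1 $ 2" "A $ 2 $ 1 = B $ 2 $ 1" "A $ 2 $ 2 = B $ 2 $ 2"
  shows "A = B"
  using assms by (simp add: vec_eq_iff forall_2)

lemma mat2_mult_nth:
  fixes A B :: "int ^ 2 ^ 2"
  shows "(A ** B) $ i $ j = A $ i $ 1 * B $ 1 $ j + A $ i $ 2 * B $ 2 $ j"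
  by (simp add: matrix_matrix_mult_def sum_2)

lemma mat_1_nth [simp]:
  "(mat 1 :: int ^ 2 ^ 2) $ 1 $ 1 = 1" "(mat 1 :: int ^ 2 ^ 2) $ 1 $ 2 = 0"
  "(mat 1 :: int ^ 2 ^ 2) $ 2 $ 1 = 0" "(mat 1 :: int ^ 2 ^ 2) $ 2 $ 2 = 1"
  by (simp_all add: mat_def)

lemma SL2Z_iff: "A \<in> SL2Z \<longleftrightarrow> A $ 1 $ 1 * A $ 2 $ 2 - A $ 1 $ 2 * A $ 2 $ 1 = 1"
  by (simp add: SL2Z_def det_2)

lemma Gamma0_subset: "A \<in> Gamma0 N \<Longrightarrow> A \<in> SL2Z"
  by (simp add: Gamma0_def)

definition adj :: "int ^ 2 ^ 2 \<Rightarrow> int ^ 2 ^ 2" where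
  "adj A = mat2 (A $ 2 $ 2) (- A $ 1 $ 2) (- A $ 2 $ 1) (A $ 1 $ 1)"

lemma adj_nth [simp]:
  "adj A $ 1 $ 1 = A $ 2 $ 2" "adj A $ 1 $ 2 = - A $ 1 $ 2"
  "adj A $ 2 $ 1 = - A $ 2 $ 1" "adj A $ 2 $ 2 = A $ 1 $ 1"
  by (simp_all add: adj_def)

lemma adj_mult: "A \<in> SL2Z \<Longrightarrow> A ** adj A = mat 1" "A \<in> SL2Z \<Longrightarrow> adj A ** A = mat 1"
  by (rule mat2_eqI; simp add: mat2_mult_nth SL2Z_iff algebra_simps)+

lemma adj_adj [simp]: "adj (adj A) = A"
  by (rule mat2_eqI) simp_all

lemma SL2Z_closed:
  "mat 1 \<in> SL2Z" "A \<in> SL2Z \<Longrightarrow> adj A \<in> SL2Z" "A \<in> SL2Z \<Longrightarrow> B \<in> SL2Z \<Longrightarrow> A ** B \<in> SL2Z"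
  by (simp add: SL2Z_iff, simp add: SL2Z_iff algebra_simps, simp add: SL2Z_def det_mul)

lemma Gamma0_closed:
  "mat 1 \<in> Gamma0 N" "A \<in> Gamma0 N \<Longrightarrow> adj A \<in> Gamma0 N"
  "A \<in> Gamma0 N \<Longrightarrow> B \<in> Gamma0 N \<Longrightarrow> A ** B \<in> Gamma0 N"
  using SL2Z_closed by (auto simp: Gamma0_def mat2_mult_nth)

lemma aut_factor_neq_0:
  assumes "A \<in> SL2Z" "z \<in> HH" shows "aut_factor A z \<noteq> 0"
proof
  assume 0: "aut_factor A z = 0"
  then have "Im (aut_factor A z) = 0" "Re (aut_factor A z) = 0" by simp_all
  then have "A $ 2 $ 1 = 0" "A $ 2 $ 2 = 0"
    using assms by (auto simp: aut_factor_def HH_iff)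
  with assms show False by (simp add: SL2Z_iff)
qed

lemma Im_moebius:
  assumes "A \<in> SL2Z" "z \<in> HH"
  shows "Im (moebius A z) = Im z / (norm (aut_factor A z))\<^sup>2"
proof -
  define a b c d where abcd: "a = real_of_int (A $ 1 $ 1)" "b = real_of_int (A $ 1 $ 2)"
    "c = real_of_int (A $ 2 $ 1)" "d = real_of_int (A $ 2 $ 2)"
  have "real_of_int (A $ 1 $ 1 * A $ 2 $ 2 - A $ 1 $ 2 * A $ 2 $ 1) = 1"
    using assms(1) unfolding SL2Z_iff by simp
  then have det: "a * d - b * c = 1" by (simp add: abcd)
  have "Im (moebius A z) = (a * Im z * (c * Re z + d) - (a * Re z + b) * (c * Im z)) / (norm (aut_factor A z))\<^sup>2"
    by (simp add: moebius_def aut_factor_def Im_divide abcd cmod_power2)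
  also have "a * Im z * (c * Re z + d) - (a * Re z + b) * (c * Im z) = (a * d - b * c) * Im z"
    by (simp add: algebra_simps)
  finally show ?thesis by (simp add: det)
qed

lemma moebius_in_HH: "A \<in> SL2Z \<Longrightarrow> z \<in> HH \<Longrightarrow> moebius A z \<in> HH"
  using aut_factor_neq_0[of A z] by (auto simp: HH_iff Im_moebius)

lemma aut_factor_mult:
  assumes "B \<in> SL2Z" "z \<in> HH"
  shows "aut_factor (A ** B) z = aut_factor A (moebius B z) * aut_factor B z"
  using aut_factor_neq_0[OF assms]
  by (simp add: moebius_def aut_factor_def[of A] distrib_right) 
     (simp add: aut_factor_def mat2_mult_nth algebra_simps)

lemma moebius_mult:
  assumes "A \<in> SL2Z" "B \<in> SL2Z" "z \<in> HH"
  shows "moebius (A ** B) z = moebius A (moebius B z)"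
proof -
  have nz: "aut_factor B z \<noteq> 0" "aut_factor A (moebius B z) \<noteq> 0"
    using assms aut_factor_neq_0 moebius_in_HH by auto
  have e: "(of_int (A $ 1 $ 1) * moebius B z + of_int (A $ 1 $ 2)) * aut_factor B z
      = of_int ((A ** B) $ 1 $ 1) * z + of_int ((A ** B) $ 1 $ 2)"
    using nz(1) by (simp add: moebius_def distrib_right) (simp add: aut_factor_def mat2_mult_nth algebra_simps)
  then show ?thesis
    unfolding moebius_def[of "A ** B"] moebius_def[of A] aut_factor_mult[OF assms(2,3)] e[symmetric]
    using nz by simp
qed

lemma moebius_1 [simp]: "moebius (mat 1) z = z"
  by (simp add: moebius_def aut_factor_def)

lemma moebius_adj:
  assumes "A \<in> SL2Z" "z \<in> HH" shows "moebius (adj A) (moebius A z) = z" "moebius A (moebius (adj A) z) = z"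
  using moebius_mult[OF SL2Z_closed(2) _ assms(2), of A A] moebius_mult[OF _ SL2Z_closed(2) assms(2), of A A] assms
  by (simp_all add: adj_mult)

lemma aut_factor_adj:
  assumes "A \<in> SL2Z" "z \<in> HH" shows "aut_factor (adj A) (moebius A z) * aut_factor A z = 1"
  using aut_factor_mult[of A z "adj A"] assms by (simp add: adj_mult) (simp add: aut_factor_def)

lemma slash_mult:
  assumes "A \<in> SL2Z" "B \<in> SL2Z" "z \<in> HH"
  shows "slash k f (A ** B) z = slash k (slash k f A) B z"
  using assms by (simp add: slash_def moebius_mult aut_factor_mult power_mult_distrib)

definition transl :: "int \<Rightarrow> int ^ 2 ^ 2" where
  "transl n = mat2 1 n 0 1"

lemma transl_nth [simp]:
  "transl n $ 1 $ 1 = 1" "transl n $ 1 $ 2 = n" "transl n $ 2 $ 1 = 0" "transl n $ 2 $ 2 = 1"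
  by (simp_all add: transl_def)

lemma transl_Gamma0 [simp]: "transl n \<in> Gamma0 N" and transl_SL2Z [simp]: "transl n \<in> SL2Z"
  by (simp_all add: Gamma0_def SL2Z_iff)

lemma moebius_transl [simp]: "moebius (transl n) z = z + of_int n"
  and aut_factor_transl [simp]: "aut_factor (transl n) z = 1"
  by (simp_all add: moebius_def aut_factor_def)

lemma SL2Z_row_exists:
  assumes "coprime c d"
  obtains A where "A \<in> SL2Z" "A $ 2 $ 1 = c" "A $ 2 $ 2 = d"
proof -
  obtain x y where "x * c + y * d = 1"
    using assms bezout_int[of c d] by (auto simp: coprime_iff_gcd_eq_1)
  then have "mat2 y (- x) c d \<in> SL2Z" by (simp add: SL2Z_iff algebra_simps)
  then show ?thesis by (rule that) simp_all
qed

lemma SL2Z_row_coprime: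
  assumes "A \<in> SL2Z" shows "coprime (A $ 2 $ 1) (A $ 2 $ 2)"
proof (rule coprimeI)
  fix g assume g: "g dvd A $ 2 $ 1" "g dvd A $ 2 $ 2"
  have "g dvd A $ 1 $ 1 * A $ 2 $ 2 - A $ 1 $ 2 * A $ 2 $ 1"
    using g by (intro dvd_diff dvd_mult) auto
  then show "is_unit g" using assms by (simp add: SL2Z_iff)
qed

text \<open>\<open>A ** adj B\<close> has bottom row \<open>(0, 1)\<close> and determinant 1, so it
  is a translation. Coprime bottom rows therefore parametrise the cosets of the
  translations.\<close>

lemma SL2Z_same_row:
  assumes "A \<in> SL2Z" "B \<in> SL2Z" "A $ 2 $ 1 = B $ 2 $ 1" "A $ 2 $ 2 = B $ 2 $ 2"
  obtains n where "A = transl n ** B"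
proof -
  define n where "n = (A ** adj B) $ 1 $ 2"
  have row: "(A ** adj B) $ 2 $ 1 = 0" "(A ** adj B) $ 2 $ 2 = 1"
    using assms by (simp_all add: mat2_mult_nth SL2Z_iff algebra_simps)
  moreover have "A ** adj B \<in> SL2Z" using assms SL2Z_closed by auto
  ultimately have "(A ** adj B) $ 1 $ 1 = 1" by (simp add: SL2Z_iff)
  with row have "A ** adj B = transl n" by (intro mat2_eqI) (auto simp: n_def)
  then have "A ** (adj B ** B) = transl n ** B" by (simp add: matrix_mul_assoc)
  then show ?thesis using that assms by (simp add: adj_mult)
qed

lemma finite_small_rows:
  assumes "z \<in> HH" shows "finite {(c, d). norm (of_int c * z + of_int d) \<le> r}"
proof -
  define C D where "C = \<lceil>r / Im z\<rceil>" and "D = \<lceil>r + of_int C * norm z\<rceil>"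
  have y: "Im z > 0" using assms by (simp add: HH_iff)
  have "\<bar>c\<bar> \<le> C \<and> \<bar>d\<bar> \<le> D" if "norm (of_int c * z + of_int d) \<le> r" for c d
  proof -
    have "\<bar>of_int c\<bar> * Im z \<le> norm (of_int c * z + of_int d)"
      using abs_Im_le_cmod[of "of_int c * z + of_int d"] y by (simp add: abs_mult)
    then have "\<bar>of_int c\<bar> \<le> r / Im z" using that y by (simp add: pos_le_divide_eq)
    then have c: "\<bar>c\<bar> \<le> C" unfolding C_def by linarith
    have "norm (of_int d :: complex) \<le> norm (of_int c * z + of_int d) + norm (of_int c * z)"
      using norm_triangle_ineq4[of "of_int c * z + of_int d" "of_int c * z"] by simp
    also have "norm (of_int c * z) \<le> of_int C * norm z"
      using c by (simp add: norm_mult) (intro mult_right_mono; linarith?; simp)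
    finally have "\<bar>of_int d\<bar> \<le> r + of_int C * norm z" using that by simp
    then have "\<bar>d\<bar> \<le> D" unfolding D_def by linarith
    with c show ?thesis by simp
  qed
  then have "{(c, d). norm (of_int c * z + of_int d) \<le> r} \<subseteq> {-C..C} \<times> {-D..D}" by force
  then show ?thesis by (rule finite_subset) simp
qed

text \<open>Only finitely many rows satisfy \<open>|cz + d| <= 1\<close>, so a least value of
  \<open>|cz + d|\<close> on the group exists. The cocycle rule turns minimality at \<open>z\<close>
  into the defining inequalities at the image, and a final translation adjusts the real part without
  changing the automorphy factor.\<close>

lemma Ford_reduction:
  assumes "z \<in> HH"
  obtains A where "A \<in> Gamma0 N" "moebius A z \<in> Ford_domain N"
proof -
  define S where "S = (\<lambda>A. (A $ 2 $ 1, A $ 2 $ 2)) ` {A \<in> Gamma0 N. norm (aut_factor A z) \<le> 1}"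
  have "S \<subseteq> {(c, d). norm (of_int c * z + of_int d) \<le> 1}"
    by (auto simp: S_def aut_factor_def)
  then have fin: "finite S" using finite_small_rows[OF assms] finite_subset by blast
  have "mat 1 \<in> {A \<in> Gamma0 N. norm (aut_factor A z) \<le> 1}" using Gamma0_closed by (simp add: aut_factor_def)
  then have "S \<noteq> {}" unfolding S_def by blast
  obtain r where r: "r \<in> S" "\<And>s. s \<in> S \<Longrightarrow> norm (of_int (fst r) * z + of_int (snd r)) \<le> norm (of_int (fst s) * z + of_int (snd s))"
    using ex_is_arg_min_if_finite[OF fin \<open>S \<noteq> {}\<close>, of "\<lambda>s. norm (of_int (fst s) * z + of_int (snd s))"]
    by (auto simp: is_arg_min_linorder)
  then obtain A where A: "A \<in> Gamma0 N" "norm (aut_factor A z) \<le> 1" "r = (A $ 2 $ 1, A $ 2 $ 2)"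
    by (auto simp: S_def)
  have min: "norm (aut_factor A z) \<le> norm (aut_factor B z)" if "B \<in> Gamma0 N" for B
  proof (cases "norm (aut_factor B z) \<le> 1")
    case True
    then have "(B $ 2 $ 1, B $ 2 $ 2) \<in> S" using that by (auto simp: S_def)
    from r(2)[OF this] show ?thesis by (simp add: A(3) aut_factor_def)
  qed (use A in auto)
  define n where "n = - round (Re (moebius A z))"
  define B where "B = transl n ** A"
  have B: "B \<in> Gamma0 N" using A by (simp add: B_def Gamma0_closed)
  have SL: "A \<in> SL2Z" "B \<in> SL2Z" using A B Gamma0_subset by auto
  have aB: "aut_factor B z = aut_factor A z"
    unfolding B_def using SL assms by (simp add: aut_factor_mult)
  have mB: "moebius B z = moebius A z + of_int n"
    unfolding B_def using SL assms by (simp add: moebius_mult)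
  have "moebius B z \<in> Ford_domain N"
  proof -
    have "\<bar>Re (moebius B z)\<bar> \<le> 1 / 2"
      using of_int_round_abs_le[of "Re (moebius A z)"] by (simp add: mB n_def abs_minus_commute)
    moreover have "norm (aut_factor C (moebius B z)) \<ge> 1" if C: "C \<in> Gamma0 N" for C
    proof -
      have "norm (aut_factor B z) \<le> norm (aut_factor (C ** B) z)"
        unfolding aB by (rule min) (use B C Gamma0_closed in auto)
      also have "\<dots> = norm (aut_factor C (moebius B z)) * norm (aut_factor B z)"
        using SL assms by (simp add: aut_factor_mult norm_mult)
      finally show ?thesis using aut_factor_neq_0[OF SL(2) assms] by simp
    qed
    ultimately show ?thesis using moebius_in_HH[OF SL(2) assms] by (simp add: Ford_domain_def)
  qed
  with B that show ?thesis by blast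
qed

text \<open>At level 1 the inversion belongs to the group and forces \<open>|w| >= 1\<close>.
  Together with \<open>|Re w| <= 1/2\<close> this bounds \<open>Im w\<close> from below, and the
  crude value \<open>1/2\<close> is enough.\<close>

lemma SL2Z_reduction:
  assumes "z \<in> HH"
  obtains A where "A \<in> SL2Z" "Im (moebius A z) \<ge> 1 / 2"
proof -
  obtain A where A: "A \<in> Gamma0 1" "moebius A z \<in> Ford_domain 1"
    using Ford_reduction[OF assms] by blast
  define w where "w = moebius A z"
  have w: "Im w > 0" "\<bar>Re w\<bar> \<le> 1 / 2" using A(2) by (auto simp: Ford_domain_def w_def HH_iff)
  have "mat2 0 (- 1) 1 0 \<in> Gamma0 1" by (simp add: Gamma0_def SL2Z_iff)
  then have "norm (aut_factor (mat2 0 (- 1) 1 0) w) \<ge> 1" using A(2) by (auto simp: Ford_domain_def w_def)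
  then have "1 \<le> (norm w)\<^sup>2" by (simp add: aut_factor_def)
  also have "\<dots> = (Re w)\<^sup>2 + (Im w)\<^sup>2" by (rule cmod_power2)
  also have "(Re w)\<^sup>2 \<le> (1 / 2)\<^sup>2" using w by (intro abs_le_square_iff[THEN iffD1]) simp
  finally have "(1 / 2)\<^sup>2 \<le> (Im w)\<^sup>2" by (simp add: power2_eq_square)
  then have "1 / 2 \<le> Im w" using w by (intro power2_le_imp_le[of "1 / 2" "Im w"]) auto
  with that[OF Gamma0_subset[OF A(1)]] show ?thesis unfolding w_def by simp
qed

text \<open>The conjugate by \<open>A\<close> of the translation by \<open>N\<close> is congruent to
  the identity modulo \<open>N\<close>, hence lies in \<open>Gamma0 N\<close>. So \<open>N\<close>
  is a period at every cusp, whatever its width.\<close>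

lemma slash_periodic:
  assumes inv: "\<And>A z. A \<in> Gamma0 N \<Longrightarrow> z \<in> HH \<Longrightarrow> slash k f A z = f z"
    and A: "A \<in> SL2Z" and z: "z \<in> HH"
  shows "slash k f A (z + of_nat N) = slash k f A z"
proof -
  define B where "B = A ** (transl (int N) ** adj A)"
  have B: "B \<in> Gamma0 N"
    using A SL2Z_closed by (simp add: Gamma0_def B_def) (simp add: mat2_mult_nth algebra_simps)
  have "B ** A = A ** (transl (int N) ** (adj A ** A))" unfolding B_def by (simp add: matrix_mul_assoc)
  then have BA: "B ** A = A ** transl (int N)" using A by (simp add: adj_mult)
  have "slash k f A (z + of_nat N) = slash k f (A ** transl (int N)) z"
    using A z by (subst slash_mult) (simp_all add: slash_def)
  also have "\<dots> = slash k (slash k f B) A z"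
    unfolding BA[symmetric] using A B z Gamma0_subset by (subst slash_mult) auto
  also have "\<dots> = slash k f A z"
    using inv[OF B, of "moebius A z"] moebius_in_HH[OF A z] by (simp add: slash_def)
  finally show ?thesis .
qed

text \<open>The lower left entry of \<open>A ** adj B\<close> is the determinant of the two bottom
  rows, which is divisible by \<open>N\<close> when the rows agree modulo \<open>N\<close>.\<close>

lemma slash_cong_mod:
  assumes inv: "\<And>A z. A \<in> Gamma0 N \<Longrightarrow> z \<in> HH \<Longrightarrow> slash k f A z = f z"
    and A: "A \<in> SL2Z" and B: "B \<in> SL2Z" and z: "z \<in> HH"
    and cong: "A $ 2 $ 1 mod int N = B $ 2 $ 1 mod int N" "A $ 2 $ 2 mod int N = B $ 2 $ 2 mod int N"
  shows "slash k f A z = slash k f B z"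
proof -
  define C where "C = A ** adj B"
  have "(A $ 2 $ 1 * B $ 2 $ 2) mod int N = (B $ 2 $ 1 * A $ 2 $ 2) mod int N"
    using cong by (metis mod_mult_cong)
  then have "int N dvd A $ 2 $ 1 * B $ 2 $ 2 - B $ 2 $ 1 * A $ 2 $ 2" by (simp add: mod_eq_dvd_iff)
  then have C: "C \<in> Gamma0 N"
    using A B SL2Z_closed by (simp add: Gamma0_def C_def) (simp add: mat2_mult_nth algebra_simps)
  have "C ** B = A" unfolding C_def using B by (simp add: adj_mult flip: matrix_mul_assoc)
  then have "slash k f A z = slash k (slash k f C) B z"
    using B C z Gamma0_subset by (metis slash_mult)
  also have "\<dots> = slash k f B z"
    using inv[OF C, of "moebius B z"] moebius_in_HH[OF B z] by (simp add: slash_def)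
  finally show ?thesis .
qed

section \<open>Expansions at the cusps\<close>

lemma periodic_int:
  assumes "\<And>z. z \<in> HH \<Longrightarrow> g (z + of_real h) = g z" "z \<in> HH"
  shows "g (z + of_int n * of_real h) = g z"
proof (induction n rule: int_induct[of _ 0])
  case (step1 i)
  have "g (z + of_int (i + 1) * of_real h) = g ((z + of_int i * of_real h) + of_real h)"
    by (simp add: algebra_simps)
  also have "\<dots> = g (z + of_int i * of_real h)" using assms by (intro assms(1)) (simp add: HH_iff)
  finally show ?case using step1 by simp
next
  case (step2 i)
  have "g ((z + of_int (i - 1) * of_real h) + of_real h) = g (z + of_int (i - 1) * of_real h)"
    using assms by (intro assms(1)) (simp add: HH_iff)
  then show ?case using step2 by (simp add: algebra_simps)
qed simp

text \<open>\<open>G\<close> is \<open>g\<close> in the coordinate \<open>q = exp (c * z)\<close>.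
  Periodicity makes it independent of the branch of the logarithm, and decay at the cusp makes 0 a
  removable singularity with value 0.\<close>

lemma q_expansion:
  fixes g :: "complex \<Rightarrow> complex"
  assumes hol: "g holomorphic_on HH" and h: "h > 0"
    and per: "\<And>z. z \<in> HH \<Longrightarrow> g (z + of_real h) = g z"
    and lim: "(g \<longlongrightarrow> 0) (filtercomap Im at_top)"
  obtains G where "G holomorphic_on ball 0 1" "G 0 = 0"
    "\<And>z. z \<in> HH \<Longrightarrow> g z = G (exp (2 * of_real pi * \<i> * z / of_real h))"
proof -
  define c where "c = 2 * of_real pi * \<i> / of_real h"
  have c0: "c \<noteq> 0" using h by (simp add: c_def)
  define G where "G q = (if q = 0 then 0 else g (Ln q / c))" for q
  have Im_c: "Im (w / c) = - Re w * h / (2 * pi)" for w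
    using h by (simp add: c_def Im_divide power2_eq_square field_simps)
  have norm_lt1: "w / c \<in> HH" if "norm (exp w) < 1" for w
    using that h by (simp add: HH_iff Im_c divide_neg_pos mult_neg_pos)
  have G_exp: "G (exp w) = g (w / c)" if w: "norm (exp w) < 1" for w
  proof -
    have "exp (Ln (exp w)) = exp w" by simp
    then obtain n :: int where "Ln (exp w) = w + (of_int (2 * n) * pi) * \<i>" unfolding exp_eq by blast
    then have "Ln (exp w) / c = w / c + of_int n * of_real h"
      using h by (simp add: c_def field_simps)
    then show ?thesis using periodic_int[of g h, OF per norm_lt1[OF w]] by (simp add: G_def)
  qed
  have holG: "G holomorphic_on ball 0 1"
  proof (rule no_isolated_singularity'[of "{0}"])
    show "G holomorphic_on ball 0 1 - {0}"
      unfolding holomorphic_on_open[OF open_Diff[OF open_ball finite_imp_closed[OF finite.insertI[OF finite.emptyI]]]]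
    proof
      fix q0 :: complex assume q0: "q0 \<in> ball 0 1 - {0}"
      \<comment> \<open>\<open>Ln\<close> jumps on the negative axis. On this disc
        \<open>q / q0\<close> has positive real part, so \<open>Ln (q / q0) + Ln q0\<close> is a
        holomorphic branch, and by periodicity it may replace \<open>Ln q\<close>.\<close>
      define U where "U = ball 0 1 \<inter> ball q0 (norm q0)"
      have Re_pos: "Re (q / q0) > 0" if "q \<in> U" for q
      proof -
        have "norm (q / q0 - 1) = norm (q - q0) / norm q0" using q0 by (simp add: diff_divide_distrib flip: norm_divide)
        also have "\<dots> < 1" using that q0 by (simp add: U_def dist_norm norm_minus_commute)
        finally have "\<bar>Re (q / q0 - 1)\<bar> < 1" using abs_Re_le_cmod[of "q / q0 - 1"] by linarith
        then show ?thesis by simp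
      qed
      have eq: "G q = g ((Ln (q / q0) + Ln q0) / c)" "(Ln (q / q0) + Ln q0) / c \<in> HH" if "q \<in> U" for q
      proof -
        have "q \<noteq> 0" using Re_pos[OF that] by auto
        then have e: "exp (Ln (q / q0) + Ln q0) = q" using q0 by (simp add: exp_add)
        moreover have "norm q < 1" using that by (simp add: U_def)
        ultimately show "G q = g ((Ln (q / q0) + Ln q0) / c)" "(Ln (q / q0) + Ln q0) / c \<in> HH"
          using G_exp[of "Ln (q / q0) + Ln q0"] norm_lt1[of "Ln (q / q0) + Ln q0"] by simp_all
      qed
      have "(\<lambda>q. g ((Ln (q / q0) + Ln q0) / c)) holomorphic_on U"
      proof (rule holomorphic_on_compose_gen[OF _ hol, unfolded o_def])
        show "(\<lambda>q. (Ln (q / q0) + Ln q0) / c) holomorphic_on U"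
          using Re_pos q0 c0 by (intro holomorphic_intros) (force simp: complex_nonpos_Reals_iff)+
      qed (use eq in auto)
      then have "G holomorphic_on U" by (rule holomorphic_transform) (simp add: eq)
      moreover have "open U" "q0 \<in> U" using q0 by (auto simp: U_def)
      ultimately show "\<exists>f'. (G has_field_derivative f') (at q0)"
        using holomorphic_on_open by blast
    qed
    show "(G \<longlongrightarrow> G z) (at z within ball 0 1)" if "z \<in> {0}" for z
    proof -
      have "(G \<longlongrightarrow> 0) (at 0)"
      proof (rule tendstoI)
        fix e :: real assume e: "e > 0"
        have "\<forall>\<^sub>F z in filtercomap Im at_top. dist (g z) 0 < e" by (rule tendstoD[OF lim e])
        then obtain Y where Y: "\<And>z. Im z \<ge> Y \<Longrightarrow> norm (g z) < e"
          unfolding eventually_filtercomap_at_top_linorder by auto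
        \<comment> \<open>Under the coordinate change, \<open>|q| < r\<close> means
          \<open>Im z > Y\<close>.\<close>
        define r where "r = exp (- (2 * pi * Y / h))"
        have "norm (G q) < e" if q: "q \<noteq> 0" "norm q < r" for q
        proof -
          have "ln (norm q) < - (2 * pi * Y / h)"
            using q ln_less_cancel_iff[of "norm q" r] by (simp add: r_def)
          then have "Im (Ln q / c) \<ge> Y" unfolding Im_c using q h by (simp add: field_simps)
          then show ?thesis using Y q by (simp add: G_def)
        qed
        moreover have "r > 0" by (simp add: r_def)
        ultimately show "\<forall>\<^sub>F q in at 0. dist (G q) 0 < e"
          unfolding eventually_at by (intro exI[of _ r]) auto
      qed
      then show ?thesis using that by (auto simp: G_def intro: tendsto_within_subset)
    qed
  qed auto
  show ?thesis
  proof (rule that[of G])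
    show "g z = G (exp (2 * of_real pi * \<i> * z / of_real h))" if z: "z \<in> HH" for z
    proof -
      have e: "2 * of_real pi * \<i> * z / of_real h = c * z" by (simp add: c_def)
      have "norm (exp (c * z)) < 1" using z h by (simp add: c_def HH_iff)
      then show ?thesis unfolding e using c0 by (subst G_exp) auto
    qed
  qed (use holG in \<open>auto simp: G_def\<close>)
qed

lemma norm_exp_2pi:
  "norm (exp (2 * of_real pi * \<i> * z / of_real h)) = exp (- (2 * pi * Im z / h))"
  by simp

text \<open>\<open>G\<close> vanishes at 0 and has bounded derivative on a closed disc of radius
  less than 1, so \<open>|G q| <= C * |q|\<close> there; the exponential is
  \<open>|q|\<close>.\<close>

lemma periodic_decay:
  fixes g :: "complex \<Rightarrow> complex"
  assumes hol: "g holomorphic_on HH" and h: "h > 0"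
    and per: "\<And>z. z \<in> HH \<Longrightarrow> g (z + of_real h) = g z"
    and lim: "(g \<longlongrightarrow> 0) (filtercomap Im at_top)" and y0: "y0 > 0"
  obtains C where "C \<ge> 0" "\<And>z. Im z \<ge> y0 \<Longrightarrow> norm (g z) \<le> C * exp (- (2 * pi * Im z / h))"
proof -
  obtain G where G: "G holomorphic_on ball 0 1" "G 0 = 0"
    "\<And>z. z \<in> HH \<Longrightarrow> g z = G (exp (2 * of_real pi * \<i> * z / of_real h))"
    using q_expansion[OF hol h per lim] by blast
  define r where "r = exp (- (2 * pi * y0 / h))"
  have r: "0 < r" "r < 1" using y0 h by (simp_all add: r_def)
  have sub: "cball 0 r \<subseteq> ball (0 :: complex) 1" using r by auto
  have "continuous_on (cball 0 r) (deriv G)"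
    using G(1) by (intro holomorphic_on_imp_continuous_on holomorphic_on_subset[OF holomorphic_deriv sub]) auto
  then have "bounded (deriv G ` cball 0 r)" by (intro compact_imp_bounded compact_continuous_image) auto
  then obtain C where C: "C > 0" "\<And>q. q \<in> cball 0 r \<Longrightarrow> norm (deriv G q) \<le> C"
    unfolding bounded_pos by auto
  have Gq: "norm (G q) \<le> C * norm q" if "q \<in> cball 0 r" for q
  proof -
    have "norm (G q - G 0) \<le> C * norm (q - 0)"
    proof (rule field_differentiable_bound[of "cball 0 r"])
      fix z :: complex assume "z \<in> cball 0 r"
      then show "(G has_field_derivative deriv G z) (at z within cball 0 r)"
        using holomorphic_derivI[OF G(1) open_ball] sub by (auto intro: has_field_derivative_at_within)
    qed (use C that r in auto)
    then show ?thesis using G(2) by simp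
  qed
  have "norm (g z) \<le> C * exp (- (2 * pi * Im z / h))" if z: "Im z \<ge> y0" for z
  proof -
    have "exp (2 * of_real pi * \<i> * z / of_real h) \<in> cball 0 r"
      using z h unfolding mem_cball_0 norm_exp_2pi r_def by (simp add: divide_right_mono)
    from Gq[OF this] show ?thesis unfolding norm_exp_2pi using z y0 G(3)[of z] by (simp add: HH_iff)
  qed
  then show ?thesis using C(1) by (intro that[of C]) auto
qed

lemma power_le_exp: "x \<ge> 0 \<Longrightarrow> x ^ n \<le> fact n * exp (x :: real)"
proof -
  assume x: "x \<ge> 0"
  have "x ^ n /\<^sub>R fact n \<le> (\<Sum>n. x ^ n /\<^sub>R fact n)"
    using x sum_le_suminf[OF summable_exp_generic[of x], of "{n}"] by simp
  then show ?thesis by (simp add: exp_def field_simps)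
qed

lemma slash_holomorphic:
  assumes "f holomorphic_on HH" "A \<in> SL2Z" shows "slash k f A holomorphic_on HH"
proof -
  have "moebius A holomorphic_on HH"
    unfolding moebius_def[abs_def] using aut_factor_neq_0[OF assms(2)]
    by (intro holomorphic_intros) (auto simp: aut_factor_def[abs_def] intro!: holomorphic_intros)
  then have "(\<lambda>z. f (moebius A z)) holomorphic_on HH"
    using moebius_in_HH[OF assms(2)]
    by (intro holomorphic_on_compose_gen[OF _ assms(1), unfolded o_def]) auto
  then show ?thesis
    unfolding slash_def[abs_def] using aut_factor_neq_0[OF assms(2)]
    by (intro holomorphic_intros) (auto simp: aut_factor_def[abs_def] intro!: holomorphic_intros)
qed

lemma cusp_formsD:
  assumes "f \<in> cusp_forms k N"
  shows "f holomorphic_on HH" "\<And>z. z \<notin> HH \<Longrightarrow> f z = 0"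
    "\<And>A z. A \<in> Gamma0 N \<Longrightarrow> z \<in> HH \<Longrightarrow> slash k f A z = f z"
    "\<And>A. A \<in> SL2Z \<Longrightarrow> (slash k f A \<longlongrightarrow> 0) (filtercomap Im at_top)"
  using assms by (auto simp: cusp_forms_def)

text \<open>The exponential decay beats every power of \<open>Im z\<close>. The range
  \<open>Im z >= 1/2\<close> is the one reached by \<open>SL2Z_reduction\<close>.\<close>

lemma cusp_form_slash_bound:
  assumes f: "f \<in> cusp_forms k N" and N: "N > 0" and A: "A \<in> SL2Z"
  obtains C where "C \<ge> 0" "\<And>z. Im z \<ge> 1 / 2 \<Longrightarrow> norm (slash k f A z) * Im z ^ j \<le> C"
proof -
  note f' = cusp_formsD[OF f]
  have per: "slash k f A (z + of_real (real N)) = slash k f A z" if "z \<in> HH" for z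
    using slash_periodic[OF f'(3) A that] by simp
  obtain C where C: "C \<ge> 0" "\<And>z. Im z \<ge> 1 / 2 \<Longrightarrow> norm (slash k f A z) \<le> C * exp (- (2 * pi * Im z / real N))"
    using periodic_decay[OF slash_holomorphic[OF f'(1) A] _ per f'(4)[OF A], of "1 / 2"] N by auto
  define a where "a = 2 * pi / real N"
  have a: "a > 0" using N by (simp add: a_def)
  have "norm (slash k f A z) * Im z ^ j \<le> C * fact j / a ^ j" if z: "Im z \<ge> 1 / 2" for z
  proof -
    have "(a * Im z) ^ j \<le> fact j * exp (a * Im z)" using a z by (intro power_le_exp) simp
    then have "Im z ^ j \<le> fact j / a ^ j * exp (a * Im z)" using a by (simp add: power_mult_distrib field_simps)
    then have "norm (slash k f A z) * Im z ^ j \<le> (C * exp (- (a * Im z))) * (fact j / a ^ j * exp (a * Im z))"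
      using C(2)[OF z] C(1) z by (intro mult_mono) (auto simp: a_def)
    also have "\<dots> = C * fact j / a ^ j" by (simp add: exp_minus)
    finally show ?thesis .
  qed
  then show ?thesis using that[of "C * fact j / a ^ j"] C a by auto
qed

text \<open>\<open>f|A\<close> depends only on the bottom row of \<open>A\<close> modulo \<open>N\<close>, so finitely many bounds suffice.\<close>

lemma cusp_form_bound:
  assumes f: "f \<in> cusp_forms (2 * j) N" and N: "N > 0"
  obtains C where "C \<ge> 0" "\<And>z. z \<in> HH \<Longrightarrow> norm (f z) * Im z ^ j \<le> C"
proof -
  note f' = cusp_formsD[OF f]
  define res where "res = (\<lambda>A :: int ^ 2 ^ 2. (A $ 2 $ 1 mod int N, A $ 2 $ 2 mod int N))"
  have fin: "finite (res ` SL2Z)"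
    by (rule finite_subset[of _ "{0..<int N} \<times> {0..<int N}"]) (use N in \<open>auto simp: res_def\<close>)
  have "\<exists>C \<ge> 0. \<forall>A \<in> SL2Z. res A = t \<longrightarrow> (\<forall>z. Im z \<ge> 1 / 2 \<longrightarrow> norm (slash (2 * j) f A z) * Im z ^ j \<le> C)"
    if t: "t \<in> res ` SL2Z" for t
  proof -
    obtain B where B: "B \<in> SL2Z" "res B = t" using t by blast
    obtain C where C: "C \<ge> 0" "\<And>z. Im z \<ge> 1 / 2 \<Longrightarrow> norm (slash (2 * j) f B z) * Im z ^ j \<le> C"
      using cusp_form_slash_bound[OF f N B(1)] by blast
    have "slash (2 * j) f A z = slash (2 * j) f B z" if "A \<in> SL2Z" "res A = t" "Im z \<ge> 1 / 2" for A z
      using that B by (intro slash_cong_mod[OF f'(3)]) (auto simp: res_def HH_iff)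
    then show ?thesis using C by metis
  qed
  then have "\<forall>t \<in> res ` SL2Z. \<exists>C. C \<ge> 0 \<and>
      (\<forall>A \<in> SL2Z. res A = t \<longrightarrow> (\<forall>z. Im z \<ge> 1 / 2 \<longrightarrow> norm (slash (2 * j) f A z) * Im z ^ j \<le> C))"
    by blast
  from bchoice[OF this] obtain C where C': "\<forall>t \<in> res ` SL2Z. C t \<ge> 0 \<and>
      (\<forall>A \<in> SL2Z. res A = t \<longrightarrow> (\<forall>z. Im z \<ge> 1 / 2 \<longrightarrow> norm (slash (2 * j) f A z) * Im z ^ j \<le> C t))"
    by blast
  then have C: "\<And>t. t \<in> res ` SL2Z \<Longrightarrow> C t \<ge> 0"
    "\<And>A z. A \<in> SL2Z \<Longrightarrow> Im z \<ge> 1 / 2 \<Longrightarrow> norm (slash (2 * j) f A z) * Im z ^ j \<le> C (res A)"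
    by blast+
  have "norm (f z) * Im z ^ j \<le> sum C (res ` SL2Z)" if z: "z \<in> HH" for z
  proof -
    obtain A where A: "A \<in> SL2Z" "Im (moebius A z) \<ge> 1 / 2" using SL2Z_reduction[OF z] by blast
    define w where "w = moebius A z"
    have w: "w \<in> HH" "moebius (adj A) w = z" using A z moebius_in_HH moebius_adj by (auto simp: w_def)
    have A': "adj A \<in> SL2Z" using A SL2Z_closed by simp
    have nz: "norm (aut_factor (adj A) w) > 0" using aut_factor_neq_0[OF A' w(1)] by simp
    have "Im z = Im w / (norm (aut_factor (adj A) w))\<^sup>2" using Im_moebius[OF A' w(1)] w(2) by simp
    \<comment> \<open>In weight \<open>2 * j\<close> the powers of \<open>|cz + d|\<close> in the
      slash operator and in the imaginary part cancel exactly.\<close>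
    then have "norm (f z) * Im z ^ j = norm (slash (2 * j) f (adj A) w) * Im w ^ j"
      by (simp add: slash_def w(2) norm_divide norm_power power_divide power_mult)
    also have "\<dots> \<le> C (res (adj A))" using C(2)[OF A'] A(2) by (simp add: w_def)
    also have "\<dots> \<le> sum C (res ` SL2Z)" using A' C(1) fin by (intro member_le_sum) auto
    finally show ?thesis .
  qed
  moreover have "sum C (res ` SL2Z) \<ge> 0" using C(1) by (intro sum_nonneg) auto
  ultimately show ?thesis using that by blast
qed

lemma fourier_unique:
  fixes a b :: "nat \<Rightarrow> complex"
  assumes "\<And>z. z \<in> HH \<Longrightarrow> (\<lambda>n. a n * exp (2 * of_real pi * \<i> * of_nat n * z)) sums f z"
    and "\<And>z. z \<in> HH \<Longrightarrow> (\<lambda>n. b n * exp (2 * of_real pi * \<i> * of_nat n * z)) sums f z"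
    and "a 0 = b 0"
  shows "a = b"
proof -
  define d where "d n = a n - b n" for n
  have "(\<lambda>n. d n * (q - 0) ^ n) sums 0" if "norm (q - 0) < 1" for q
  \<comment> \<open>The value \<open>q = 0\<close> is not attained on \<open>HH\<close>; there
    \<open>a 0 = b 0\<close> supplies the claim.\<close>
  proof (cases "q = 0")
    case True
    then show ?thesis using powser_sums_zero[of d] assms(3) by (simp add: d_def)
  next
    case False
    define z where "z = Ln q / (2 * of_real pi * \<i>)"
    have "Im z = - ln (norm q) / (2 * pi)" using False by (simp add: z_def Im_divide power2_eq_square field_simps)
    also have "\<dots> > 0" using that False by (simp add: divide_neg_pos)
    finally have z: "z \<in> HH" by (simp add: HH_iff)
    have e: "exp (2 * of_real pi * \<i> * of_nat n * z) = q ^ n" for n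
    proof -
      have "2 * of_real pi * \<i> * of_nat n * z = of_nat n * Ln q" by (simp add: z_def)
      then show ?thesis using False by (simp only: exp_of_nat_mult) simp
    qed
    show ?thesis using sums_diff[OF assms(1)[OF z] assms(2)[OF z], unfolded e] by (simp add: d_def algebra_simps)
  qed
  note sums = this
  have "d m = 0" for m
  proof (rule ccontr)
    assume m: "d m \<noteq> 0"
    then have "m > 0" using assms(3) by (cases m) (auto simp: d_def)
    then show False
      using powser_0_nonzero[of 1 0 d "\<lambda>_. 0" m, OF _ sums _ m] by (metis Diff_iff cball_eq_empty
        centre_in_cball ex_in_conv insert_iff less_eq_real_def linorder_not_less mem_cball norm_of_real dist_0_norm abs_of_pos of_real_eq_0_iff order.irrefl singletonD zero_less_one)
  qed
  then show ?thesis by (auto simp: d_def)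
qed

lemma fourier_exists:
  assumes f: "f \<in> cusp_forms k N"
  obtains b where "b 0 = 0" "\<And>z. z \<in> HH \<Longrightarrow> (\<lambda>n. b n * exp (2 * of_real pi * \<i> * of_nat n * z)) sums f z"
proof -
  note f' = cusp_formsD[OF f]
  have per: "f (z + of_real 1) = f z" if "z \<in> HH" for z
    using f'(3)[OF transl_Gamma0[of 1] that] by (simp add: slash_def)
  have s1: "slash k f (mat 1) = f"
    by (simp add: fun_eq_iff slash_def aut_factor_def)
  have lim: "(f \<longlongrightarrow> 0) (filtercomap Im at_top)"
    using f'(4)[OF SL2Z_closed(1)] unfolding s1 .
  obtain G where G: "G holomorphic_on ball 0 1" "G 0 = 0"
    "\<And>z. z \<in> HH \<Longrightarrow> f z = G (exp (2 * of_real pi * \<i> * z / of_real 1))"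
    using q_expansion[OF f'(1) zero_less_one per lim] by blast
  define b where "b n = (deriv ^^ n) G 0 / fact n" for n
  show ?thesis
  proof (rule that[of b])
    show "b 0 = 0" using G(2) by (simp add: b_def)
    fix z assume z: "z \<in> HH"
    let ?q = "exp (2 * of_real pi * \<i> * z / of_real 1)"
    have "?q \<in> ball 0 1" using z by (simp add: HH_iff)
    from holomorphic_power_series[OF G(1) this]
    have "(\<lambda>n. b n * ?q ^ n) sums f z" unfolding b_def G(3)[OF z] by simp
    moreover have "?q ^ n = exp (2 * of_real pi * \<i> * of_nat n * z)" for n
      by (subst exp_of_nat_mult[symmetric]) (simp add: mult_ac)
    ultimately show "(\<lambda>n. b n * exp (2 * of_real pi * \<i> * of_nat n * z)) sums f z" by simp
  qed
qed

lemma fourier_coeff_eqI: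
  assumes "b 0 = 0" "\<And>z. z \<in> HH \<Longrightarrow> (\<lambda>n. b n * exp (2 * of_real pi * \<i> * of_nat n * z)) sums f z"
  shows "fourier_coeff k f n = b n / of_real (real n powr ((real k - 1) / 2))"
proof -
  define a where "a n = b n / of_real (real n powr ((real k - 1) / 2))" for n
  have a0: "a 0 = 0" by (simp add: a_def assms)
  have ab: "a n * of_real (real n powr ((real k - 1) / 2)) = b n" for n
    by (cases "n = 0") (auto simp: a_def assms)
  have "fourier_coeff k f = a"
    unfolding fourier_coeff_def
  proof (rule the_equality)
    show "a 0 = 0 \<and> (\<forall>z\<in>HH. (\<lambda>n. a n * of_real (real n powr ((real k - 1) / 2)) * exp (2 * of_real pi * \<i> * of_nat n * z)) sums f z)"
      using assms by (simp add: ab a0)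
    fix a' assume a': "a' 0 = 0 \<and> (\<forall>z\<in>HH. (\<lambda>n. a' n * of_real (real n powr ((real k - 1) / 2)) * exp (2 * of_real pi * \<i> * of_nat n * z)) sums f z)"
    have "(\<lambda>n. a' n * of_real (real n powr ((real k - 1) / 2))) = b"
      using a' assms by (intro fourier_unique) auto
    then have *: "a' n * of_real (real n powr ((real k - 1) / 2)) = b n" for n by (simp add: fun_eq_iff)
    show "a' = a"
    proof
      fix n show "a' n = a n"
        using *[of n] a' a0 by (cases "n = 0") (auto simp: a_def *[symmetric])
    qed
  qed
  then show ?thesis by (simp add: a_def)
qed

section \<open>The invariant measure\<close>

lemma box_complex: "box l u = {z. Re l < Re z \<and> Re z < Re u \<and> Im l < Im z \<and> Im z < Im u}"
  by (auto simp: box_def Basis_complex_def)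

text \<open>The change of variables with a Jacobian determinant is carried out on
  \<open>real ^ 2\<close>; this identity transports it to the complex plane.\<close>

lemma lborel_complex_vec: "(lborel :: complex measure) = distr lborel borel (\<lambda>v :: real ^ 2. Complex (v $ 1) (v $ 2))"
proof (rule lborel_eqI)
  have m: "(\<lambda>v :: real ^ 2. Complex (v $ 1) (v $ 2)) \<in> borel_measurable lborel"
    unfolding complex_eq_iff by (simp add: Complex_eq)
  fix l u :: complex assume le: "\<And>b. b \<in> Basis \<Longrightarrow> l \<bullet> b \<le> u \<bullet> b"
  have le': "Re l \<le> Re u" "Im l \<le> Im u" using le[of 1] le[of \<i>] by (auto simp: Basis_complex_def)
  have Basis: "(Basis :: (real ^ 2) set) = {axis 1 1, axis 2 1}"
    by (auto simp: Basis_vec_def UNIV_2)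
  define l' u' where "l' = (vector [Re l, Im l] :: real ^ 2)" and "u' = (vector [Re u, Im u] :: real ^ 2)"
  have "(\<lambda>v :: real ^ 2. Complex (v $ 1) (v $ 2)) -` box l u \<inter> space lborel = box l' u'"
    by (auto simp: box_complex mem_box_cart forall_2 l'_def u'_def)
  then have "emeasure (distr lborel borel (\<lambda>v :: real ^ 2. Complex (v $ 1) (v $ 2))) (box l u) = emeasure lborel (box l' u')"
    using m by (subst emeasure_distr) auto
  also have "\<dots> = (\<Prod>b\<in>Basis. (u' - l') \<bullet> b)"
    by (rule emeasure_lborel_box) (use le' in \<open>auto simp: Basis inner_axis l'_def u'_def\<close>)
  also have "(\<Prod>b\<in>Basis. (u' - l') \<bullet> b) = (Re u - Re l) * (Im u - Im l)"
    unfolding Basis by (subst prod.insert) (auto simp: axis_eq_axis inner_axis l'_def u'_def)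
  also have "(Re u - Re l) * (Im u - Im l) = (\<Prod>b\<in>Basis. (u - l) \<bullet> b)"
    by (simp add: Basis_complex_def)
  finally show "emeasure (distr lborel borel (\<lambda>v :: real ^ 2. Complex (v $ 1) (v $ 2))) (box l u) = (\<Prod>b\<in>Basis. (u - l) \<bullet> b)" .
qed simp

lemma nn_integral_complex_vec:
  fixes F :: "complex \<Rightarrow> ennreal"
  assumes "F \<in> borel_measurable borel"
  shows "(\<integral>\<^sup>+z. F z \<partial>lborel) = (\<integral>\<^sup>+v. F (Complex (v $ 1) (v $ 2)) \<partial>(lborel :: (real ^ 2) measure))"
proof -
  have m: "(\<lambda>v :: real ^ 2. Complex (v $ 1) (v $ 2)) \<in> lborel \<rightarrow>\<^sub>M borel"
    unfolding Complex_eq by measurable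
  show ?thesis
    unfolding lborel_complex_vec using assms by (intro nn_integral_distr m) simp
qed

lemma measurable_Complex_pair: "(\<lambda>(x, y). Complex x y) \<in> borel_measurable (lborel \<Otimes>\<^sub>M lborel)"
proof -
  have "(\<lambda>p. Complex (fst p) (snd p)) \<in> borel_measurable (lborel \<Otimes>\<^sub>M lborel)"
    unfolding Complex_eq by measurable
  then show ?thesis by (simp add: case_prod_beta')
qed

text \<open>The product form serves Fubini's theorem in \<open>strip_integral\<close>, with
  \<open>x\<close> integrated first and \<open>y\<close> second.\<close>

lemma lborel_complex_prod: "(lborel :: complex measure) = distr (lborel \<Otimes>\<^sub>M lborel) borel (\<lambda>(x, y). Complex x y)"
proof (rule lborel_eqI)
  note m = measurable_Complex_pair
  fix l u :: complex assume le: "\<And>b. b \<in> Basis \<Longrightarrow> l \<bullet> b \<le> u \<bullet> b"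
  have le': "Re l \<le> Re u" "Im l \<le> Im u" using le[of 1] le[of \<i>] by (auto simp: Basis_complex_def)
  have "(\<lambda>(x, y). Complex x y) -` box l u \<inter> space (lborel \<Otimes>\<^sub>M lborel) = {Re l<..<Re u} \<times> {Im l<..<Im u}"
    by (auto simp: box_complex space_pair_measure)
  then have "emeasure (distr (lborel \<Otimes>\<^sub>M lborel) borel (\<lambda>(x, y). Complex x y)) (box l u)
      = emeasure (lborel \<Otimes>\<^sub>M lborel) ({Re l<..<Re u} \<times> {Im l<..<Im u})"
    using m by (subst emeasure_distr) auto
  also have "\<dots> = ennreal (Re u - Re l) * ennreal (Im u - Im l)"
    using le' by (subst lborel.emeasure_pair_measure_Times) auto
  also have "\<dots> = (\<Prod>b\<in>Basis. (u - l) \<bullet> b)"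
    using le' by (simp add: Basis_complex_def ennreal_mult')
  finally show "emeasure (distr (lborel \<Otimes>\<^sub>M lborel) borel (\<lambda>(x, y). Complex x y)) (box l u) = (\<Prod>b\<in>Basis. (u - l) \<bullet> b)" .
qed simp

text \<open>The area formula is used with a real-valued integral, hence the restriction to images of
  finite measure. \<open>emeasure_exhaust\<close> removes it later.\<close>

lemma emeasure_image_vec2:
  fixes g :: "real ^ 2 \<Rightarrow> real ^ 2"
  assumes E: "E \<in> sets borel" and J: "J \<in> borel_measurable borel" "\<And>x. J x \<ge> 0"
    and der: "\<And>x. x \<in> E \<Longrightarrow> (g has_derivative g' x) (at x)"
    and det: "\<And>x. x \<in> E \<Longrightarrow> \<bar>det (matrix (g' x))\<bar> = J x"
    and inj: "inj_on g E"
    and img: "g ` E \<in> sets borel" "emeasure lborel (g ` E) < \<infinity>"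
  shows "(\<integral>\<^sup>+x. ennreal (J x) * indicator E x \<partial>lborel) = emeasure lborel (g ` E)"
proof -
  have lm: "g ` E \<in> lmeasurable"
    using img by (intro fmeasurableI) auto
  have "((\<lambda>x. \<bar>det (matrix (g' x))\<bar>) has_integral measure lebesgue (g ` E)) E"
    using has_measure_differentiable_image[of E g g' "measure lebesgue (g ` E)"] E der inj lm
    by (auto intro: has_derivative_at_withinI)
  then have "((\<lambda>x. if x \<in> E then J x else 0) has_integral measure lebesgue (g ` E)) UNIV"
    unfolding has_integral_restrict_UNIV by (rule has_integral_eq[rotated]) (simp add: det)
  then have "((\<lambda>x. indicator E x * J x) has_integral measure lebesgue (g ` E)) UNIV"
    by (rule has_integral_eq[rotated]) (simp add: indicator_def)
  then have "(\<integral>\<^sup>+x. ennreal (indicator E x * J x) \<partial>lborel) = measure lebesgue (g ` E)"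
    by (rule nn_integral_has_integral_lborel[rotated 2]) (use E J in auto)
  also have "\<dots> = emeasure lborel (g ` E)"
    using img lm by (simp add: emeasure_eq_ennreal_measure top.not_eq_extremum)
  also have "(\<integral>\<^sup>+x. ennreal (indicator E x * J x) \<partial>lborel) = (\<integral>\<^sup>+x. ennreal (J x) * indicator E x \<partial>lborel)"
    by (intro nn_integral_cong) (auto simp: indicator_def)
  finally show ?thesis .
qed

lemma aut_factor_measurable [measurable]: "aut_factor A \<in> borel_measurable borel"
  unfolding aut_factor_def[abs_def] by measurable

lemma moebius_measurable [measurable]: "moebius A \<in> borel_measurable borel"
  unfolding moebius_def[abs_def] by measurable

lemma HH_borel [measurable]: "HH \<in> sets borel"
  using open_HH by (rule borel_open)

lemma moebius_deriv:
  assumes "A \<in> SL2Z" "z \<in> HH"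
  shows "(moebius A has_field_derivative 1 / (aut_factor A z)\<^sup>2) (at z)"
proof -
  define a b c d where abcd: "a = (of_int (A $ 1 $ 1) :: complex)" "b = (of_int (A $ 1 $ 2) :: complex)"
    "c = (of_int (A $ 2 $ 1) :: complex)" "d = (of_int (A $ 2 $ 2) :: complex)"
  have "of_int (A $ 1 $ 1 * A $ 2 $ 2 - A $ 1 $ 2 * A $ 2 $ 1) = (1 :: complex)"
    using assms(1) unfolding SL2Z_iff by simp
  then have det: "a * d - b * c = 1" by (simp add: abcd)
  have nz: "c * z + d \<noteq> 0" using aut_factor_neq_0[OF assms] by (simp add: aut_factor_def abcd)
  have "((\<lambda>z. (a * z + b) / (c * z + d)) has_field_derivative (a * (c * z + d) - (a * z + b) * c) / (c * z + d)\<^sup>2) (at z)"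
    using nz by (auto intro!: derivative_eq_intros simp: power2_eq_square)
  moreover have "a * (c * z + d) - (a * z + b) * c = 1" using det by (simp add: algebra_simps)
  ultimately show ?thesis by (simp add: moebius_def[abs_def] aut_factor_def abcd)
qed

lemma emeasure_moebius:
  assumes A: "A \<in> SL2Z" and X: "X \<in> sets borel" "X \<subseteq> HH" "emeasure lborel X < \<infinity>"
  shows "(\<integral>\<^sup>+z. ennreal (1 / norm (aut_factor A z) ^ 4) * indicator (HH \<inter> moebius A -` X) z \<partial>lborel) = emeasure lborel X"
proof -
  define c where "c v = Complex (v $ 1) (v $ 2)" for v :: "real ^ 2"
  define i where "i z = (vector [Re z, Im z] :: real ^ 2)" for z
  have ci [simp]: "c (i z) = z" "i (c v) = v" for z v
    by (simp_all add: c_def i_def vec_eq_iff forall_2)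
  have cm [measurable]: "c \<in> borel_measurable borel"
    unfolding c_def[abs_def] Complex_eq by measurable
  define g where "g v = i (moebius A (c v))" for v
  define J where "J v = 1 / norm (aut_factor A (c v)) ^ 4" for v
  define E where "E = c -` (HH \<inter> moebius A -` X)"
  define D where "D v = 1 / (aut_factor A (c v))\<^sup>2" for v
  have [measurable]: "X \<in> sets borel" by fact
  have E_borel: "E \<in> sets borel" unfolding E_def by (rule measurable_sets_borel[OF cm]) measurable
  have lin_c: "bounded_linear c"
    unfolding c_def[abs_def] Complex_eq
    by (intro bounded_linear_add bounded_linear_compose[OF bounded_linear_of_real] bounded_linear_mult_right[THEN bounded_linear_compose] bounded_linear_vec_nth)
  have lin_i: "bounded_linear i"
  proof -
    have "linear i" by (rule linearI) (simp_all add: i_def vec_eq_iff forall_2)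
    then show ?thesis by (rule linear_conv_bounded_linear[THEN iffD1])
  qed
  have img: "g ` E = c -` X"
  proof (intro set_eqI iffI)
    fix v assume v: "v \<in> c -` X"
    then have "c v \<in> HH" using X by auto
    define w where "w = i (moebius (adj A) (c v))"
    have "w \<in> E" "g w = v"
      using v \<open>c v \<in> HH\<close> A moebius_adj[OF A \<open>c v \<in> HH\<close>] moebius_in_HH[of "adj A" "c v"] SL2Z_closed
      by (auto simp: w_def E_def g_def)
    then show "v \<in> g ` E" by blast
  qed (auto simp: g_def E_def)
  have eX: "emeasure lborel X = emeasure lborel (c -` X)"
    by (subst lborel_complex_vec) (subst emeasure_distr, auto simp: c_def[abs_def] X Complex_eq)
  have "(\<integral>\<^sup>+v. ennreal (J v) * indicator E v \<partial>lborel) = emeasure lborel (g ` E)"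
  proof (rule emeasure_image_vec2[where g' = "\<lambda>v h. i (c h * D v)"])
    show "J \<in> borel_measurable borel" unfolding J_def[abs_def] by measurable
    show "inj_on g E"
    proof (rule inj_onI)
      fix v w assume vw: "v \<in> E" "w \<in> E" "g v = g w"
      have "moebius A (c v) = moebius A (c w)" using vw(3) ci(1) unfolding g_def by metis
      then have "c v = c w" using vw moebius_adj(1)[OF A] unfolding E_def by (metis Int_iff vimage_eq)
      then show "v = w" using ci(2) by metis
    qed
    show "(g has_derivative (\<lambda>h. i (c h * D v))) (at v)" if "v \<in> E" for v
    proof -
      have "(moebius A has_derivative (\<lambda>h. h * D v)) (at (c v))"
      proof -
        have "(\<lambda>h. h * D v) = (*) (D v)" by (simp add: fun_eq_iff mult.commute)
        then show ?thesis
          using moebius_deriv[OF A, of "c v"] that by (simp only: has_field_derivative_def D_def E_def) auto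
      qed
      then have "((\<lambda>v. moebius A (c v)) has_derivative (\<lambda>h. c h * D v)) (at v)"
        by (rule has_derivative_compose[OF bounded_linear_imp_has_derivative[OF lin_c]])
      then show ?thesis unfolding g_def[abs_def]
        by (rule has_derivative_compose[OF _ bounded_linear_imp_has_derivative[OF lin_i]])
    qed
    show "\<bar>det (matrix (\<lambda>h. i (c h * D v)))\<bar> = J v" if "v \<in> E" for v
    proof -
      \<comment> \<open>Multiplication by a complex number \<open>D\<close> has real determinant
        \<open>|D|^2\<close>, here \<open>|cz + d|^(-4)\<close>.\<close>
      have "det (matrix (\<lambda>h. i (c h * D v))) = (Re (D v))\<^sup>2 + (Im (D v))\<^sup>2"
        by (simp add: det_2 matrix_def i_def c_def axis_def power2_eq_square)
      also have "\<dots> = J v"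
        by (simp add: cmod_power2[symmetric] D_def J_def norm_divide norm_power power_divide flip: power_mult)
      finally show ?thesis by (simp add: J_def)
    qed
    show "g ` E \<in> sets borel" unfolding img by (rule measurable_sets_borel[OF cm]) fact
    show "emeasure lborel (g ` E) < \<infinity>" using X(3) unfolding img eX .
  qed (auto simp: E_borel J_def)
  also have "(\<integral>\<^sup>+v. ennreal (J v) * indicator E v \<partial>lborel)
      = (\<integral>\<^sup>+z. ennreal (1 / norm (aut_factor A z) ^ 4) * indicator (HH \<inter> moebius A -` X) z \<partial>lborel)"
  proof -
    have "(\<lambda>z. ennreal (1 / norm (aut_factor A z) ^ 4) * indicator (HH \<inter> moebius A -` X) z) \<in> borel_measurable borel"
      by measurable
    from nn_integral_complex_vec[OF this] show ?thesis
      by (simp add: J_def E_def c_def indicator_def)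
  qed
  finally show ?thesis unfolding img eX .
qed

lemma emeasure_exhaust:
  fixes M :: "complex measure"
  assumes M: "sets M = sets borel" and X: "X \<in> sets borel"
  shows "emeasure M X = (SUP n::nat. emeasure M (X \<inter> ball 0 (real n)))"
proof -
  have a: "(\<Union>n::nat. X \<inter> ball 0 (real n)) = X"
  proof (intro set_eqI iffI)
    fix z assume z: "z \<in> X"
    obtain n :: nat where "norm z < real n" using reals_Archimedean2[of "norm z"] ..
    then have "z \<in> X \<inter> ball 0 (real n)" using z by simp
    then show "z \<in> (\<Union>n::nat. X \<inter> ball 0 (real n))" by (rule UN_I[OF UNIV_I])
  qed blast
  have i: "incseq (\<lambda>n. X \<inter> ball 0 (real n))"
  proof (rule incseq_SucI)
    fix n show "X \<inter> ball 0 (real n) \<subseteq> X \<inter> ball 0 (real (Suc n))"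
      by (intro Int_mono subset_refl subset_ball) simp
  qed
  have s: "range (\<lambda>n. X \<inter> ball 0 (real n)) \<subseteq> sets M"
    unfolding M by (intro image_subsetI sets.Int X borel_open open_ball)
  show ?thesis using SUP_emeasure_incseq[OF s i] unfolding a by (rule sym)
qed

text \<open>Both measures agree on bounded sets by \<open>emeasure_moebius\<close>, and every Borel
  set is an increasing union of such sets.\<close>

lemma distr_moebius:
  assumes A: "A \<in> SL2Z"
  shows "distr (density lborel (\<lambda>z. ennreal (1 / norm (aut_factor A z) ^ 4) * indicator HH z)) borel (moebius A)
    = density lborel (indicator HH)" (is "?M = ?N")
proof (rule measure_eqI)
  fix X assume "X \<in> sets ?M"
  then have [measurable]: "X \<in> sets borel" by simp
  have "emeasure ?M (X \<inter> ball 0 (real n)) = emeasure ?N (X \<inter> ball 0 (real n))" for n :: nat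
  proof -
    let ?Y = "X \<inter> ball 0 (real n)"
    have fin: "emeasure lborel (?Y \<inter> HH) < \<infinity>"
    proof -
      have "emeasure lborel (?Y \<inter> HH) \<le> emeasure lborel (ball (0 :: complex) (real n))"
        by (intro emeasure_mono) auto
      also have "\<dots> < \<infinity>" by (intro emeasure_bounded_finite) auto
      finally show ?thesis .
    qed
    have "emeasure ?M ?Y = (\<integral>\<^sup>+z. ennreal (1 / norm (aut_factor A z) ^ 4) * indicator HH z * indicator (moebius A -` ?Y) z \<partial>lborel)"
    proof -
      have "moebius A -` ?Y \<in> sets borel" by (rule measurable_sets_borel[OF moebius_measurable]) auto
      then show ?thesis by (simp add: emeasure_distr emeasure_density)
    qed
    also have "\<dots> = (\<integral>\<^sup>+z. ennreal (1 / norm (aut_factor A z) ^ 4) * indicator (HH \<inter> moebius A -` (?Y \<inter> HH)) z \<partial>lborel)"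
      using moebius_in_HH[OF A] by (intro nn_integral_cong) (auto simp: indicator_def)
    also have "\<dots> = emeasure lborel (?Y \<inter> HH)"
      using fin by (intro emeasure_moebius[OF A]) auto
    also have "\<dots> = emeasure ?N ?Y"
    proof -
      have "emeasure lborel (?Y \<inter> HH) = (\<integral>\<^sup>+z. indicator (?Y \<inter> HH) z \<partial>lborel)" by simp
      also have "\<dots> = (\<integral>\<^sup>+z. indicator HH z * indicator ?Y z \<partial>lborel)"
        by (intro nn_integral_cong) (auto simp: indicator_def)
      also have "\<dots> = emeasure ?N ?Y" by (simp add: emeasure_density)
      finally show ?thesis .
    qed
    finally show ?thesis .
  qed
  note eq = this
  have "emeasure ?M X = (SUP n::nat. emeasure ?M (X \<inter> ball 0 (real n)))"
    by (rule emeasure_exhaust) auto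
  also have "\<dots> = emeasure ?N X"
    unfolding eq by (rule emeasure_exhaust[symmetric]) auto
  finally show "emeasure ?M X = emeasure ?N X" .
qed simp

definition hyp :: "complex measure" where
  "hyp = density lborel (\<lambda>z. ennreal (1 / (Im z)\<^sup>2) * indicator HH z)"

lemma sets_hyp [measurable_cong, simp]: "sets hyp = sets borel" and space_hyp [simp]: "space hyp = UNIV"
  by (simp_all add: hyp_def)

lemma nn_integral_hyp:
  assumes [measurable]: "F \<in> borel_measurable borel"
  shows "(\<integral>\<^sup>+z. F z \<partial>hyp) = (\<integral>\<^sup>+z. ennreal (1 / (Im z)\<^sup>2) * indicator HH z * F z \<partial>lborel)"
  unfolding hyp_def by (subst nn_integral_density) auto

text \<open>\<open>Im (A z) = Im z / |cz + d|^2\<close>, so the density \<open>1 / y^2\<close>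
  changes by \<open>|cz + d|^4\<close>, which compensates the Jacobian.\<close>

lemma nn_integral_hyp_moebius:
  assumes A: "A \<in> SL2Z" and [measurable]: "F \<in> borel_measurable borel"
  shows "(\<integral>\<^sup>+z. F (moebius A z) \<partial>hyp) = (\<integral>\<^sup>+z. F z \<partial>hyp)"
proof -
  let ?J = "\<lambda>z. ennreal (1 / norm (aut_factor A z) ^ 4) * indicator HH z"
  have "(\<integral>\<^sup>+z. F (moebius A z) \<partial>hyp)
      = (\<integral>\<^sup>+z. ?J z * (ennreal (1 / (Im (moebius A z))\<^sup>2) * F (moebius A z)) \<partial>lborel)"
    unfolding nn_integral_hyp[OF measurable_compose[OF moebius_measurable assms(2)]]
  proof (intro nn_integral_cong)
    fix z
    show "ennreal (1 / (Im z)\<^sup>2) * indicator HH z * F (moebius A z)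
      = ?J z * (ennreal (1 / (Im (moebius A z))\<^sup>2) * F (moebius A z))"
    proof (cases "z \<in> HH")
      case True
      have "1 / (Im z)\<^sup>2 = 1 / norm (aut_factor A z) ^ 4 * (1 / (Im (moebius A z))\<^sup>2)"
        using aut_factor_neq_0[OF A True] True
        by (simp add: Im_moebius[OF A True] HH_iff field_simps flip: power_mult)
      then have "ennreal (1 / (Im z)\<^sup>2) = ennreal (1 / norm (aut_factor A z) ^ 4) * ennreal (1 / (Im (moebius A z))\<^sup>2)"
        by (simp only:) (rule ennreal_mult, auto)
      then show ?thesis using True by (simp add: mult_ac)
    qed simp
  qed
  also have "\<dots> = (\<integral>\<^sup>+z. ennreal (1 / (Im (moebius A z))\<^sup>2) * F (moebius A z) \<partial>density lborel ?J)"
    by (subst nn_integral_density) auto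
  also have "\<dots> = (\<integral>\<^sup>+z. ennreal (1 / (Im z)\<^sup>2) * F z \<partial>distr (density lborel ?J) borel (moebius A))"
    by (subst nn_integral_distr) auto
  also have "\<dots> = (\<integral>\<^sup>+z. F z \<partial>hyp)"
    unfolding distr_moebius[OF A] nn_integral_hyp[OF assms(2)]
    by (subst nn_integral_density) (auto simp: mult_ac)
  finally show ?thesis .
qed

lemma integral_hyp:
  fixes F :: "complex \<Rightarrow> complex"
  assumes [measurable]: "F \<in> borel_measurable borel"
  shows "integral\<^sup>L hyp F = (\<integral>z. (1 / (Im z)\<^sup>2 * indicator HH z) *\<^sub>R F z \<partial>lborel)"
    and "integrable hyp F \<longleftrightarrow> integrable lborel (\<lambda>z. (1 / (Im z)\<^sup>2 * indicator HH z) *\<^sub>R F z)"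
proof -
  have *: "hyp = density lborel (\<lambda>z. ennreal (1 / (Im z)\<^sup>2 * indicator HH z))"
    unfolding hyp_def by (intro arg_cong[where f = "density lborel"]) (auto simp: fun_eq_iff indicator_def)
  show "integral\<^sup>L hyp F = (\<integral>z. (1 / (Im z)\<^sup>2 * indicator HH z) *\<^sub>R F z \<partial>lborel)"
    unfolding * by (rule integral_density) auto
  show "integrable hyp F \<longleftrightarrow> integrable lborel (\<lambda>z. (1 / (Im z)\<^sup>2 * indicator HH z) *\<^sub>R F z)"
    unfolding * by (rule integrable_density) auto
qed

lemma AE_hypI:
  assumes "AE z in lborel. z \<in> HH \<longrightarrow> P z" shows "AE z in hyp. P z"
proof -
  have m: "(\<lambda>z. ennreal (1 / (Im z)\<^sup>2) * indicator HH z) \<in> borel_measurable lborel" by measurable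
  from assms show ?thesis
    unfolding hyp_def AE_density[OF m] by eventually_elim (simp add: indicator_def)
qed

section \<open>Unfolding\<close>

lemma countable_matrices: "countable (X :: (int ^ 2 ^ 2) set)"
proof (rule countableI')
  define f where "f A = (A $ 1 $ 1, A $ 1 $ 2, A $ 2 $ 1, A $ 2 $ 2)" for A :: "int ^ 2 ^ 2"
  show "inj_on (\<lambda>A. to_nat (f A)) X"
    by (rule inj_onI) (auto simp: f_def intro: mat2_eqI)
qed

lemma Ford_domain_borel [measurable]: "Ford_domain N \<in> sets borel"
proof -
  have "Ford_domain N = HH \<inter> {z. \<bar>Re z\<bar> \<le> 1 / 2} \<inter> (\<Inter>A\<in>Gamma0 N. {z. norm (aut_factor A z) \<ge> 1})"
    by (auto simp: Ford_domain_def)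
  also have "\<dots> \<in> sets borel"
  proof (intro sets.Int HH_borel sets.countable_INT'')
    show "{z :: complex. \<bar>Re z\<bar> \<le> 1 / 2} \<in> sets borel" by measurable
    show "{z. norm (aut_factor A z) \<ge> 1} \<in> sets borel" for A by measurable
  qed (auto simp: countable_matrices)
  finally show ?thesis .
qed

definition Ford_boundary :: "complex set" where
  "Ford_boundary = {z. \<bar>Re z\<bar> = 1 / 2} \<union>
     (\<Union>(c, d)\<in>{(c, d). c \<noteq> 0}. {z. norm (of_int c * z + of_int d :: complex) = 1})"

lemma Ford_boundary_null: "Ford_boundary \<in> null_sets lborel"
proof -
  have 1: "{z :: complex. Re z = a} \<in> null_sets lborel" for a
  proof -
    have "negligible {z :: complex. 1 \<bullet> z = a}" by (rule negligible_hyperplane) simp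
    then have "{z :: complex. Re z = a} \<in> null_sets lebesgue"
      by (simp add: negligible_iff_null_sets)
    moreover have "{z :: complex. Re z = a} \<in> sets borel" by measurable
    ultimately show ?thesis by (simp add: null_sets_def)
  qed
  have 2: "{z. norm (of_int c * z + of_int d :: complex) = 1} \<in> null_sets lborel" if c: "c \<noteq> 0" for c d :: int
  proof -
    have "norm (of_int c * z + of_int d :: complex) = \<bar>of_int c\<bar> * dist (- of_int d / of_int c) z" for z
    proof -
      have "of_int c * z + of_int d = of_int c * (z - (- of_int d / of_int c))" using c by (simp add: field_simps)
      then show ?thesis by (simp only: norm_mult dist_norm norm_minus_commute) simp
    qed
    then have "{z. norm (of_int c * z + of_int d :: complex) = 1} = sphere (- of_int d / of_int c) (1 / \<bar>of_int c\<bar>)"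
      using c by (auto simp: field_simps)
    moreover have "sphere (- of_int d / of_int c :: complex) (1 / \<bar>of_int c\<bar>) \<in> null_sets lebesgue"
      using negligible_sphere by (simp add: negligible_iff_null_sets)
    moreover have "{z. norm (of_int c * z + of_int d :: complex) = 1} \<in> sets borel" by measurable
    ultimately show ?thesis by (simp add: null_sets_def)
  qed
  have "{z :: complex. \<bar>Re z\<bar> = 1 / 2} = {z. Re z = 1 / 2} \<union> {z. Re z = - (1 / 2)}" by auto
  then have "{z :: complex. \<bar>Re z\<bar> = 1 / 2} \<in> null_sets lborel" using 1 by (simp only:) (intro null_sets.Un 1)
  moreover have "(\<Union>(c, d)\<in>{(c, d). c \<noteq> 0}. {z. norm (of_int c * z + of_int d :: complex) = 1}) \<in> null_sets lborel"
    using 2 by (intro null_sets_UN') auto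
  ultimately show ?thesis unfolding Ford_boundary_def by (rule null_sets.Un)
qed

lemma Ford_boundary_borel [measurable]: "Ford_boundary \<in> sets borel"
  using Ford_boundary_null by (simp add: null_sets_def)

lemma AE_hyp_HH: "AE z in hyp. z \<in> HH"
  by (rule AE_hypI) simp

text \<open>Uniqueness is needed along whole orbits. The group is countable and preserves
  \<open>hyp\<close>, so the preimages of the null boundary form a null set.\<close>

lemma AE_moebius_not_boundary:
  "AE w in hyp. w \<in> HH \<and> (\<forall>A\<in>Gamma0 N. moebius A w \<notin> Ford_boundary)"
proof -
  have "AE w in hyp. moebius A w \<notin> Ford_boundary" if "A \<in> Gamma0 N" for A
  proof -
    have "AE z in lborel. z \<notin> Ford_boundary" using AE_not_in[OF Ford_boundary_null] .
    then have "AE z in hyp. z \<notin> Ford_boundary" by (intro AE_hypI) auto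
    then have "(\<integral>\<^sup>+z. indicator Ford_boundary z \<partial>hyp) = 0"
      by (subst nn_integral_0_iff_AE) (auto elim!: eventually_mono)
    then have "(\<integral>\<^sup>+z. indicator Ford_boundary (moebius A z) \<partial>hyp) = 0"
      using nn_integral_hyp_moebius[OF Gamma0_subset[OF that], of "indicator Ford_boundary"] by simp
    then have "AE z in hyp. indicator Ford_boundary (moebius A z) = (0 :: ennreal)"
      by (subst (asm) nn_integral_0_iff_AE) auto
    then show ?thesis by (auto elim!: eventually_mono simp: indicator_def split: if_splits)
  qed
  then have "AE w in hyp. \<forall>A\<in>Gamma0 N. moebius A w \<notin> Ford_boundary"
    by (intro AE_ball_countable' countable_matrices)
  with AE_hyp_HH show ?thesis by eventually_elim simp
qed

text \<open>Minimality at \<open>z\<close> and at its image forces \<open>|cz + d| = 1\<close>. Off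
  the boundary this excludes \<open>c \<noteq> 0\<close>, so \<open>A\<close> is a translation up to
  sign, and \<open>|Re z| < 1/2\<close> leaves only the trivial one.\<close>

lemma Ford_unique:
  assumes z: "z \<in> Ford_domain N" "z \<notin> Ford_boundary"
    and A: "A \<in> Gamma0 N" "moebius A z \<in> Ford_domain N"
  shows "A = mat 1 \<or> A = - mat 1"
proof -
  have SL: "A \<in> SL2Z" and zH: "z \<in> HH" using A z Gamma0_subset by (auto simp: Ford_domain_def)
  have "norm (aut_factor A z) \<ge> 1" "norm (aut_factor (adj A) (moebius A z)) \<ge> 1"
    using z A Gamma0_closed(2)[of A N] by (auto simp: Ford_domain_def)
  moreover have "norm (aut_factor (adj A) (moebius A z)) * norm (aut_factor A z) = 1"
    using aut_factor_adj[OF SL zH] by (metis norm_mult norm_one)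
  moreover have "b = 1" if "b \<ge> 1" "a \<ge> 1" "a * b = 1" for a b :: real
    using mult_right_mono[of 1 a b] that by simp
  ultimately have n1: "norm (aut_factor A z) = 1" by blast
  have c0: "A $ 2 $ 1 = 0"
    using n1 z(2) by (auto simp: Ford_boundary_def aut_factor_def)
  then have "A $ 1 $ 1 * A $ 2 $ 2 = 1" using SL by (simp add: SL2Z_iff)
  then have diag: "A $ 1 $ 1 = 1 \<and> A $ 2 $ 2 = 1 \<or> A $ 1 $ 1 = -1 \<and> A $ 2 $ 2 = -1"
    by (simp add: zmult_eq_1_iff)
  then have "\<exists>n :: int. moebius A z = z + of_int n \<and> \<bar>n\<bar> = \<bar>A $ 1 $ 2\<bar>"
  proof
    assume "A $ 1 $ 1 = 1 \<and> A $ 2 $ 2 = 1"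
    then show ?thesis using c0 by (intro exI[of _ "A $ 1 $ 2"]) (simp add: moebius_def aut_factor_def)
  next
    assume "A $ 1 $ 1 = -1 \<and> A $ 2 $ 2 = -1"
    then show ?thesis using c0 by (intro exI[of _ "- (A $ 1 $ 2)"]) (simp add: moebius_def aut_factor_def)
  qed
  then obtain n :: int where n: "moebius A z = z + of_int n" "\<bar>n\<bar> = \<bar>A $ 1 $ 2\<bar>" by blast
  have "\<bar>Re z\<bar> \<le> 1 / 2" "\<bar>Re z\<bar> \<noteq> 1 / 2" "\<bar>Re z + of_int n\<bar> \<le> 1 / 2"
    using z A(2) n(1) by (auto simp: Ford_domain_def Ford_boundary_def)
  then have "\<bar>of_int n :: real\<bar> < 1" by linarith
  then have "n = 0" by linarith
  then have "A $ 1 $ 2 = 0" using n by simp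
  from diag show ?thesis
  proof
    assume "A $ 1 $ 1 = 1 \<and> A $ 2 $ 2 = 1"
    then have "A = mat 1" using c0 \<open>A $ 1 $ 2 = 0\<close> by (intro mat2_eqI) auto
    then show ?thesis ..
  next
    assume "A $ 1 $ 1 = -1 \<and> A $ 2 $ 2 = -1"
    then have "A = - mat 1" using c0 \<open>A $ 1 $ 2 = 0\<close> by (intro mat2_eqI) auto
    then show ?thesis ..
  qed
qed

lemma uminus_Gamma0: "A \<in> Gamma0 N \<Longrightarrow> - A \<in> Gamma0 N"
  by (simp add: Gamma0_def SL2Z_iff)

lemma moebius_uminus [simp]: "moebius (- A) z = moebius A z"
proof -
  have "aut_factor (- A) z = - aut_factor A z" by (simp add: aut_factor_def)
  moreover have "of_int (- A $ 1 $ 1) * z + of_int (- A $ 1 $ 2) = - (of_int (A $ 1 $ 1) * z + of_int (A $ 1 $ 2))" by simp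
  ultimately show ?thesis unfolding moebius_def by (simp only: vector_uminus_component minus_divide_divide)
qed

lemma uminus_matrix_neq: "A \<in> SL2Z \<Longrightarrow> - A \<noteq> A"
proof
  assume "A \<in> SL2Z" "- A = A"
  then have "- (A $ i $ j) = A $ i $ j" for i j by (metis vector_uminus_component)
  then have "A $ i $ j = 0" for i j by (metis equal_neg_zero)
  with \<open>A \<in> SL2Z\<close> show False by (simp add: SL2Z_iff)
qed

text \<open>The two elements are \<open>A\<close> and \<open>- A\<close>, which act alike; this is
  the source of the factor 2 in the unfolding.\<close>

lemma Ford_orbit_count:
  assumes w: "w \<in> HH" "\<And>A. A \<in> Gamma0 N \<Longrightarrow> moebius A w \<notin> Ford_boundary"
  shows "emeasure (count_space (Gamma0 N)) {A \<in> Gamma0 N. moebius A w \<in> Ford_domain N} = 2"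
proof -
  obtain A where A: "A \<in> Gamma0 N" "moebius A w \<in> Ford_domain N" using Ford_reduction[OF w(1)] .
  have SL: "A \<in> SL2Z" using A Gamma0_subset by blast
  have "{B \<in> Gamma0 N. moebius B w \<in> Ford_domain N} = {A, - A}"
  proof (intro set_eqI iffI)
    fix B assume B: "B \<in> {B \<in> Gamma0 N. moebius B w \<in> Ford_domain N}"
    then have B': "B \<in> SL2Z" using Gamma0_subset by blast
    define C where "C = B ** adj A"
    have C: "C \<in> Gamma0 N" using B A Gamma0_closed by (simp add: C_def)
    have "moebius C (moebius A w) = moebius B w"
      using SL B' w SL2Z_closed moebius_in_HH[OF SL w(1)] by (simp add: C_def moebius_mult moebius_adj)
    then have "C = mat 1 \<or> C = - mat 1"
      using A B C w by (intro Ford_unique[of "moebius A w" N]) auto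
    moreover have "C ** A = B" using SL by (simp add: C_def adj_mult flip: matrix_mul_assoc)
    moreover have "(- mat 1) ** A = - A" by (rule mat2_eqI) (simp_all add: mat2_mult_nth)
    ultimately show "B \<in> {A, - A}" by auto
  qed (use A uminus_Gamma0 in auto)
  then show ?thesis using A uminus_matrix_neq[OF SL] uminus_Gamma0[OF A(1)]
    by (simp add: emeasure_count_space_finite)
qed

text \<open>The union of all translates of the Ford domain, counted with multiplicity. Stated as an
  identity of measures, unfolding transfers both integrability and the value of an integral.\<close>

definition unfold_measure :: "nat \<Rightarrow> complex measure" where
  "unfold_measure N = distr (count_space (Gamma0 N) \<Otimes>\<^sub>M density hyp (indicator (Ford_domain N))) borel (\<lambda>(A, z). moebius A z)"

lemma measurable_unfold [measurable]:
  assumes "sets M = sets borel"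
  shows "(\<lambda>(A, z). moebius A z) \<in> measurable (count_space (Gamma0 N) \<Otimes>\<^sub>M M) borel"
  using assms moebius_measurable
  by (intro measurable_pair_measure_countable1) (auto simp: countable_matrices measurable_cong_sets[of M borel borel borel])

lemma sigma_finite_hyp: "sigma_finite_measure hyp"
  unfolding hyp_def
  by (subst sigma_finite_measure.sigma_finite_iff_density_finite[OF sigma_finite_lborel])
    (auto simp: ennreal_mult_eq_top_iff indicator_def)

lemma sigma_finite_hyp_indicator: "X \<in> sets borel \<Longrightarrow> sigma_finite_measure (density hyp (indicator X))"
  by (subst sigma_finite_measure.sigma_finite_iff_density_finite[OF sigma_finite_hyp]) (auto simp: indicator_def)

text \<open>A point \<open>w\<close> is covered once for each \<open>A\<close> with
  \<open>A^(-1) w\<close> in the Ford domain, hence twice almost everywhere. Invariance of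
  \<open>hyp\<close> moves the variable to \<open>w\<close>, and Fubini then allows the count over
  \<open>A\<close> to be done first.\<close>

lemma unfold_measure_eq: "unfold_measure N = scale_measure 2 hyp"
proof (rule measure_eqI)
  fix X assume "X \<in> sets (unfold_measure N)"
  then have [measurable]: "X \<in> sets borel" by (simp add: unfold_measure_def)
  let ?D = "Ford_domain N" and ?G = "count_space (Gamma0 N)"
  let ?H = "density hyp (indicator ?D)"
  interpret H: sigma_finite_measure ?H by (rule sigma_finite_hyp_indicator) measurable
  interpret hyp: sigma_finite_measure hyp by (rule sigma_finite_hyp)
  interpret G: sigma_finite_measure ?G by (rule sigma_finite_measure_count_space_countable) (rule countable_matrices)
  interpret P: pair_sigma_finite ?G hyp ..
  have "emeasure (unfold_measure N) X = (\<integral>\<^sup>+x. indicator X x \<partial>unfold_measure N)"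
    by (subst nn_integral_indicator) (auto simp: unfold_measure_def)
  also have "\<dots> = (\<integral>\<^sup>+p. indicator X ((\<lambda>(A, z). moebius A z) p) \<partial>(?G \<Otimes>\<^sub>M ?H))"
    unfolding unfold_measure_def by (subst nn_integral_distr) auto
  also have "\<dots> = (\<integral>\<^sup>+A. \<integral>\<^sup>+z. indicator X (moebius A z) \<partial>?H \<partial>?G)"
    by (subst H.nn_integral_fst[symmetric]) (auto simp: measurable_unfold measurable_compose[OF measurable_unfold])
  also have "\<dots> = (\<integral>\<^sup>+A. \<integral>\<^sup>+w. indicator ?D (moebius (adj A) w) * indicator X w \<partial>hyp \<partial>?G)"
  proof (intro nn_integral_cong)
    fix A assume "A \<in> space ?G"
    then have A: "A \<in> SL2Z" using Gamma0_subset by simp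
    have "(\<integral>\<^sup>+z. indicator X (moebius A z) \<partial>?H) = (\<integral>\<^sup>+z. indicator ?D z * indicator X (moebius A z) \<partial>hyp)"
      by (subst nn_integral_density) auto
    also have "\<dots> = (\<integral>\<^sup>+z. indicator ?D (moebius (adj A) (moebius A z)) * indicator X (moebius A z) \<partial>hyp)"
      by (intro nn_integral_cong_AE eventually_mono[OF AE_hyp_HH]) (simp add: moebius_adj[OF A])
    also have "\<dots> = (\<integral>\<^sup>+w. indicator ?D (moebius (adj A) w) * indicator X w \<partial>hyp)"
      by (rule nn_integral_hyp_moebius[OF A]) measurable
    finally show "(\<integral>\<^sup>+z. indicator X (moebius A z) \<partial>?H) = (\<integral>\<^sup>+w. indicator ?D (moebius (adj A) w) * indicator X w \<partial>hyp)" .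
  qed
  also have "\<dots> = (\<integral>\<^sup>+w. \<integral>\<^sup>+A. indicator ?D (moebius (adj A) w) * indicator X w \<partial>?G \<partial>hyp)"
  proof (rule P.Fubini'[symmetric])
    show "(\<lambda>(A, w). indicator ?D (moebius (adj A) w) * indicator X w :: ennreal) \<in> borel_measurable (?G \<Otimes>\<^sub>M hyp)"
    proof (rule measurable_pair_measure_countable1)
      show "(\<lambda>w. case (A, w) of (A, w) \<Rightarrow> (indicator ?D (moebius (adj A) w) * indicator X w :: ennreal)) \<in> borel_measurable hyp" for A
        by simp measurable
    qed (rule countable_matrices)
  qed
  also have "\<dots> = (\<integral>\<^sup>+w. 2 * indicator X w \<partial>hyp)"
  proof (intro nn_integral_cong_AE eventually_mono[OF AE_moebius_not_boundary[of N]], elim conjE)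
    fix w assume w: "w \<in> HH" "\<forall>A\<in>Gamma0 N. moebius A w \<notin> Ford_boundary"
    have "(\<integral>\<^sup>+A. indicator ?D (moebius (adj A) w) \<partial>?G) = (\<integral>\<^sup>+A. indicator ?D (moebius A w) \<partial>?G)"
    proof (rule nn_integral_bij_count_space)
      show "bij_betw adj (Gamma0 N) (Gamma0 N)"
        by (rule bij_betw_byWitness[where f' = adj]) (auto simp: Gamma0_closed)
    qed
    also have "\<dots> = (\<integral>\<^sup>+A. indicator {A \<in> Gamma0 N. moebius A w \<in> ?D} A \<partial>?G)"
      by (intro nn_integral_cong) (simp add: indicator_def)
    also have "\<dots> = emeasure ?G {A \<in> Gamma0 N. moebius A w \<in> ?D}"
      by (intro nn_integral_indicator) auto
    also have "\<dots> = 2" using w by (intro Ford_orbit_count) auto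
    finally show "(\<integral>\<^sup>+A. indicator ?D (moebius (adj A) w) * indicator X w \<partial>?G) = 2 * indicator X w"
      by (subst nn_integral_multc) auto
  qed
  also have "\<dots> = 2 * emeasure hyp X" by (subst nn_integral_cmult) auto
  finally show "emeasure (unfold_measure N) X = emeasure (scale_measure 2 hyp) X" by simp
qed (simp add: unfold_measure_def)

text \<open>Fubini on group times domain yields the classical unfolding. Summability of complex
  families is absolute, so \<open>sm\<close> identifies the integral over the counting measure with
  the infinite sum.\<close>

lemma integral_unfold:
  fixes F :: "complex \<Rightarrow> complex"
  assumes F: "integrable hyp F"
    and sm: "\<And>z. z \<in> HH \<Longrightarrow> (\<lambda>A. F (moebius A z)) summable_on Gamma0 N"
  shows "integrable hyp (\<lambda>z. indicator (Ford_domain N) z *\<^sub>R (\<Sum>\<^sub>\<infinity>A\<in>Gamma0 N. F (moebius A z)))" (is ?A)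
    and "(\<integral>z. indicator (Ford_domain N) z *\<^sub>R (\<Sum>\<^sub>\<infinity>A\<in>Gamma0 N. F (moebius A z)) \<partial>hyp) = 2 * integral\<^sup>L hyp F" (is ?B)
proof -
  let ?D = "Ford_domain N" and ?G = "count_space (Gamma0 N)"
  let ?H = "density hyp (indicator ?D)"
  have F_m [measurable]: "F \<in> borel_measurable borel" using borel_measurable_integrable[OF F] by simp
  interpret H: sigma_finite_measure ?H by (rule sigma_finite_hyp_indicator) measurable
  interpret G: sigma_finite_measure ?G by (rule sigma_finite_measure_count_space_countable) (rule countable_matrices)
  interpret P: pair_sigma_finite ?G ?H ..
  have scale: "scale_measure 2 hyp = density hyp (\<lambda>_. ennreal 2)"
    by (rule measure_eqI) (auto simp: emeasure_density nn_integral_cmult_indicator)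
  have "integrable (unfold_measure N) F" and U2: "integral\<^sup>L (unfold_measure N) F = 2 * integral\<^sup>L hyp F"
  proof -
    have "integrable (density hyp (\<lambda>_. ennreal 2)) F \<longleftrightarrow> integrable hyp (\<lambda>x. 2 *\<^sub>R F x)"
      by (rule integrable_density) auto
    then show "integrable (unfold_measure N) F" unfolding unfold_measure_eq scale using F by simp
    have "integral\<^sup>L (density hyp (\<lambda>_. ennreal 2)) F = (\<integral>x. 2 *\<^sub>R F x \<partial>hyp)"
      by (rule integral_density) auto
    then show "integral\<^sup>L (unfold_measure N) F = 2 * integral\<^sup>L hyp F"
      unfolding unfold_measure_eq scale by (simp add: scaleR_conv_of_real)
  qed
  then have int: "integrable (?G \<Otimes>\<^sub>M ?H) (\<lambda>(A, z). F (moebius A z))"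
    unfolding unfold_measure_def by (subst (asm) integrable_distr_eq) (auto simp: case_prod_beta')
  have "integral\<^sup>L (unfold_measure N) F = integral\<^sup>L (?G \<Otimes>\<^sub>M ?H) (\<lambda>(A, z). F (moebius A z))"
    unfolding unfold_measure_def by (subst integral_distr) (auto simp: case_prod_beta')
  also have "\<dots> = (\<integral>z. (\<integral>A. F (moebius A z) \<partial>?G) \<partial>?H)"
    by (rule P.integral_snd[symmetric]) (use int in simp)
  finally have eq: "(\<integral>z. (\<integral>A. F (moebius A z) \<partial>?G) \<partial>?H) = 2 * integral\<^sup>L hyp F" using U2 by simp
  have int2: "integrable ?H (\<lambda>z. \<integral>A. F (moebius A z) \<partial>?G)"
    by (rule P.integrable_snd) (use int in simp)
  have inner: "(\<integral>A. F (moebius A z) \<partial>?G) = (\<Sum>\<^sub>\<infinity>A\<in>Gamma0 N. F (moebius A z))" if "z \<in> HH" for z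
  proof -
    have "Infinite_Set_Sum.abs_summable_on (\<lambda>A. F (moebius A z)) (Gamma0 N)"
      using sm[OF that] by (simp add: summable_on_iff_abs_summable_on_complex flip: abs_summable_equivalent)
    from infsetsum_infsum[OF this] show ?thesis by (simp add: infsetsum_def)
  qed
  have D0: "indicator ?D z *\<^sub>R (\<integral>A. F (moebius A z) \<partial>?G) = indicator ?D z *\<^sub>R (\<Sum>\<^sub>\<infinity>A\<in>Gamma0 N. F (moebius A z))" for z
    using inner[of z] by (cases "z \<in> ?D") (auto simp: Ford_domain_def)
  have m: "(\<lambda>z. \<integral>A. F (moebius A z) \<partial>?G) \<in> borel_measurable hyp"
    using borel_measurable_integrable[OF int2] by simp
  have dens: "?H = density hyp (\<lambda>z. ennreal (indicator ?D z))" by (simp add: ennreal_indicator)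
  show ?A using int2 unfolding dens by (subst (asm) integrable_density) (use m D0 in auto)
  show ?B using eq unfolding dens by (subst (asm) integral_density) (use m D0 in auto)
qed

section \<open>Poincare series\<close>

definition coprime_rows :: "nat \<Rightarrow> (int \<times> int) set" where
  "coprime_rows N = {(c, d). int N dvd c \<and> coprime c d}"

definition bottom_row :: "int ^ 2 ^ 2 \<Rightarrow> int \<times> int" where
  "bottom_row A = (A $ 2 $ 1, A $ 2 $ 2)"

text \<open>An arbitrary representative of a coset of the translations; by \<open>pterm_cong\<close>
  the choice does not affect the series.\<close>

definition lift_row :: "int \<times> int \<Rightarrow> int ^ 2 ^ 2" where
  "lift_row r = (SOME A. A \<in> SL2Z \<and> bottom_row A = r)"

definition pterm :: "nat \<Rightarrow> nat \<Rightarrow> int ^ 2 ^ 2 \<Rightarrow> complex \<Rightarrow> complex" where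
  "pterm k m A z = exp (2 * of_real pi * \<i> * of_nat m * moebius A z) / aut_factor A z ^ k"

text \<open>The index set is a parameter because slashing by a general element of
  \<open>SL2Z\<close> carries the rows of level \<open>N\<close> to a different set of rows.\<close>

definition psum :: "nat \<Rightarrow> nat \<Rightarrow> (int \<times> int) set \<Rightarrow> complex \<Rightarrow> complex" where
  "psum k m R z = (\<Sum>\<^sub>\<infinity>r\<in>R. pterm k m (lift_row r) z)"

text \<open>The rows come with both signs, while the classical series runs over rows up to sign;
  hence the division by 2.\<close>

definition poincare :: "nat \<Rightarrow> nat \<Rightarrow> nat \<Rightarrow> complex \<Rightarrow> complex" where
  "poincare k N m z = (if z \<in> HH then psum k m (coprime_rows N) z / 2 else 0)"

lemma lift_row:
  assumes "case r of (c, d) \<Rightarrow> coprime c d"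
  shows "lift_row r \<in> SL2Z" "bottom_row (lift_row r) = r"
proof -
  obtain A where "A \<in> SL2Z" "A $ 2 $ 1 = fst r" "A $ 2 $ 2 = snd r"
    using SL2Z_row_exists[of "fst r" "snd r"] assms by (auto simp: case_prod_beta')
  then have "A \<in> SL2Z \<and> bottom_row A = r" by (simp add: bottom_row_def)
  then have "lift_row r \<in> SL2Z \<and> bottom_row (lift_row r) = r" unfolding lift_row_def by (rule someI)
  then show "lift_row r \<in> SL2Z" "bottom_row (lift_row r) = r" by auto
qed

lemma rows_subset: "coprime_rows N \<subseteq> coprime_rows 1"
  by (auto simp: coprime_rows_def)

lemma lift_rows:
  assumes "r \<in> coprime_rows N" shows "lift_row r \<in> SL2Z" "bottom_row (lift_row r) = r"
  using lift_row[of r] assms by (auto simp: coprime_rows_def)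

lemma row_in_rows: "A \<in> SL2Z \<Longrightarrow> bottom_row A \<in> coprime_rows 1"
  using SL2Z_row_coprime by (simp add: bottom_row_def coprime_rows_def)

lemma row_in_rows_iff: "A \<in> SL2Z \<Longrightarrow> bottom_row A \<in> coprime_rows N \<longleftrightarrow> A \<in> Gamma0 N"
  using SL2Z_row_coprime[of A] by (auto simp: bottom_row_def coprime_rows_def Gamma0_def)

lemma same_row: "A \<in> SL2Z \<Longrightarrow> B \<in> SL2Z \<Longrightarrow> bottom_row A = bottom_row B \<Longrightarrow> \<exists>n. A = transl n ** B"
  using SL2Z_same_row[of A B] by (auto simp: bottom_row_def)

lemma exp_2pi_int: "exp (2 * of_real pi * \<i> * of_nat m * (z + of_int n)) = exp (2 * of_real pi * \<i> * of_nat m * z)"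
proof -
  have "2 * of_real pi * \<i> * of_nat m * (z + of_int n) = 2 * of_real pi * \<i> * of_nat m * z + (of_int (2 * (int m * n)) * of_real pi) * \<i>"
    by (simp add: algebra_simps)
  moreover have "(of_int (2 * (int m * n)) * of_real pi) = (complex_of_real (of_int (2 * (int m * n)) * pi))"
    by simp
  ultimately show ?thesis unfolding exp_eq by metis
qed

lemma pterm_cong:
  assumes "A \<in> SL2Z" "B \<in> SL2Z" "bottom_row A = bottom_row B" "z \<in> HH"
  shows "pterm k m A z = pterm k m B z"
proof -
  obtain n where n: "A = transl n ** B" using same_row assms by blast
  have "moebius A z = moebius B z + of_int n" unfolding n using assms by (simp add: moebius_mult)
  moreover have "aut_factor A z = aut_factor B z" using assms(3) by (simp add: aut_factor_def bottom_row_def)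
  ultimately show ?thesis by (simp only: pterm_def exp_2pi_int)
qed

lemma pterm_mult:
  assumes "A \<in> SL2Z" "B \<in> SL2Z" "z \<in> HH"
  shows "pterm k m A (moebius B z) / aut_factor B z ^ k = pterm k m (A ** B) z"
  using assms by (simp add: pterm_def moebius_mult aut_factor_mult power_mult_distrib mult.commute)

lemma norm_pterm:
  assumes "A \<in> SL2Z" "z \<in> HH"
  shows "norm (pterm k m A z) = exp (- (2 * pi * m * (Im z / (norm (aut_factor A z))\<^sup>2))) / norm (aut_factor A z) ^ k"
  by (simp add: pterm_def norm_divide norm_power Im_moebius[OF assms])

lemma norm_pterm_le:
  assumes "A \<in> SL2Z" "z \<in> HH"
  shows "norm (pterm k m A z) \<le> 1 / norm (aut_factor A z) ^ k"
proof -
  have "- (2 * pi * m * (Im z / (norm (aut_factor A z))\<^sup>2)) \<le> 0"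
    using assms by (simp add: HH_iff)
  then show ?thesis unfolding norm_pterm[OF assms] by (intro divide_right_mono) auto
qed

section \<open>Absolute convergence and holomorphy of the series\<close>

definition wt :: "int \<times> int \<Rightarrow> real" where
  "wt r = real_of_int (\<bar>fst r\<bar> + \<bar>snd r\<bar>)"

lemma wt_ge_1: "r \<in> coprime_rows 1 \<Longrightarrow> wt r \<ge> 1"
proof -
  assume "r \<in> coprime_rows 1"
  then have "fst r \<noteq> 0 \<or> snd r \<noteq> 0" by (auto simp: coprime_rows_def)
  then have "\<bar>fst r\<bar> + \<bar>snd r\<bar> \<ge> 1" by auto
  then show ?thesis unfolding wt_def by linarith
qed

lemma summable_int_inverse_square: "(\<lambda>c :: int. 1 / (1 + (real_of_int c)\<^sup>2)) summable_on UNIV"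
proof -
  have "summable (\<lambda>n. 1 / (1 + (real n)\<^sup>2))"
  proof (rule summable_comparison_test')
    show "summable (\<lambda>n. 1 / real n ^ 2)" using inverse_power_summable[of 2, where 'a = real] by (simp add: field_simps)
    show "norm (1 / (1 + (real n)\<^sup>2)) \<le> 1 / real n ^ 2" if "n \<ge> 1" for n
      using that by (auto intro!: divide_left_mono simp: add_pos_nonneg)
  qed
  then have n: "(\<lambda>n. 1 / (1 + (real n)\<^sup>2)) summable_on UNIV"
    by (subst summable_on_UNIV_nonneg_real_iff) auto
  have "(\<lambda>c :: int. 1 / (1 + (real_of_int c)\<^sup>2)) summable_on range int"
    using n by (subst summable_on_reindex) (auto simp: o_def)
  moreover have "(\<lambda>c :: int. 1 / (1 + (real_of_int c)\<^sup>2)) summable_on range (\<lambda>n. - int n)"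
    using n by (subst summable_on_reindex) (auto simp: o_def inj_on_def)
  ultimately have "(\<lambda>c :: int. 1 / (1 + (real_of_int c)\<^sup>2)) summable_on (range int \<union> range (\<lambda>n. - int n))"
    by (rule summable_on_union)
  moreover have "range int \<union> range (\<lambda>n. - int n) = UNIV"
  proof (intro set_eqI iffI UNIV_I)
    fix c :: int
    show "c \<in> range int \<union> range (\<lambda>n. - int n)"
      by (cases "c \<ge> 0") (auto intro: image_eqI[of _ _ "nat c"] image_eqI[of _ _ "nat (- c)"])
  qed
  ultimately show ?thesis by simp
qed

text \<open>The exponent 4 permits comparison with a product of two one-dimensional series, as
  \<open>(1 + c^2) (1 + d^2) <= 4 * wt^4\<close>.\<close>

lemma summable_wt: "(\<lambda>r. 1 / wt r ^ 4) summable_on coprime_rows 1"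
proof (rule summable_on_comparison_test)
  let ?f = "\<lambda>c. 1 / (1 + (real_of_int c)\<^sup>2)"
  have "(\<lambda>(c, d). ?f c * ?f d) summable_on (SIGMA c:UNIV. UNIV)"
  proof (rule summable_on_SigmaI)
    show "((\<lambda>d. case (c, d) of (c, d) \<Rightarrow> ?f c * ?f d) has_sum (?f c * infsum ?f UNIV)) UNIV" for c
      using has_sum_cmult_right[OF has_sum_infsum[OF summable_int_inverse_square], of "?f c"] by simp
    show "(\<lambda>c. ?f c * infsum ?f UNIV) summable_on UNIV"
      by (intro summable_on_cmult_left summable_int_inverse_square)
  qed auto
  then have "(\<lambda>(c, d). ?f c * ?f d) summable_on coprime_rows 1"
    by (rule summable_on_subset_banach) auto
  then show "(\<lambda>r. 4 * (case r of (c, d) \<Rightarrow> ?f c * ?f d)) summable_on coprime_rows 1"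
    by (intro summable_on_cmult_right) (simp add: case_prod_beta')
  show "1 / wt r ^ 4 \<le> 4 * (case r of (c, d) \<Rightarrow> ?f c * ?f d)" if r: "r \<in> coprime_rows 1" for r
  proof -
    obtain c d where cd: "r = (c, d)" by (cases r)
    define s where "s = wt r"
    have s: "s \<ge> 1" using wt_ge_1[OF r] by (simp add: s_def)
    have c: "(real_of_int c)\<^sup>2 \<le> s\<^sup>2" "(real_of_int d)\<^sup>2 \<le> s\<^sup>2"
      by (intro abs_le_square_iff[THEN iffD1]; simp add: s_def wt_def cd)+
    have s2: "1 \<le> s\<^sup>2" using s by simp
    have "(1 + (real_of_int c)\<^sup>2) * (1 + (real_of_int d)\<^sup>2) \<le> (2 * s\<^sup>2) * (2 * s\<^sup>2)"
      using c s2 by (intro mult_mono) auto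
    also have "\<dots> = 4 * s ^ 4" by (simp add: power2_eq_square eval_nat_numeral)
    finally have "1 / (4 * s ^ 4) \<le> 1 / ((1 + (real_of_int c)\<^sup>2) * (1 + (real_of_int d)\<^sup>2))"
      by (intro divide_left_mono mult_pos_pos) (use s in \<open>auto intro: add_pos_nonneg\<close>)
    then have "1 / s ^ 4 \<le> 4 * (?f c * ?f d)" by simp
    then show ?thesis by (simp add: s_def cd)
  qed
qed simp

text \<open>The imaginary part of \<open>cz + d\<close> controls \<open>c\<close>, and then the real
  part controls \<open>d\<close>. The constant is uniform on the region described by
  \<open>x\<close> and \<open>y\<close>.\<close>

lemma aut_factor_ge:
  assumes z: "Im z \<ge> y" "y > 0" "\<bar>Re z\<bar> \<le> x"
  shows "wt (bottom_row A) \<le> (1 / y + 1 + x / y) * norm (aut_factor A z)"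
proof -
  define c d where "c = real_of_int (A $ 2 $ 1)" and "d = real_of_int (A $ 2 $ 2)"
  have j: "aut_factor A z = of_real c * z + of_real d" by (simp add: aut_factor_def c_def d_def)
  have "\<bar>c\<bar> * y \<le> \<bar>c\<bar> * Im z" using z by (intro mult_left_mono) auto
  also have "\<dots> = \<bar>Im (aut_factor A z)\<bar>" using z by (simp add: j abs_mult)
  also have "\<dots> \<le> norm (aut_factor A z)" by (rule abs_Im_le_cmod)
  finally have c: "\<bar>c\<bar> \<le> norm (aut_factor A z) / y" using z by (simp add: pos_le_divide_eq)
  have "\<bar>d\<bar> \<le> \<bar>c * Re z + d\<bar> + \<bar>c\<bar> * \<bar>Re z\<bar>" by (simp add: abs_mult[symmetric])
  also have "\<bar>c * Re z + d\<bar> \<le> norm (aut_factor A z)"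
    using abs_Re_le_cmod[of "aut_factor A z"] by (simp add: j)
  also have "\<bar>c\<bar> * \<bar>Re z\<bar> \<le> norm (aut_factor A z) / y * x" using c z by (intro mult_mono) auto
  finally have "\<bar>c\<bar> + \<bar>d\<bar> \<le> norm (aut_factor A z) / y + (norm (aut_factor A z) + norm (aut_factor A z) / y * x)"
    using c by linarith
  also have "\<dots> = (1 / y + 1 + x / y) * norm (aut_factor A z)" by (simp add: field_simps)
  finally show ?thesis by (simp add: wt_def bottom_row_def c_def d_def)
qed

lemma norm_pterm_majorant:
  assumes k: "k \<ge> 4" and r: "r \<in> coprime_rows 1" and z: "Im z \<ge> y" "y > 0" "\<bar>Re z\<bar> \<le> x"
  shows "norm (pterm k m (lift_row r) z) \<le> (1 / y + 1 + x / y) ^ k * (1 / wt r ^ 4)"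
proof -
  let ?K = "1 / y + 1 + x / y" and ?j = "norm (aut_factor (lift_row r) z)"
  have zH: "z \<in> HH" using z by (simp add: HH_iff)
  note A = lift_rows[OF r]
  have K: "?K > 0" using z by (intro add_pos_nonneg add_pos_pos) auto
  have j: "?j > 0" using aut_factor_neq_0[OF A(1) zH] by simp
  have w: "wt r \<ge> 1" by (rule wt_ge_1[OF r])
  have "wt r ^ 4 \<le> wt r ^ k" using w k by (rule power_increasing[rotated])
  also have "wt r \<le> ?K * ?j" using aut_factor_ge[OF z, of "lift_row r"] A(2) by simp
  then have "wt r ^ k \<le> (?K * ?j) ^ k" using w by (intro power_mono) auto
  finally have le: "wt r ^ 4 \<le> ?K ^ k * ?j ^ k" by (simp add: power_mult_distrib)
  have "norm (pterm k m (lift_row r) z) \<le> 1 / ?j ^ k" by (rule norm_pterm_le[OF A(1) zH])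
  also have "\<dots> \<le> ?K ^ k * (1 / wt r ^ 4)"
    using le j w by (simp add: divide_simps)
  finally show ?thesis .
qed

lemma pterm_abs_summable:
  assumes "k \<ge> 4" "R \<subseteq> coprime_rows 1" "z \<in> HH"
  shows "(\<lambda>r. norm (pterm k m (lift_row r) z)) summable_on R"
proof (rule summable_on_comparison_test)
  let ?K = "(1 / Im z + 1 + \<bar>Re z\<bar> / Im z) ^ k"
  have "(\<lambda>r. 1 / wt r ^ 4) summable_on R"
    using summable_wt assms(2) by (rule summable_on_subset_banach)
  then show "(\<lambda>r. ?K * (1 / wt r ^ 4)) summable_on R" by (rule summable_on_cmult_right)
  show "norm (pterm k m (lift_row r) z) \<le> ?K * (1 / wt r ^ 4)" if "r \<in> R" for r
    using assms that by (intro norm_pterm_majorant) (auto simp: HH_iff)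
qed simp

lemma pterm_summable:
  assumes "k \<ge> 4" "R \<subseteq> coprime_rows 1" "z \<in> HH"
  shows "(\<lambda>r. pterm k m (lift_row r) z) summable_on R"
  using pterm_abs_summable[OF assms] by (rule abs_summable_summable)

lemma moebius_holomorphic: "A \<in> SL2Z \<Longrightarrow> moebius A holomorphic_on HH"
  unfolding holomorphic_on_open[OF open_HH] using moebius_deriv by blast

lemma pterm_holomorphic: "A \<in> SL2Z \<Longrightarrow> pterm k m A holomorphic_on HH"
  unfolding pterm_def[abs_def] using aut_factor_neq_0[of A]
  by (intro holomorphic_intros moebius_holomorphic) (auto simp: aut_factor_def[abs_def] intro!: holomorphic_intros)

text \<open>On a disc of half the height of its centre \<open>norm_pterm_majorant\<close> is
  uniform, so the series is a uniform limit of holomorphic finite sums.\<close>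

lemma psum_holomorphic:
  assumes k: "k \<ge> 4" and R: "R \<subseteq> coprime_rows 1"
  shows "psum k m R holomorphic_on HH"
  unfolding holomorphic_on_open[OF open_HH]
proof
  fix z0 assume z0: "z0 \<in> HH"
  define r where "r = Im z0 / 2"
  have r: "r > 0" using z0 by (simp add: r_def HH_iff)
  have Im: "Im z \<ge> r" "\<bar>Re z\<bar> \<le> \<bar>Re z0\<bar> + r" if "z \<in> cball z0 r" for z
    using abs_Im_le_cmod[of "z0 - z"] abs_Re_le_cmod[of "z0 - z"] that
    by (auto simp: dist_norm r_def)
  have sub: "cball z0 r \<subseteq> HH"
  proof
    fix z assume "z \<in> cball z0 r"
    from Im(1)[OF this] r show "z \<in> HH" by (simp add: HH_iff)
  qed
  let ?K = "(1 / r + 1 + (\<bar>Re z0\<bar> + r) / r) ^ k"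
  have sm: "(\<lambda>t. ?K * (1 / wt t ^ 4)) summable_on R"
    using summable_on_subset_banach[OF summable_wt R] by (rule summable_on_cmult_right)
  have ulim: "uniform_limit (cball z0 r) (\<lambda>X z. \<Sum>t\<in>X. pterm k m (lift_row t) z) (psum k m R) (finite_subsets_at_top R)"
    unfolding psum_def[abs_def]
    by (rule Weierstrass_m_test_general[OF norm_pterm_majorant[OF k subsetD[OF R]] sm]) (use r Im in auto)
  have ev: "\<forall>\<^sub>F X in finite_subsets_at_top R. continuous_on (cball z0 r) (\<lambda>z. \<Sum>t\<in>X. pterm k m (lift_row t) z) \<and>
      (\<lambda>z. \<Sum>t\<in>X. pterm k m (lift_row t) z) holomorphic_on ball z0 r"
  proof (rule eventually_finite_subsets_at_top_weakI)
    fix X assume X: "finite X" "X \<subseteq> R"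
    have "(\<lambda>z. \<Sum>t\<in>X. pterm k m (lift_row t) z) holomorphic_on HH"
      using X R lift_rows[of _ 1] by (intro holomorphic_on_sum pterm_holomorphic) auto
    then show "continuous_on (cball z0 r) (\<lambda>z. \<Sum>t\<in>X. pterm k m (lift_row t) z) \<and>
      (\<lambda>z. \<Sum>t\<in>X. pterm k m (lift_row t) z) holomorphic_on ball z0 r"
      using sub ball_subset_cball by (blast intro: holomorphic_on_imp_continuous_on holomorphic_on_subset)
  qed
  obtain "psum k m R holomorphic_on ball z0 r"
    using holomorphic_uniform_limit[OF ev ulim] by auto
  then show "\<exists>f'. (psum k m R has_field_derivative f') (at z0)"
    using r by (simp add: holomorphic_on_open)
qed

section \<open>Right multiplication on bottom rows, modularity and behaviour at the cusps\<close>

definition act :: "int ^ 2 ^ 2 \<Rightarrow> int \<times> int \<Rightarrow> int \<times> int" where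
  "act B r = (fst r * B $ 1 $ 1 + snd r * B $ 2 $ 1, fst r * B $ 1 $ 2 + snd r * B $ 2 $ 2)"

lemma act_row: "act B (bottom_row A) = bottom_row (A ** B)"
  by (simp add: act_def bottom_row_def mat2_mult_nth)

lemma act_act: "B \<in> SL2Z \<Longrightarrow> r \<in> coprime_rows 1 \<Longrightarrow> act (adj B) (act B r) = r"
  using act_row[of B "lift_row r"] act_row[of "adj B" "lift_row r ** B"] lift_rows[of r 1]
  by (simp add: adj_mult flip: matrix_mul_assoc)

lemma act_rows: "B \<in> SL2Z \<Longrightarrow> r \<in> coprime_rows 1 \<Longrightarrow> act B r \<in> coprime_rows 1"
  using act_row[of B "lift_row r"] lift_rows[of r 1] row_in_rows[of "lift_row r ** B"] SL2Z_closed by simp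

lemma act_rows_Gamma0: "B \<in> Gamma0 N \<Longrightarrow> r \<in> coprime_rows N \<Longrightarrow> act B r \<in> coprime_rows N"
proof -
  assume B: "B \<in> Gamma0 N" and r: "r \<in> coprime_rows N"
  have "lift_row r \<in> Gamma0 N" using lift_rows[OF r] r row_in_rows_iff by metis
  then have *: "lift_row r ** B \<in> Gamma0 N" using B Gamma0_closed by blast
  have "bottom_row (lift_row r ** B) \<in> coprime_rows N" using * row_in_rows_iff[OF Gamma0_subset[OF *]] by simp
  then show ?thesis using act_row[of B "lift_row r"] lift_rows[OF r] by simp
qed

text \<open>Slashing by \<open>B\<close> multiplies every row by \<open>B\<close> from the right, so
  it only re-indexes the series.\<close>

lemma slash_psum:
  assumes B: "B \<in> SL2Z" and R: "R \<subseteq> coprime_rows 1" and z: "z \<in> HH"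
  shows "slash k (psum k m R) B z = psum k m (act B ` R) z"
proof -
  have inj: "inj_on (act B) R"
    using act_act[OF B] R by (intro inj_on_inverseI[where g = "act (adj B)"]) auto
  have "psum k m (act B ` R) z = (\<Sum>\<^sub>\<infinity>r\<in>R. pterm k m (lift_row (act B r)) z)"
    unfolding psum_def by (subst infsum_reindex[OF inj]) (simp add: o_def)
  also have "\<dots> = (\<Sum>\<^sub>\<infinity>r\<in>R. pterm k m (lift_row r) (moebius B z) * (1 / aut_factor B z ^ k))"
  proof (intro infsum_cong)
    fix r assume "r \<in> R"
    then have r: "r \<in> coprime_rows 1" using R by auto
    note A = lift_rows[OF r] and A' = lift_rows[OF act_rows[OF B r]]
    have "bottom_row (lift_row (act B r)) = bottom_row (lift_row r ** B)" using A A' act_row by metis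
    then have "pterm k m (lift_row (act B r)) z = pterm k m (lift_row r ** B) z"
      using A A' B z SL2Z_closed by (intro pterm_cong) auto
    then show "pterm k m (lift_row (act B r)) z = pterm k m (lift_row r) (moebius B z) * (1 / aut_factor B z ^ k)"
      using pterm_mult[OF A(1) B z, of k m] by simp
  qed
  also have "\<dots> = slash k (psum k m R) B z"
    unfolding slash_def psum_def by (subst infsum_cmult_left') simp
  finally show ?thesis ..
qed

lemma psum_Gamma0:
  assumes "B \<in> Gamma0 N" "z \<in> HH"
  shows "slash k (psum k m (coprime_rows N)) B z = psum k m (coprime_rows N) z"
proof -
  have B: "B \<in> SL2Z" using assms Gamma0_subset by blast
  have "act B ` coprime_rows N = coprime_rows N"
  proof (intro set_eqI iffI)
    fix r assume r: "r \<in> coprime_rows N"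
    have "act B (act (adj B) r) = r"
      using act_act[OF SL2Z_closed(2)[OF B] subsetD[OF rows_subset r]] by simp
    moreover have "act (adj B) r \<in> coprime_rows N" using assms r act_rows_Gamma0 Gamma0_closed by blast
    ultimately show "r \<in> act B ` coprime_rows N" by force
  qed (use assms act_rows_Gamma0 in auto)
  then show ?thesis using slash_psum[OF B rows_subset assms(2)] by simp
qed

text \<open>Weight at least 5 leaves one factor \<open>|cz + d|\<close> to spare: for
  \<open>c \<noteq> 0\<close> it is at least \<open>Im z\<close> and yields the decay, while the
  other four keep the series summable. The rows with \<open>c = 0\<close> decay through their
  exponential because \<open>m > 0\<close>. Periodicity confines \<open>Re z\<close> to an interval
  on which all constants are uniform.\<close>

lemma psum_at_cusp:
  assumes k: "k \<ge> 5" and m: "m > 0" and N: "N > 0" and R: "R \<subseteq> coprime_rows 1"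
    and per: "\<And>z. z \<in> HH \<Longrightarrow> psum k m R (z + of_nat N) = psum k m R z"
  shows "(psum k m R \<longlongrightarrow> 0) (filtercomap Im at_top)"
proof -
  \<comment> \<open>\<open>K\<close> is the constant of \<open>aut_factor_ge\<close> for
    \<open>y = 1\<close> and \<open>x = N\<close>.\<close>
  define K S where "K = 2 + real N" and "S = (\<Sum>\<^sub>\<infinity>r\<in>R. 1 / wt r ^ 4)"
  have smR: "(\<lambda>r. 1 / wt r ^ 4) summable_on R" using summable_wt R by (rule summable_on_subset_banach)
  have pt: "norm (pterm k m (lift_row r) z) \<le> K ^ 4 / Im z * (1 / wt r ^ 4)"
    if r: "r \<in> R" and y: "Im z \<ge> 1" and x: "\<bar>Re z\<bar> \<le> real N" for r z
  proof -
    have r1: "r \<in> coprime_rows 1" using r R by auto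
    note A = lift_rows[OF r1]
    have zH: "z \<in> HH" using y by (simp add: HH_iff)
    let ?j = "norm (aut_factor (lift_row r) z)"
    have w: "wt r \<ge> 1" by (rule wt_ge_1[OF r1])
    have K1: "K \<ge> 1" by (simp add: K_def)
    have wK: "wt r \<le> K * ?j" using aut_factor_ge[of 1 z "real N" "lift_row r"] y x A by (simp add: K_def)
    show ?thesis
    proof (cases "fst r = 0")
      case False
      then have "1 * Im z \<le> \<bar>real_of_int (fst r)\<bar> * Im z" using y by (intro mult_right_mono) auto
      also have "\<dots> = \<bar>Im (aut_factor (lift_row r) z)\<bar>"
      proof -
        have "fst r = lift_row r $ 2 $ 1" using A(2) by (metis bottom_row_def fst_conv)
        then show ?thesis using y by (simp add: aut_factor_def abs_mult)
      qed
      also have "\<dots> \<le> ?j" by (rule abs_Im_le_cmod)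
      finally have j: "Im z \<le> ?j" by simp
      then have j1: "?j \<ge> 1" using y by simp
      have "wt r ^ 4 * Im z \<le> (K * ?j) ^ 4 * ?j" using wK w j y by (intro mult_mono power_mono) auto
      also have "\<dots> = K ^ 4 * ?j ^ 5" by (simp add: power_mult_distrib eval_nat_numeral)
      also have "?j ^ 5 \<le> ?j ^ k" using j1 k by (intro power_increasing)
      finally have *: "wt r ^ 4 * Im z \<le> K ^ 4 * ?j ^ k" using K1 by (simp add: mult_left_mono)
      have "norm (pterm k m (lift_row r) z) \<le> 1 / ?j ^ k" by (rule norm_pterm_le[OF A(1) zH])
      also have "\<dots> \<le> K ^ 4 / Im z * (1 / wt r ^ 4)"
        using * j1 w y by (simp add: divide_simps mult_ac)
      finally show ?thesis .
    next
      case True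
      then have d: "\<bar>snd r\<bar> = 1" using r1 by (auto simp: coprime_rows_def)
      have "norm (of_int (snd r) :: complex) = 1" using d by (metis norm_of_int of_int_1 of_int_abs)
      moreover have "lift_row r $ 2 $ 1 = 0" "lift_row r $ 2 $ 2 = snd r"
        using True A(2) by (metis bottom_row_def fst_conv, metis bottom_row_def snd_conv)
      ultimately have j: "?j = 1" by (simp add: aut_factor_def)
      have wt1: "wt r = 1" using True d by (simp add: wt_def)
      have "norm (pterm k m (lift_row r) z) = exp (- (2 * pi * m * Im z))"
        by (simp add: norm_pterm[OF A(1) zH] j)
      also have "\<dots> \<le> 1 / Im z"
      proof -
        have "1 * Im z \<le> (2 * pi * m) * Im z"
          using pi_ge_two m y by (intro mult_right_mono) (auto intro: order_trans[of 1 "2 * pi * 1"])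
        also have "\<dots> \<le> exp (2 * pi * m * Im z)" using exp_ge_add_one_self[of "2 * pi * m * Im z"] by linarith
        finally show ?thesis using y by (simp add: exp_minus field_simps)
      qed
      also have "\<dots> \<le> K ^ 4 / Im z" using y K1 by (intro divide_right_mono) auto
      finally show ?thesis by (simp add: wt1)
    qed
  qed
  have bound: "norm (psum k m R z) \<le> K ^ 4 * S / Im z" if y: "Im z \<ge> 1" for z
  proof -
    define n where "n = \<lfloor>Re z / N\<rfloor>"
    define z' where "z' = z + of_int (- n) * of_real (real N)"
    have zH: "z \<in> HH" using y by (simp add: HH_iff)
    have eq: "psum k m R z' = psum k m R z"
      unfolding z'_def using per by (intro periodic_int zH) simp
    have "Re z' = Re z - real_of_int n * real N" "Im z' = Im z" by (simp_all add: z'_def)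
    moreover have "real_of_int n \<le> Re z / N" "Re z / N < real_of_int n + 1" by (auto simp: n_def)
    then have "real_of_int n * N \<le> Re z" "Re z \<le> (real_of_int n + 1) * N" using N by (auto simp: field_simps)
    ultimately have z': "Im z' = Im z" "\<bar>Re z'\<bar> \<le> real N" by (auto simp: algebra_simps)
    have "norm (psum k m R z') \<le> K ^ 4 / Im z * S"
    proof (rule norm_infsum_le)
      show "((\<lambda>r. pterm k m (lift_row r) z') has_sum psum k m R z') R"
        unfolding psum_def using k R z' y by (intro has_sum_infsum pterm_summable) (auto simp: HH_iff)
      show "((\<lambda>r. K ^ 4 / Im z * (1 / wt r ^ 4)) has_sum (K ^ 4 / Im z * S)) R"
        unfolding S_def by (intro has_sum_cmult_right has_sum_infsum smR)
    qed (use pt[of _ z'] z' y in auto)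
    then show ?thesis using eq by simp
  qed
  have lim: "((\<lambda>z. K ^ 4 * S / Im z) \<longlongrightarrow> 0) (filtercomap Im at_top)"
    by (rule tendsto_divide_0[OF tendsto_const]) (rule filterlim_at_top_imp_at_infinity[OF filterlim_filtercomap])
  show ?thesis
  proof (rule Lim_null_comparison[OF _ lim])
    show "\<forall>\<^sub>F z in filtercomap Im at_top. norm (psum k m R z) \<le> K ^ 4 * S / Im z"
      unfolding eventually_filtercomap_at_top_linorder using bound by blast
  qed
qed

text \<open>At the cusp given by \<open>A\<close> the slashed series is again a \<open>psum\<close>,
  over the rows moved by \<open>A\<close>, and it has period \<open>N\<close> by
  \<open>slash_periodic\<close>. So \<open>psum_at_cusp\<close> treats all cusps alike.\<close>

lemma poincare_cusp_form:
  assumes k: "k \<ge> 5" and m: "m > 0" and N: "N > 0"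
  shows "poincare k N m \<in> cusp_forms k N"
proof -
  have half: "slash k (poincare k N m) A z = slash k (psum k m (coprime_rows N)) A z / 2" if "A \<in> SL2Z" "z \<in> HH" for A z
    using moebius_in_HH[OF that] by (simp add: slash_def poincare_def)
  have "poincare k N m holomorphic_on HH"
    by (rule holomorphic_transform[of "\<lambda>z. psum k m (coprime_rows N) z / 2"])
      (use k in \<open>auto simp: poincare_def intro!: holomorphic_intros psum_holomorphic rows_subset\<close>)
  moreover have "slash k (poincare k N m) A z = poincare k N m z" if "A \<in> Gamma0 N" "z \<in> HH" for A z
    using half[OF Gamma0_subset[OF that(1)] that(2)] psum_Gamma0[OF that] that by (simp add: poincare_def)
  moreover have "(slash k (poincare k N m) A \<longlongrightarrow> 0) (filtercomap Im at_top)" if A: "A \<in> SL2Z" for A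
  proof -
    have sub: "act A ` coprime_rows N \<subseteq> coprime_rows 1" using act_rows[OF A] rows_subset by blast
    have "psum k m (act A ` coprime_rows N) (z + of_nat N) = psum k m (act A ` coprime_rows N) z" if z: "z \<in> HH" for z
    proof -
      have "z + of_nat N \<in> HH" using z by (simp add: HH_iff)
      then show ?thesis
        using slash_periodic[OF _ A z, where N = N and k = k and f = "psum k m (coprime_rows N)", OF psum_Gamma0] slash_psum[OF A rows_subset z, of k m N]
          slash_psum[OF A rows_subset, of "z + of_nat N" k m N] by simp
    qed
    then have "(psum k m (act A ` coprime_rows N) \<longlongrightarrow> 0) (filtercomap Im at_top)"
      by (rule psum_at_cusp[OF k m N sub])
    then have "((\<lambda>z. psum k m (act A ` coprime_rows N) z / 2) \<longlongrightarrow> 0 / 2) (filtercomap Im at_top)"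
      by (intro tendsto_intros) auto
    moreover have "\<forall>\<^sub>F z in filtercomap Im at_top. psum k m (act A ` coprime_rows N) z / 2 = slash k (poincare k N m) A z"
      unfolding eventually_filtercomap_at_top_linorder
      using half[OF A] slash_psum[OF A rows_subset, of _ k m N] by (intro exI[of _ 1]) (auto simp: HH_iff)
    ultimately show ?thesis by (simp add: filterlim_cong)
  qed
  ultimately show ?thesis by (simp add: cusp_forms_def poincare_def)
qed

section \<open>The inner product with a Poincare series\<close>

lemma exp_2pi_Complex: "exp (2 * of_real pi * \<i> * of_nat n * Complex x y) = of_real (exp (- (2 * pi * n * y))) * exp (of_real (2 * pi * n * x) * \<i>)"
proof -
  have "2 * of_real pi * \<i> * of_nat n * Complex x y = of_real (- (2 * pi * n * y)) + of_real (2 * pi * n * x) * \<i>"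
    by (simp add: complex_eq_iff)
  then show ?thesis by (simp only: exp_add exp_of_real)
qed

text \<open>The strip is half-open so that it meets each orbit of translations once, whereas the
  fundamental theorem of calculus is applied on the closed interval.\<close>

lemma integral_unit_AE: "(\<integral>x. indicator {0..<1::real} x *\<^sub>R g x \<partial>lborel) = (\<integral>x. indicator {0..1} x *\<^sub>R (g x :: complex) \<partial>lborel)"
  if [measurable]: "g \<in> borel_measurable borel"
proof (rule integral_cong_AE)
  show "AE x in lborel. indicator {0..<1::real} x *\<^sub>R g x = indicator {0..1} x *\<^sub>R g x"
    using AE_lborel_singleton[of "1::real"] by eventually_elim (auto simp: indicator_def)
qed measurable

lemma integral_character:
  "(\<integral>x. indicator {0..<1::real} x *\<^sub>R exp (of_real (2 * pi * of_int n * x) * \<i>) \<partial>lborel) = of_bool (n = 0)"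
proof -
  have m: "(\<lambda>x::real. exp (of_real (2 * pi * of_int n * x) * \<i>)) \<in> borel_measurable borel"
    by (intro borel_measurable_continuous_onI continuous_intros)
  show ?thesis
  proof (cases "n = 0")
    case True
    then show ?thesis by simp
  next
    case False
    define c where "c = 2 * of_real pi * of_int n * \<i>"
    have c: "c \<noteq> 0" using False by (simp add: c_def)
    have e: "exp (of_real (2 * pi * of_int n * x) * \<i>) = exp (c * of_real x)" for x :: real
      by (simp add: c_def mult_ac)
    define F where "F x = exp (c * of_real x) / c" for x :: real
    have "(\<integral>x. indicator {0..1::real} x *\<^sub>R exp (c * of_real x) \<partial>lborel) = F 1 - F 0"
    proof (rule integral_FTC_Icc)
      show "(F has_vector_derivative exp (c * of_real x)) (at x within {0..1})" for x
      proof -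
        have "((\<lambda>z. exp (c * z) / c) has_field_derivative exp (c * of_real x)) (at (of_real x))"
          using c by (auto intro!: derivative_eq_intros)
        then show ?thesis unfolding F_def[abs_def]
          by (rule has_vector_derivative_real_field)
      qed
    qed (auto intro!: continuous_intros)
    also have "exp (c * of_real 1) = 1"
    proof -
      have "c * of_real 1 = 0 + (of_real (of_int (2 * n) * pi)) * \<i>" by (simp add: c_def)
      moreover have "exp (0 + of_real (of_int (2 * n) * pi) * \<i>) = exp 0"
        unfolding exp_eq by (rule exI[of _ n]) simp
      ultimately show ?thesis by (simp only: exp_zero)
    qed
    then have "F 1 - F 0 = 0" by (simp add: F_def)
    finally show ?thesis using integral_unit_AE[OF m[unfolded e]] False unfolding e by simp
  qed
qed

text \<open>Orthogonality of characters, applied term by term. Convergence of the expansion at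
  height \<open>y / 2\<close> gives absolute convergence at height \<open>y\<close> and hence the
  summable majorant \<open>d\<close>. The series and the character each contribute
  \<open>exp (- 2 pi m y)\<close>.\<close>

lemma fourier_integral:
  assumes sums: "\<And>z. z \<in> HH \<Longrightarrow> (\<lambda>n. b n * exp (2 * of_real pi * \<i> * of_nat n * z)) sums f z" and y: "y > 0"
  shows "(\<integral>x. indicator {0..<1} x *\<^sub>R (f (Complex x y) * cnj (exp (2 * of_real pi * \<i> * of_nat m * Complex x y))) \<partial>lborel)
     = b m * of_real (exp (- (4 * pi * m * y)))"
proof -
  define h where "h n x = b n * of_real (exp (- (2 * pi * n * y))) * of_real (exp (- (2 * pi * m * y)))
     * (indicator {0..<1::real} x *\<^sub>R exp (of_real (2 * pi * of_int (int n - int m) * x) * \<i>))" for n x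
  have e_m: "(\<lambda>x::real. exp (of_real (2 * pi * of_int n * x) * \<i>)) \<in> borel_measurable borel" for n
    by (intro borel_measurable_continuous_onI continuous_intros)
  have int1: "integrable lborel (\<lambda>x. indicator {0..<1::real} x *\<^sub>R exp (of_real (2 * pi * of_int n * x) * \<i>))" for n
    by (rule integrableI_bounded_set_indicator[where B = 1]) (auto simp: e_m)
  then have int: "integrable lborel (h n)" for n unfolding h_def by (intro integrable_mult_right)
  have pw: "(\<lambda>n. h n x) sums (indicator {0..<1} x *\<^sub>R (f (Complex x y) * cnj (exp (2 * of_real pi * \<i> * of_nat m * Complex x y))))" for x
  proof -
    have "Complex x y \<in> HH" using y by (simp add: HH_iff)
    from sums_mult2[OF sums[OF this], of "cnj (exp (2 * of_real pi * \<i> * of_nat m * Complex x y))"]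
    have "(\<lambda>n. indicator {0..<1} x *\<^sub>R (b n * exp (2 * of_real pi * \<i> * of_nat n * Complex x y) * cnj (exp (2 * of_real pi * \<i> * of_nat m * Complex x y))))
        sums (indicator {0..<1} x *\<^sub>R (f (Complex x y) * cnj (exp (2 * of_real pi * \<i> * of_nat m * Complex x y))))"
      by (rule sums_scaleR_right)
    moreover have "indicator {0..<1} x *\<^sub>R (b n * exp (2 * of_real pi * \<i> * of_nat n * Complex x y) * cnj (exp (2 * of_real pi * \<i> * of_nat m * Complex x y))) = h n x" for n
    proof -
      have "exp (of_real (2 * pi * n * x) * \<i>) * cnj (exp (of_real (2 * pi * m * x) * \<i>)) = exp (of_real (2 * pi * of_int (int n - int m) * x) * \<i>)"
        by (simp add: exp_cnj algebra_simps flip: exp_add)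
      then show ?thesis unfolding exp_2pi_Complex h_def
        by (simp add: mult_ac scaleR_conv_of_real)
    qed
    ultimately show ?thesis by simp
  qed
  define d where "d n = norm (b n) * exp (- (2 * pi * n * y)) * exp (- (2 * pi * m * y))" for n
  have d: "summable d"
  proof -
    define q where "q t = exp (2 * of_real pi * \<i> * Complex 0 t)" for t
    have qn: "exp (2 * of_real pi * \<i> * of_nat n * Complex 0 t) = q t ^ n" for n t
      unfolding q_def by (subst exp_of_nat_mult[symmetric]) (simp add: mult_ac)
    have nq: "norm (q t) = exp (- (2 * pi * t))" for t unfolding q_def by simp
    have "Complex 0 (y / 2) \<in> HH" using y by (simp add: HH_iff)
    from sums_summable[OF sums[OF this]] have "summable (\<lambda>n. b n * q (y / 2) ^ n)" unfolding qn .
    moreover have "norm (q y) < norm (q (y / 2))" unfolding nq using y by simp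
    ultimately have "summable (\<lambda>n. norm (b n * q y ^ n))" by (rule powser_insidea)
    then have "summable (\<lambda>n. norm (b n * q y ^ n) * exp (- (2 * pi * m * y)))" by (rule summable_mult2)
    then show ?thesis unfolding d_def norm_mult norm_power nq
      by (simp add: exp_of_nat_mult[symmetric] mult_ac)
  qed
  have nh: "norm (h n x) \<le> d n" "norm (h n x) \<le> d n * indicator {0..<1} x" for n x
    by (auto simp: h_def d_def norm_mult indicator_def)
  have "(\<integral>x. indicator {0..<1} x *\<^sub>R (f (Complex x y) * cnj (exp (2 * of_real pi * \<i> * of_nat m * Complex x y))) \<partial>lborel) = (\<integral>x. (\<Sum>n. h n x) \<partial>lborel)"
    using pw by (simp add: sums_iff)
  also have "\<dots> = (\<Sum>n. integral\<^sup>L lborel (h n))"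
  proof (rule integral_suminf[OF int])
    show "AE x in lborel. summable (\<lambda>i. norm (h i x))"
      using d nh(1) by (intro AE_I2 summable_comparison_test'[OF d]) auto
    show "summable (\<lambda>i. \<integral>x. norm (h i x) \<partial>lborel)"
    proof (rule summable_comparison_test'[OF d])
      fix n
      have "(\<integral>x. norm (h n x) \<partial>lborel) \<le> (\<integral>x. d n * indicator {0..<1::real} x \<partial>lborel)"
        using int nh(2) by (intro integral_mono) auto
      then show "norm (\<integral>x. norm (h n x) \<partial>lborel) \<le> d n" by simp
    qed
  qed
  also have "\<dots> = b m * of_real (exp (- (4 * pi * m * y)))"
  proof -
    have "integral\<^sup>L lborel (h n) = (if n = m then b m * of_real (exp (- (4 * pi * m * y))) else 0)" for n
      unfolding h_def integral_mult_right_zero integral_character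
      by (auto simp flip: of_real_mult exp_add)
    then show ?thesis
      using sums_single[of m "\<lambda>_. b m * of_real (exp (- (4 * pi * m * y)))"] by (simp add: sums_iff)
  qed
  finally show ?thesis .
qed

lemma integral_power_exp:
  fixes a :: real
  assumes a: "a > 0"
  shows "has_bochner_integral lborel (\<lambda>y :: real. indicator {0<..} y * (y ^ n * exp (- (a * y)))) (fact n / a ^ (n + 1))"
proof (rule has_bochner_integral_nn_integral)
  let ?I = "\<integral>\<^sup>+y. ennreal (indicator {0<..} y * (y ^ n * exp (- (a * y)))) \<partial>lborel"
  have "ennreal (real (fact n)) = ennreal \<bar>a\<bar> * (\<integral>\<^sup>+y. ennreal ((0 + a * y) ^ n * exp (- (0 + a * y))) * indicator {0..} (0 + a * y) \<partial>lborel)"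
    using a by (subst nn_intergal_power_times_exp_Ici[symmetric], subst nn_integral_real_affine[where c = a and t = 0])
      (auto simp: ennreal_of_nat_eq_real_of_nat)
  also have "(\<integral>\<^sup>+y. ennreal ((0 + a * y) ^ n * exp (- (0 + a * y))) * indicator {0..} (0 + a * y) \<partial>lborel)
      = (\<integral>\<^sup>+y. ennreal (a ^ n) * ennreal (indicator {0<..} y * (y ^ n * exp (- (a * y)))) \<partial>lborel)"
  proof (rule nn_integral_cong_AE)
    show "AE y in lborel. ennreal ((0 + a * y) ^ n * exp (- (0 + a * y))) * indicator {0..} (0 + a * y)
        = ennreal (a ^ n) * ennreal (indicator {0<..} y * (y ^ n * exp (- (a * y))))"
      using AE_lborel_singleton[of "0::real"]
      by eventually_elim (use a in \<open>auto simp: indicator_def power_mult_distrib zero_le_mult_iff mult.assoc simp flip: ennreal_mult'\<close>)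
  qed
  also have "\<dots> = ennreal (a ^ n) * ?I" by (subst nn_integral_cmult) auto
  finally have "ennreal (fact n) = ennreal (a ^ (n + 1)) * ?I"
    using a by (simp add: mult.assoc[symmetric] ennreal_mult'[symmetric])
  then have "ennreal (1 / a ^ (n + 1)) * ennreal (fact n) = (ennreal (1 / a ^ (n + 1)) * ennreal (a ^ (n + 1))) * ?I"
    by (simp add: mult.assoc)
  also have "ennreal (1 / a ^ (n + 1)) * ennreal (a ^ (n + 1)) = 1"
    using a by (subst ennreal_mult'[symmetric]) auto
  finally show "?I = ennreal (fact n / a ^ (n + 1))"
    using a by (simp add: ennreal_mult'[symmetric])
qed (use a in \<open>auto simp: indicator_def\<close>)

lemma cusp_form_measurable:
  assumes "f \<in> cusp_forms k N" shows "f \<in> borel_measurable borel"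
proof -
  have "(\<lambda>z. indicator HH z *\<^sub>R f z) \<in> borel_measurable borel"
    using cusp_formsD(1)[OF assms]
    by (intro borel_measurable_continuous_on_indicator HH_borel holomorphic_on_imp_continuous_on)
  moreover have "(\<lambda>z. indicator HH z *\<^sub>R f z) = f"
    using cusp_formsD(2)[OF assms] by (auto simp: indicator_def fun_eq_iff)
  ultimately show ?thesis by simp
qed

definition strip :: "complex set" where
  "strip = {z \<in> HH. 0 \<le> Re z \<and> Re z < 1}"

lemma strip_borel [measurable]: "strip \<in> sets borel"
proof -
  have "strip = HH \<inter> {z. 0 \<le> Re z} \<inter> {z. Re z < 1}" by (auto simp: strip_def)
  also have "\<dots> \<in> sets borel" by measurable
  finally show ?thesis .
qed

text \<open>The form times the conjugate of the exponential defining the Poincare series, cut off to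
  one fundamental domain of the translations.\<close>

definition strip_fun :: "nat \<Rightarrow> nat \<Rightarrow> (complex \<Rightarrow> complex) \<Rightarrow> complex \<Rightarrow> complex" where
  "strip_fun k m f z = indicator strip z *\<^sub>R (f z * cnj (exp (2 * of_real pi * \<i> * of_nat m * z)) * of_real (Im z ^ k))"

text \<open>The bound \<open>|f| * y^j <= C\<close> dominates the integrand by a multiple of
  \<open>y^(j - 2) * exp (- 2 pi m y)\<close>, so Fubini applies. The inner integral extracts
  \<open>b m\<close>, and the outer one is Euler's integral for
  \<open>Gamma (2 j - 1)\<close>.\<close>

lemma strip_integral:
  assumes f: "f \<in> cusp_forms (2 * j) N" and N: "N > 0" and j: "j \<ge> 2" and m: "m > 0"
    and sums: "\<And>z. z \<in> HH \<Longrightarrow> (\<lambda>n. b n * exp (2 * of_real pi * \<i> * of_nat n * z)) sums f z"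
  shows "integrable hyp (strip_fun (2 * j) m f)"
    and "integral\<^sup>L hyp (strip_fun (2 * j) m f) = b m * of_real (fact (2 * j - 2) / (4 * pi * m) ^ (2 * j - 1))"
proof -
  let ?F = "strip_fun (2 * j) m f"
  note [measurable] = cusp_form_measurable[OF f]
  have F_m [measurable]: "?F \<in> borel_measurable borel"
  proof -
    have [measurable]: "(\<lambda>z. cnj (exp (2 * of_real pi * \<i> * of_nat m * z))) \<in> borel_measurable borel"
      "(\<lambda>z. complex_of_real (Im z ^ (2 * j))) \<in> borel_measurable borel"
      by (intro borel_measurable_continuous_onI continuous_intros)+
    show ?thesis unfolding strip_fun_def[abs_def] by measurable
  qed
  obtain C where C: "C \<ge> 0" "\<And>z. z \<in> HH \<Longrightarrow> norm (f z) * Im z ^ j \<le> C"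
    using cusp_form_bound[OF f N] by blast
  define G where "G z = (1 / (Im z)\<^sup>2 * indicator HH z) *\<^sub>R ?F z" for z
  have G_m [measurable]: "G \<in> borel_measurable borel" unfolding G_def[abs_def] by measurable
  have G_eq: "G (Complex x y) = (indicator {0<..} y * y ^ (2 * j - 2)) *\<^sub>R
      (indicator {0..<1} x *\<^sub>R (f (Complex x y) * cnj (exp (2 * of_real pi * \<i> * of_nat m * Complex x y))))" for x y
  proof (cases "y > 0")
    case True
    have "2 * j = 2 + (2 * j - 2)" using j by simp
    then have "y ^ (2 * j) = y ^ 2 * y ^ (2 * j - 2)" by (metis power_add)
    then show ?thesis using True
      by (simp add: G_def strip_fun_def strip_def HH_iff indicator_def scaleR_conv_of_real)
  qed (simp add: G_def HH_iff)
  define g where "g y = indicator {0<..} y * (y ^ (j - 2) * exp (- (2 * pi * m * y)))" for y :: real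
  have g: "has_bochner_integral lborel g (fact (j - 2) / (2 * pi * m) ^ (j - 2 + 1))"
    unfolding g_def[abs_def] using m by (intro integral_power_exp) simp
  have g0: "g y \<ge> 0" for y by (simp add: g_def indicator_def)
  have bound: "norm (G (Complex x y)) \<le> indicator {0..<1} x * (C * g y)" for x y
  proof (cases "y > 0")
    case True
    have "norm (f (Complex x y)) * y ^ j \<le> C" using C(2)[of "Complex x y"] True by (simp add: HH_iff)
    then have "norm (f (Complex x y)) * y ^ j * (y ^ (j - 2) * exp (- (2 * pi * m * y))) \<le> C * (y ^ (j - 2) * exp (- (2 * pi * m * y)))"
      using True by (intro mult_right_mono) auto
    moreover have "2 * j - 2 = j + (j - 2)" using j by simp
    then have "y ^ (2 * j - 2) = y ^ j * y ^ (j - 2)" by (metis power_add)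
    ultimately show ?thesis using True unfolding G_eq exp_2pi_Complex
      by (auto simp: indicator_def norm_mult g_def mult_ac)
  qed (simp add: G_def HH_iff g_def)
  have int2: "integrable (lborel \<Otimes>\<^sub>M lborel) (\<lambda>(x, y). G (Complex x y))"
  proof (rule integrableI_bounded)
    show m2: "(\<lambda>(x, y). G (Complex x y)) \<in> borel_measurable (lborel \<Otimes>\<^sub>M lborel)"
      using measurable_compose[OF measurable_Complex_pair G_m] by (simp add: case_prod_beta')
    have gm [measurable]: "g \<in> borel_measurable borel" unfolding g_def[abs_def] by measurable
    have "(\<integral>\<^sup>+p. ennreal (norm (case p of (x, y) \<Rightarrow> G (Complex x y))) \<partial>(lborel \<Otimes>\<^sub>M lborel))
        \<le> (\<integral>\<^sup>+p. ennreal (indicator {0..<1::real} (fst p)) * ennreal (C * g (snd p)) \<partial>(lborel \<Otimes>\<^sub>M lborel))"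
    proof (rule nn_integral_mono)
      fix p :: "real \<times> real"
      have "norm (G (Complex (fst p) (snd p))) \<le> indicator {0..<1} (fst p) * (C * g (snd p))" by (rule bound)
      then have "ennreal (norm (G (Complex (fst p) (snd p)))) \<le> ennreal (indicator {0..<1} (fst p) * (C * g (snd p)))"
        by (rule ennreal_leI)
      also have "\<dots> = ennreal (indicator {0..<1} (fst p)) * ennreal (C * g (snd p))"
        using C(1) g0[of "snd p"] by (intro ennreal_mult) auto
      finally show "ennreal (norm (case p of (x, y) \<Rightarrow> G (Complex x y))) \<le> ennreal (indicator {0..<1} (fst p)) * ennreal (C * g (snd p))"
        by (simp add: case_prod_beta')
    qed
    also have "\<dots> = (\<integral>\<^sup>+x. \<integral>\<^sup>+y. ennreal (indicator {0..<1::real} x) * ennreal (C * g y) \<partial>lborel \<partial>lborel)"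
      by (subst lborel.nn_integral_fst[symmetric]) auto
    also have "\<dots> = (\<integral>\<^sup>+x. ennreal (indicator {0..<1::real} x) \<partial>lborel) * (\<integral>\<^sup>+y. ennreal (C * g y) \<partial>lborel)"
      by (simp add: nn_integral_cmult nn_integral_multc)
    also have "\<dots> < \<infinity>"
    proof -
      have "integrable lborel (\<lambda>y. C * g y)" using g by (auto simp: has_bochner_integral_iff)
      then have "(\<integral>\<^sup>+y. ennreal (norm (C * g y)) \<partial>lborel) < \<infinity>" unfolding integrable_iff_bounded by blast
      moreover have "norm (C * g y) = C * g y" for y using C g0[of y] by simp
      ultimately have "(\<integral>\<^sup>+y. ennreal (C * g y) \<partial>lborel) < \<infinity>" by simp
      then show ?thesis by (simp add: ennreal_indicator ennreal_mult_less_top)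
    qed
    finally show "(\<integral>\<^sup>+p. ennreal (norm (case p of (x, y) \<Rightarrow> G (Complex x y))) \<partial>(lborel \<Otimes>\<^sub>M lborel)) < \<infinity>" .
  qed
  have "integrable lborel G"
    unfolding lborel_complex_prod
    by (subst integrable_distr_eq[OF measurable_Complex_pair]) (use int2 in \<open>auto simp: case_prod_beta'\<close>)
  then show "integrable hyp ?F" using integral_hyp(2)[OF F_m] by (simp add: G_def[abs_def])
  have "integral\<^sup>L hyp ?F = integral\<^sup>L lborel G" using integral_hyp(1)[OF F_m] by (simp add: G_def[abs_def])
  also have "\<dots> = integral\<^sup>L (lborel \<Otimes>\<^sub>M lborel) (\<lambda>(x, y). G (Complex x y))"
    unfolding lborel_complex_prod
    by (subst integral_distr[OF measurable_Complex_pair]) (auto simp: case_prod_beta')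
  also have "\<dots> = (\<integral>y. (\<integral>x. G (Complex x y) \<partial>lborel) \<partial>lborel)"
    by (rule lborel_pair.integral_snd[symmetric]) (use int2 in simp)
  also have "\<dots> = (\<integral>y. b m * of_real (indicator {0<..} y * (y ^ (2 * j - 2) * exp (- (4 * pi * m * y)))) \<partial>lborel)"
  proof (intro Bochner_Integration.integral_cong refl)
    fix y :: real
    show "(\<integral>x. G (Complex x y) \<partial>lborel) = b m * of_real (indicator {0<..} y * (y ^ (2 * j - 2) * exp (- (4 * pi * m * y))))"
    proof (cases "y > 0")
      case True
      have "(\<integral>x. G (Complex x y) \<partial>lborel) = of_real (indicator {0<..} y * y ^ (2 * j - 2)) *
          (\<integral>x. indicator {0..<1} x *\<^sub>R (f (Complex x y) * cnj (exp (2 * of_real pi * \<i> * of_nat m * Complex x y))) \<partial>lborel)"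
        unfolding G_eq scaleR_conv_of_real[of "indicator {0<..} y * y ^ (2 * j - 2)"] by (rule integral_mult_right_zero)
      also have "\<dots> = of_real (indicator {0<..} y * y ^ (2 * j - 2)) * (b m * of_real (exp (- (4 * pi * m * y))))"
        by (rule arg_cong[where f = "(*) _"], rule fourier_integral[where b = b, OF sums True])
      finally show ?thesis by (simp add: mult_ac)
    qed (simp add: G_eq)
  qed
  also have "\<dots> = b m * of_real (fact (2 * j - 2) / (4 * pi * m) ^ (2 * j - 2 + 1))"
    using has_bochner_integral_integral_eq[OF integral_power_exp[of "4 * pi * m" "2 * j - 2"]] m
    by (subst integral_mult_right_zero, subst integral_complex_of_real) simp
  also have "2 * j - 2 + 1 = 2 * j - 1" using j by simp
  finally show "integral\<^sup>L hyp ?F = b m * of_real (fact (2 * j - 2) / (4 * pi * m) ^ (2 * j - 1))" .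
qed

text \<open>Each row has exactly one representative that moves \<open>z\<close> into the half-open
  strip; all other group elements contribute 0. With \<open>J = cz + d\<close>, the factor
  \<open>J^k\<close> from \<open>f\<close> and \<open>|J|^(-2k)\<close> from the imaginary part
  leave \<open>cnj J^(-k)\<close>, as in the conjugated Poincare term.\<close>

lemma strip_fun_orbit_sum:
  assumes k: "k \<ge> 4" and z: "z \<in> HH" and inv: "\<And>A z. A \<in> Gamma0 N \<Longrightarrow> z \<in> HH \<Longrightarrow> slash (2 * j) f A z = f z"
    and kj: "k = 2 * j"
  shows "((\<lambda>A. strip_fun k m f (moebius A z)) has_sum (f z * of_real (Im z ^ k) * cnj (psum k m (coprime_rows N) z))) (Gamma0 N)"
proof -
  let ?X = "{A \<in> Gamma0 N. moebius A z \<in> strip}"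
  have bij: "bij_betw bottom_row ?X (coprime_rows N)"
  proof (rule bij_betwI')
    fix A B assume AB: "A \<in> ?X" "B \<in> ?X"
    then have SL: "A \<in> SL2Z" "B \<in> SL2Z" using Gamma0_subset by auto
    show "bottom_row A = bottom_row B \<longleftrightarrow> A = B"
    proof
      assume "bottom_row A = bottom_row B"
      then obtain n where n: "A = transl n ** B" using same_row SL by blast
      have "moebius A z = moebius B z + of_int n" unfolding n using SL z by (simp add: moebius_mult)
      then have "0 \<le> Re (moebius B z) + of_int n" "Re (moebius B z) + of_int n < 1" "0 \<le> Re (moebius B z)" "Re (moebius B z) < 1"
        using AB by (auto simp: strip_def)
      then have "n = 0" by linarith
      then show "A = B" unfolding n by (intro mat2_eqI) (simp_all add: mat2_mult_nth)
    qed simp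
  next
    fix A assume "A \<in> ?X"
    then show "bottom_row A \<in> coprime_rows N" using row_in_rows_iff[OF Gamma0_subset[of A N]] by simp
  next
    fix r assume r: "r \<in> coprime_rows N"
    note L = lift_rows[OF r]
    define n where "n = - \<lfloor>Re (moebius (lift_row r) z)\<rfloor>"
    define A where "A = transl n ** lift_row r"
    have row: "bottom_row A = r" using L by (simp add: A_def bottom_row_def mat2_mult_nth)
    have SL: "A \<in> SL2Z" using L SL2Z_closed by (simp add: A_def)
    have "A \<in> Gamma0 N" using row_in_rows_iff[OF SL] row r by simp
    moreover have "moebius A z = moebius (lift_row r) z + of_int n" using L z by (simp add: A_def moebius_mult)
    then have "moebius A z \<in> strip" using moebius_in_HH[OF SL z]
      by (auto simp: strip_def n_def) linarith+
    ultimately show "\<exists>A\<in>?X. r = bottom_row A" using row by blast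
  qed
  have ps: "((\<lambda>r. pterm k m (lift_row r) z) has_sum psum k m (coprime_rows N) z) (coprime_rows N)"
    unfolding psum_def using pterm_summable[OF k rows_subset z] by (rule has_sum_infsum)
  then have "((\<lambda>A. pterm k m (lift_row (bottom_row A)) z) has_sum psum k m (coprime_rows N) z) ?X"
    by (rule has_sum_reindex_bij_betw[OF bij, THEN iffD2])
  then have "((\<lambda>A. cnj (pterm k m (lift_row (bottom_row A)) z)) has_sum cnj (psum k m (coprime_rows N) z)) ?X"
    by simp
  then have s: "((\<lambda>A. f z * of_real (Im z ^ k) * cnj (pterm k m (lift_row (bottom_row A)) z)) has_sum
      (f z * of_real (Im z ^ k) * cnj (psum k m (coprime_rows N) z))) ?X"
    by (rule has_sum_cmult_right)
  show ?thesis
  proof (rule has_sum_cong_neutral[THEN iffD1, OF _ _ _ s])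
    show "strip_fun k m f (moebius A z) = 0" if "A \<in> Gamma0 N - ?X" for A
      using that by (simp add: strip_fun_def)
    show "f z * of_real (Im z ^ k) * cnj (pterm k m (lift_row (bottom_row A)) z) = strip_fun k m f (moebius A z)"
      if "A \<in> ?X \<inter> Gamma0 N" for A
    proof -
      have A: "A \<in> Gamma0 N" "moebius A z \<in> strip" and SL: "A \<in> SL2Z" using that Gamma0_subset by auto
      let ?j = "aut_factor A z" and ?e = "exp (2 * of_real pi * \<i> * of_nat m * moebius A z)"
      have nz: "?j \<noteq> 0" by (rule aut_factor_neq_0[OF SL z])
      have r: "bottom_row A \<in> coprime_rows N" using A row_in_rows_iff[OF SL] by simp
      have pt: "pterm k m (lift_row (bottom_row A)) z = ?e / ?j ^ k"
        using pterm_cong[OF _ SL _ z, of "lift_row (bottom_row A)" k m] lift_rows[OF r] by (simp add: pterm_def)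
      have fz: "f (moebius A z) = f z * ?j ^ k" using inv[OF A(1) z] nz by (simp add: slash_def kj field_simps)
      have "of_real (Im (moebius A z) ^ k) = of_real (Im z ^ k) / (of_real ((norm ?j)\<^sup>2) :: complex) ^ k"
        by (simp add: Im_moebius[OF SL z] power_divide)
      also have "of_real ((norm ?j)\<^sup>2) = ?j * cnj ?j" by (rule complex_norm_square)
      finally have im: "of_real (Im (moebius A z) ^ k) = of_real (Im z ^ k) / (?j ^ k * cnj ?j ^ k)"
        by (simp add: power_mult_distrib)
      show ?thesis unfolding strip_fun_def pt fz im using A(2) nz by (simp add: field_simps)
    qed
  qed auto
qed

text \<open>The factor 2 of the unfolding cancels the division by 2 in
  \<open>poincare\<close>.\<close>

lemma petersson_poincare:
  assumes f: "f \<in> cusp_forms (2 * j) N" and N: "N > 0" and j: "j \<ge> 3" and m: "m > 0"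
    and sums: "\<And>z. z \<in> HH \<Longrightarrow> (\<lambda>n. b n * exp (2 * of_real pi * \<i> * of_nat n * z)) sums f z"
  shows "petersson (2 * j) N f (poincare (2 * j) N m) = b m * of_real (fact (2 * j - 2) / (4 * pi * m) ^ (2 * j - 1))"
proof -
  let ?D = "Ford_domain N" and ?k = "2 * j" and ?F = "strip_fun (2 * j) m f"
  let ?S = "\<lambda>z. \<Sum>\<^sub>\<infinity>A\<in>Gamma0 N. ?F (moebius A z)"
  have j2: "j \<ge> 2" using j by simp
  have hs: "((\<lambda>A. ?F (moebius A z)) has_sum (f z * of_real (Im z ^ ?k) * cnj (psum ?k m (coprime_rows N) z))) (Gamma0 N)"
    if "z \<in> HH" for z
    using j by (intro strip_fun_orbit_sum[OF _ that cusp_formsD(3)[OF f]]) auto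
  have sm: "(\<lambda>A. ?F (moebius A z)) summable_on Gamma0 N" if "z \<in> HH" for z
    using hs[OF that] by (rule has_sum_imp_summable)
  note I = strip_integral[where b = b, OF f N j2 m sums]
  note U = integral_unfold[OF I(1) sm]
  have ms: "(\<lambda>z. indicator ?D z *\<^sub>R ?S z) \<in> borel_measurable borel"
    using borel_measurable_integrable[OF U(1)] by simp
  have "petersson ?k N f (poincare ?k N m) = (\<integral>z. (1 / (Im z)\<^sup>2 * indicator HH z) *\<^sub>R (indicator ?D z *\<^sub>R ?S z) / 2 \<partial>lborel)"
    unfolding petersson_def set_lebesgue_integral_def
  proof (intro Bochner_Integration.integral_cong refl)
    fix z
    show "indicat_real ?D z *\<^sub>R (f z * cnj (poincare ?k N m z) * of_real (Im z ^ ?k / (Im z)\<^sup>2))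
        = (1 / (Im z)\<^sup>2 * indicator HH z) *\<^sub>R (indicator ?D z *\<^sub>R ?S z) / 2"
    proof (cases "z \<in> ?D")
      case True
      then have z: "z \<in> HH" by (simp add: Ford_domain_def)
      show ?thesis using True z infsumI[OF hs[OF z]]
        by (simp add: poincare_def scaleR_conv_of_real mult_ac)
    qed simp
  qed
  also have "\<dots> = integral\<^sup>L hyp (\<lambda>z. indicator ?D z *\<^sub>R ?S z) / 2"
    unfolding integral_hyp(1)[OF ms] by (rule integral_divide_zero)
  also have "\<dots> = integral\<^sup>L hyp ?F" using U(2) by simp
  finally show ?thesis using strip_integral(2)[where b = b, OF f N j2 m sums] by simp
qed

section \<open>The Lipschitz formula\<close>

lemma HH_not_Ints: "z \<in> HH \<Longrightarrow> z \<notin> \<int>" "z \<in> HH \<Longrightarrow> 1 - z \<notin> \<int>"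
  by (auto simp: HH_iff complex_is_Int_iff)

lemma HH_not_nonpos_Ints: "z \<in> HH \<Longrightarrow> z \<notin> \<int>\<^sub>\<le>\<^sub>0" "z \<in> HH \<Longrightarrow> 1 - z \<notin> \<int>\<^sub>\<le>\<^sub>0"
  using HH_not_Ints nonpos_Ints_subset_Ints by blast+

lemma sin_pi_neq_0: "z \<in> HH \<Longrightarrow> sin (of_real pi * z) \<noteq> 0"
  using HH_not_Ints(1)[of z] by (simp add: sin_eq_0) (auto simp: Ints_def)

text \<open>Differentiation of \<open>rGamma z * rGamma (1 - z) = sin (pi z) / pi\<close>.\<close>

lemma Digamma_reflection:
  assumes z: "z \<in> HH"
  shows "Digamma z - Digamma (1 - z) = - of_real pi * cos (of_real pi * z) / sin (of_real pi * z)"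
proof -
  note nz = HH_not_nonpos_Ints[OF z]
  have "((\<lambda>z. rGamma z * rGamma (1 - z)) has_field_derivative
      (- rGamma z * Digamma z) * rGamma (1 - z) + ((- rGamma (1 - z) * Digamma (1 - z)) * (0 - 1)) * rGamma z) (at z)"
    by (rule DERIV_mult[OF has_field_derivative_rGamma_no_nonpos_int[OF nz(1)]
        DERIV_chain2[OF has_field_derivative_rGamma_no_nonpos_int[OF nz(2)] DERIV_diff[OF DERIV_const DERIV_ident]]])
  moreover have "((\<lambda>z. sin (of_real pi * z) / of_real pi) has_field_derivative cos (of_real pi * z)) (at z)"
    by (auto intro!: derivative_eq_intros)
  ultimately have "(- rGamma z * Digamma z) * rGamma (1 - z) + ((- rGamma (1 - z) * Digamma (1 - z)) * (0 - 1)) * rGamma z = cos (of_real pi * z)"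
    unfolding rGamma_reflection_complex by (rule DERIV_unique)
  then have "- (rGamma z * rGamma (1 - z)) * (Digamma z - Digamma (1 - z)) = cos (of_real pi * z)"
    by (simp add: algebra_simps)
  then show ?thesis
    unfolding rGamma_reflection_complex using sin_pi_neq_0[OF z] by (simp add: field_simps)
qed

definition qq :: "complex \<Rightarrow> complex" where
  "qq z = exp (2 * of_real pi * \<i> * z)"

lemma qq_pow: "exp (2 * of_real pi * \<i> * of_nat n * z) = qq z ^ n"
  unfolding qq_def by (subst exp_of_nat_mult[symmetric]) (simp add: mult_ac)

lemma norm_qq: "norm (qq z) = exp (- (2 * pi * Im z))"
  by (simp add: qq_def)

lemma norm_qq_less: "z \<in> HH \<Longrightarrow> norm (qq z) < 1"
  by (simp add: norm_qq HH_iff)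

lemma summable_power_powser: "norm q < 1 \<Longrightarrow> summable (\<lambda>n. of_nat n ^ s * q ^ n)" for q :: complex
proof (induction s arbitrary: q)
  case (Suc s)
  have "summable (\<lambda>n. diffs (\<lambda>n. of_nat n ^ s) n * q ^ n)"
    by (rule termdiff_converges[of _ 1]) (use Suc in auto)
  then have "summable (\<lambda>n. q * (diffs (\<lambda>n. of_nat n ^ s) n * q ^ n))" by (rule summable_mult)
  then have "summable (\<lambda>n. of_nat (Suc n) ^ Suc s * q ^ Suc n)"
    by (simp add: diffs_def mult_ac)
  then show ?case by (subst (asm) summable_Suc_iff)
qed simp

text \<open>The geometric series in \<open>q\<close> after \<open>s\<close> applications of
  \<open>q d/dq\<close>; it is the Fourier side of the Lipschitz formula.\<close>

definition GG :: "nat \<Rightarrow> complex \<Rightarrow> complex" where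
  "GG s z = (\<Sum>n. of_nat n ^ s * qq z ^ n)"

lemma GG_deriv:
  assumes z: "z \<in> HH"
  shows "(GG s has_field_derivative 2 * of_real pi * \<i> * GG (Suc s) z) (at z)"
proof -
  let ?q = "qq z"
  have q: "norm ?q < 1" by (rule norm_qq_less[OF z])
  have D: "((\<lambda>q. \<Sum>n. of_nat n ^ s * q ^ n) has_field_derivative (\<Sum>n. diffs (\<lambda>n. of_nat n ^ s) n * ?q ^ n)) (at ?q)"
    by (rule termdiffs_strong'[of 1]) (use q summable_power_powser in auto)
  have "(qq has_field_derivative 2 * of_real pi * \<i> * ?q) (at z)"
    unfolding qq_def[abs_def] by (auto intro!: derivative_eq_intros)
  from DERIV_chain2[OF D this]
  have "(GG s has_field_derivative (\<Sum>n. diffs (\<lambda>n. of_nat n ^ s) n * ?q ^ n) * (2 * of_real pi * \<i> * ?q)) (at z)"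
    unfolding GG_def[abs_def] .
  moreover have "(\<Sum>n. diffs (\<lambda>n. of_nat n ^ s) n * ?q ^ n) * ?q = GG (Suc s) z"
  proof -
    have "summable (\<lambda>n. diffs (\<lambda>n. of_nat n ^ s) n * ?q ^ n)"
      by (rule termdiff_converges[of _ 1]) (use q summable_power_powser in auto)
    then have "(\<lambda>n. diffs (\<lambda>n. of_nat n ^ s) n * ?q ^ n * ?q) sums ((\<Sum>n. diffs (\<lambda>n. of_nat n ^ s) n * ?q ^ n) * ?q)"
      by (intro sums_mult2 summable_sums)
    then have "(\<lambda>n. of_nat (Suc n) ^ Suc s * ?q ^ Suc n) sums ((\<Sum>n. diffs (\<lambda>n. of_nat n ^ s) n * ?q ^ n) * ?q)"
      by (simp add: diffs_def mult_ac)
    then have "(\<lambda>n. of_nat n ^ Suc s * ?q ^ n) sums ((\<Sum>n. diffs (\<lambda>n. of_nat n ^ s) n * ?q ^ n) * ?q)"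
      by (subst (asm) sums_Suc_iff) simp
    then show ?thesis by (simp add: GG_def sums_iff)
  qed
  moreover have "D * (c * q) = c * (D * q)" for D c q :: complex by (simp add: mult_ac)
  ultimately show ?thesis by metis
qed

text \<open>This is \<open>- pi cot (pi z)\<close> as a geometric series in \<open>q\<close>, valid
  because \<open>|q| < 1\<close> on \<open>HH\<close>.\<close>

lemma Digamma_reflection_q:
  assumes z: "z \<in> HH"
  shows "Digamma z - Digamma (1 - z) = 2 * of_real pi * \<i> * GG 0 z - of_real pi * \<i>"
proof -
  define e where "e = exp (\<i> * (of_real pi * z))"
  have e0: "e \<noteq> 0" by (simp add: e_def)
  have q: "qq z = e\<^sup>2" by (simp add: qq_def e_def power2_eq_square flip: exp_add) (simp add: algebra_simps)
  have "GG 0 z = 1 / (1 - qq z)" using norm_qq_less[OF z] by (simp add: GG_def suminf_geometric)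
  then have G: "GG 0 z = 1 / (1 - e\<^sup>2)" by (simp add: q)
  have ne: "1 - e\<^sup>2 \<noteq> 0" using norm_qq_less[OF z] unfolding q by auto
  have m: "exp (- (\<i> * (of_real pi * z))) = 1 / e" by (simp add: e_def exp_minus field_simps)
  have "sin (of_real pi * z) = (e - 1 / e) / (2 * \<i>)" by (simp add: sin_exp_eq e_def m[unfolded e_def])
  moreover have "cos (of_real pi * z) = (e + 1 / e) / 2" by (simp add: cos_exp_eq e_def m[unfolded e_def])
  ultimately have "- of_real pi * cos (of_real pi * z) / sin (of_real pi * z) = - of_real pi * ((e + 1 / e) / 2) / ((e - 1 / e) / (2 * \<i>))"
    by simp
  also have "\<dots> = of_real pi * \<i> * (1 + e\<^sup>2) / (1 - e\<^sup>2)"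
  proof -
    have "e - 1 / e \<noteq> 0" using ne e0 by (auto simp: field_simps power2_eq_square)
    then show ?thesis using ne e0 by (simp add: field_simps power2_eq_square)
  qed
  also have "\<dots> = 2 * of_real pi * \<i> * GG 0 z - of_real pi * \<i>"
    unfolding G using ne by (simp add: field_simps)
  finally show ?thesis unfolding Digamma_reflection[OF z] .
qed

text \<open>Repeated differentiation of \<open>Digamma_reflection_q\<close>: each step gains a
  factor \<open>2 pi i\<close> and raises the index of \<open>GG\<close>, while the chain rule at
  \<open>1 - z\<close> flips the sign.\<close>

lemma Polygamma_reflection:
  "z \<in> HH \<Longrightarrow> Polygamma (Suc s) z - (-1) ^ Suc s * Polygamma (Suc s) (1 - z) = (2 * of_real pi * \<i>) ^ (s + 2) * GG (Suc s) z"
proof (induction s arbitrary: z)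
  case step: 0
  note nz = HH_not_nonpos_Ints[OF step]
  have L: "((\<lambda>z. Digamma z - Digamma (1 - z)) has_field_derivative Polygamma (Suc 0) z - Polygamma (Suc 0) (1 - z) * (0 - 1)) (at z)"
    by (rule DERIV_diff[OF has_field_derivative_Polygamma[OF nz(1)]
        DERIV_chain2[OF has_field_derivative_Polygamma[OF nz(2)] DERIV_diff[OF DERIV_const DERIV_ident]]])
  have "((\<lambda>z. 2 * of_real pi * \<i> * GG 0 z - of_real pi * \<i>) has_field_derivative 2 * of_real pi * \<i> * (2 * of_real pi * \<i> * GG (Suc 0) z) - 0) (at z)"
    by (intro DERIV_diff DERIV_cmult DERIV_const GG_deriv step)
  then have "((\<lambda>z. Digamma z - Digamma (1 - z)) has_field_derivative 2 * of_real pi * \<i> * (2 * of_real pi * \<i> * GG (Suc 0) z) - 0) (at z)"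
    by (rule has_field_derivative_transform_within_open[OF _ open_HH step]) (simp add: Digamma_reflection_q)
  from DERIV_unique[OF L this] show ?case by (simp add: power2_eq_square mult_ac)
next
  case (Suc s)
  note nz = HH_not_nonpos_Ints[OF Suc.prems]
  let ?t = "Suc s"
  have L: "((\<lambda>z. Polygamma ?t z - (-1) ^ ?t * Polygamma ?t (1 - z)) has_field_derivative
      Polygamma (Suc ?t) z - (-1) ^ ?t * (Polygamma (Suc ?t) (1 - z) * (0 - 1))) (at z)"
    by (rule DERIV_diff[OF has_field_derivative_Polygamma[OF nz(1)] DERIV_cmult[OF
        DERIV_chain2[OF has_field_derivative_Polygamma[OF nz(2)] DERIV_diff[OF DERIV_const DERIV_ident]]]])
  have "((\<lambda>z. (2 * of_real pi * \<i>) ^ (s + 2) * GG ?t z) has_field_derivative (2 * of_real pi * \<i>) ^ (s + 2) * (2 * of_real pi * \<i> * GG (Suc ?t) z)) (at z)"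
    by (intro DERIV_cmult GG_deriv Suc.prems)
  then have "((\<lambda>z. Polygamma ?t z - (-1) ^ ?t * Polygamma ?t (1 - z)) has_field_derivative (2 * of_real pi * \<i>) ^ (s + 2) * (2 * of_real pi * \<i> * GG (Suc ?t) z)) (at z)"
    by (rule has_field_derivative_transform_within_open[OF _ open_HH Suc.prems]) (rule Suc.IH[symmetric])
  from DERIV_unique[OF L this]
  have "Polygamma (Suc ?t) z - (-1) ^ ?t * (Polygamma (Suc ?t) (1 - z) * (0 - 1)) = (2 * of_real pi * \<i>) ^ (s + 2) * (2 * of_real pi * \<i> * GG (Suc ?t) z)" .
  moreover have "c ^ (s + 2) * (c * G) = c ^ (Suc s + 2) * G" for c G :: complex
    by simp
  moreover have "Polygamma (Suc ?t) z - (-1) ^ ?t * (Polygamma (Suc ?t) (1 - z) * (0 - 1)) = Polygamma (Suc ?t) z - (-1) ^ Suc ?t * Polygamma (Suc ?t) (1 - z)"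
    by simp
  ultimately show ?case by (simp only:)
qed

lemma summable_int_power:
  assumes z: "z \<in> HH" and s: "s \<ge> 2"
  shows "(\<lambda>l :: int. norm (1 / (z + of_int l) ^ s)) summable_on UNIV"
proof (rule summable_on_comparison_test)
  define K where "K = 1 / Im z + 1 + \<bar>Re z\<bar> / Im z"
  have y: "Im z > 0" using z by (simp add: HH_iff)
  have K: "K > 0" unfolding K_def using y by (intro add_pos_nonneg add_pos_pos) auto
  show "(\<lambda>l :: int. K ^ s * (1 / (1 + (real_of_int l)\<^sup>2))) summable_on UNIV"
    by (intro summable_on_cmult_right summable_int_inverse_square)
  show "norm (1 / (z + of_int l) ^ s) \<le> K ^ s * (1 / (1 + (real_of_int l)\<^sup>2))" for l
  proof -
    \<comment> \<open>The row \<open>(1, l)\<close> has automorphy factor \<open>z + l\<close>, so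
      \<open>aut_factor_ge\<close> applies.\<close>
    define A where "A = mat2 0 (- 1) 1 l"
    have w: "wt (bottom_row A) = 1 + \<bar>real_of_int l\<bar>" by (simp add: A_def bottom_row_def wt_def)
    have a: "aut_factor A z = z + of_int l" by (simp add: A_def aut_factor_def)
    have le: "1 + \<bar>real_of_int l\<bar> \<le> K * norm (z + of_int l)"
      using aut_factor_ge[of "Im z" z "\<bar>Re z\<bar>" A] y unfolding w a K_def by simp
    have nz: "norm (z + of_int l) > 0" using y by (auto simp: complex_eq_iff)
    have "1 + (real_of_int l)\<^sup>2 \<le> (1 + \<bar>real_of_int l\<bar>)\<^sup>2" by (simp add: power2_eq_square algebra_simps)
    also have "\<dots> \<le> (1 + \<bar>real_of_int l\<bar>) ^ s" using s by (intro power_increasing) auto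
    also have "\<dots> \<le> (K * norm (z + of_int l)) ^ s" using le by (intro power_mono) auto
    finally have "1 + (real_of_int l)\<^sup>2 \<le> K ^ s * norm (z + of_int l) ^ s" by (simp add: power_mult_distrib)
    moreover have "1 + (real_of_int l)\<^sup>2 > 0" by (simp add: add_pos_nonneg)
    ultimately show ?thesis using nz by (simp add: norm_divide norm_power field_simps)
  qed
qed simp

lemma GG_has_sum:
  assumes z: "z \<in> HH"
  shows "((\<lambda>n. of_nat n ^ s * qq z ^ n) has_sum GG s z) UNIV"
    and "(\<lambda>n. norm (of_nat n ^ s * qq z ^ n)) summable_on UNIV"
proof -
  have "summable (\<lambda>n. complex_of_nat n ^ s * of_real (norm (qq z)) ^ n)"
    using norm_qq_less[OF z] by (intro summable_power_powser) simp
  then have "summable (\<lambda>n. complex_of_real (norm (of_nat n ^ s * qq z ^ n)))"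
    by (simp add: norm_mult norm_power)
  then have sm: "summable (\<lambda>n. norm (of_nat n ^ s * qq z ^ n))"
    by (subst (asm) summable_of_real_iff)
  show "((\<lambda>n. of_nat n ^ s * qq z ^ n) has_sum GG s z) UNIV"
    unfolding GG_def by (rule norm_summable_imp_has_sum[OF sm summable_sums[OF summable_norm_cancel[OF sm]]])
  show "(\<lambda>n. norm (of_nat n ^ s * qq z ^ n)) summable_on UNIV"
    unfolding summable_on_UNIV_nonneg_real_iff[of "\<lambda>n. norm (of_nat n ^ s * qq z ^ n)", OF norm_ge_zero] by (rule sm)
qed

text \<open>The terms with \<open>l >= 0\<close> form a Polygamma series at \<open>z\<close>; those
  with \<open>l < 0\<close> form one at \<open>1 - z\<close>, through \<open>l = - 1 - n\<close>.
  \<open>Polygamma_reflection\<close> evaluates the combination.\<close>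

lemma Lipschitz:
  assumes z: "z \<in> HH"
  shows "((\<lambda>l :: int. 1 / (z + of_int l) ^ (s + 2)) has_sum
    ((- 2 * of_real pi * \<i>) ^ (s + 2) / fact (Suc s) * GG (Suc s) z)) UNIV"
proof -
  let ?f = "\<lambda>l :: int. 1 / (z + of_int l) ^ (s + 2)"
  note nz = HH_not_nonpos_Ints[OF z]
  have z0: "z \<noteq> 0" "1 - z \<noteq> 0" using HH_not_Ints[OF z] by auto
  have sm: "(\<lambda>l. norm (?f l)) summable_on UNIV" using z by (intro summable_int_power) auto
  define a where "a n = int n" for n
  define b where "b n = - 1 - int n" for n
  have inj: "inj a" "inj b" by (auto simp: a_def b_def inj_on_def)
  have sums_to: "(?f has_sum S) (range g)" if "inj g" "(\<lambda>n. ?f (g n)) sums S" for g :: "nat \<Rightarrow> int" and S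
  proof -
    have "(\<lambda>l. norm (?f l)) summable_on range g" using sm by (rule summable_on_subset_banach) simp
    then have "(\<lambda>n. norm (?f (g n))) summable_on UNIV" using that by (subst (asm) summable_on_reindex) (auto simp: o_def)
    then have "summable (\<lambda>n. norm (?f (g n)))" by (rule summable_on_imp_summable)
    then have "((\<lambda>n. ?f (g n)) has_sum S) UNIV" using that by (intro norm_summable_imp_has_sum)
    then show ?thesis using that by (subst has_sum_reindex) (auto simp: o_def)
  qed
  have "(\<lambda>n. ?f (a n)) sums ((-1) ^ Suc (Suc s) * Polygamma (Suc s) z / fact (Suc s))"
    using Polygamma_LIMSEQ[OF z0(1), of "Suc s"] by (simp add: a_def inverse_eq_divide)
  note A = sums_to[OF inj(1) this]
  have "(\<lambda>n. (-1) ^ (s + 2) * inverse ((1 - z + of_nat n) ^ Suc (Suc s))) sums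
      ((-1) ^ (s + 2) * ((-1) ^ Suc (Suc s) * Polygamma (Suc s) (1 - z) / fact (Suc s)))"
    by (intro sums_mult Polygamma_LIMSEQ z0) simp
  moreover have "(-1) ^ (s + 2) * inverse ((1 - z + of_nat n) ^ Suc (Suc s)) = ?f (b n)" for n
  proof -
    have "z + of_int (b n) = (-1) * (1 - z + of_nat n)" by (simp add: b_def)
    then have "?f (b n) = 1 / ((-1) ^ (s + 2) * (1 - z + of_nat n) ^ (s + 2))" by (simp only: power_mult_distrib)
    moreover have "1 / ((-1) ^ (s + 2) * y) = (-1) ^ (s + 2) * inverse y" for y :: complex
      by (cases "even s") (auto simp: inverse_eq_divide)
    ultimately show ?thesis by simp
  qed
  ultimately have "(\<lambda>n. ?f (b n)) sums ((-1) ^ (s + 2) * ((-1) ^ Suc (Suc s) * Polygamma (Suc s) (1 - z) / fact (Suc s)))"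
    by simp
  note B = sums_to[OF inj(2) this]
  have disj: "range a \<inter> range b = {}" by (auto simp: a_def b_def)
  have un: "range a \<union> range b = UNIV"
  proof (intro set_eqI iffI UNIV_I)
    fix l :: int
    show "l \<in> range a \<union> range b"
      by (cases "l \<ge> 0") (auto simp: a_def b_def intro: image_eqI[of _ _ "nat l"] image_eqI[of _ _ "nat (- 1 - l)"])
  qed
  have "(?f has_sum ((-1) ^ Suc (Suc s) * Polygamma (Suc s) z / fact (Suc s) +
      (-1) ^ (s + 2) * ((-1) ^ Suc (Suc s) * Polygamma (Suc s) (1 - z) / fact (Suc s)))) UNIV"
    using has_sum_Un_disjoint[OF A B disj] unfolding un .
  also have "(-1) ^ Suc (Suc s) * Polygamma (Suc s) z / fact (Suc s) +
      (-1) ^ (s + 2) * ((-1) ^ Suc (Suc s) * Polygamma (Suc s) (1 - z) / fact (Suc s))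
    = (-1) ^ (s + 2) / fact (Suc s) * (Polygamma (Suc s) z - (-1) ^ Suc s * Polygamma (Suc s) (1 - z))"
  proof -
    have "e * P / F + e * (e * Q / F) = e / F * (P - (- e) * Q)" for e P Q F :: complex
      by (simp add: algebra_simps add_divide_distrib)
    moreover have "(-1) ^ Suc (Suc s) = ((-1) ^ (s + 2) :: complex)" "(-1) ^ Suc s = (- ((-1) ^ (s + 2)) :: complex)" by simp_all
    ultimately show ?thesis by (simp only:)
  qed
  also have "\<dots> = (- 2 * of_real pi * \<i>) ^ (s + 2) / fact (Suc s) * GG (Suc s) z"
  proof -
    have "- 2 * of_real pi * \<i> = (-1) * (2 * of_real pi * \<i>)" by simp
    then have "(- 2 * of_real pi * \<i>) ^ (s + 2) = (-1) ^ (s + 2) * (2 * of_real pi * \<i>) ^ (s + 2)" by (simp only: power_mult_distrib)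
    then show ?thesis unfolding Polygamma_reflection[OF z] by (simp only: times_divide_eq_left mult.assoc)
  qed
  finally show ?thesis .
qed

text \<open>The coefficient of \<open>q^n\<close> obtained from the \<open>j\<close>-th term of
  \<open>exp (\<beta> / w)\<close> when the Lipschitz formula is applied with exponent
  \<open>k + j\<close>.\<close>

definition twist_term :: "nat \<Rightarrow> complex \<Rightarrow> nat \<Rightarrow> nat \<Rightarrow> complex" where
  "twist_term k \<beta> n j = \<beta> ^ j / fact j * ((- 2 * of_real pi * \<i>) ^ (k + j) / fact (k + j - 1) * of_nat n ^ (k + j - 1))"

definition twist_coeff :: "nat \<Rightarrow> complex \<Rightarrow> nat \<Rightarrow> complex" where
  "twist_coeff k \<beta> n = (\<Sum>\<^sub>\<infinity>j. twist_term k \<beta> n j)"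

lemma summable_exp_shift: "(\<lambda>j. (b :: real) ^ j / fact j * c) summable_on UNIV" if "b \<ge> 0" "c \<ge> 0"
proof -
  have "summable (\<lambda>j. b ^ j / fact j * c)"
    using summable_exp_generic[of b] by (intro summable_mult2) (simp add: field_simps)
  then show ?thesis using that by (subst summable_on_UNIV_nonneg_real_iff) auto
qed

lemma norm_plus_int_ge: "z \<in> HH \<Longrightarrow> norm (z + of_int l) \<ge> Im z"
  using abs_Im_le_cmod[of "z + of_int l"] by simp

lemma norm_lipschitz_term_le:
  assumes z: "z \<in> HH"
  shows "norm (1 / (z + of_int l) ^ (k + j)) \<le> (1 / Im z) ^ j * norm (1 / (z + of_int l) ^ k)"
proof -
  have y: "Im z > 0" using z by (simp add: HH_iff)
  have n: "norm (z + of_int l) \<ge> Im z" by (rule norm_plus_int_ge[OF z])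
  then have "1 / norm (z + of_int l) \<le> 1 / Im z" using y by (intro divide_left_mono mult_pos_pos) auto
  then have "(1 / norm (z + of_int l)) ^ j \<le> (1 / Im z) ^ j" by (intro power_mono) auto
  then have "(1 / norm (z + of_int l)) ^ j * norm (1 / (z + of_int l) ^ k) \<le> (1 / Im z) ^ j * norm (1 / (z + of_int l) ^ k)"
    by (intro mult_right_mono) auto
  then show ?thesis by (simp add: power_add norm_divide norm_mult norm_power power_one_over mult_ac)
qed

lemma summable_twist_lattice:
  assumes z: "z \<in> HH" and k: "k \<ge> 2"
  shows "(\<lambda>(j, l :: int). norm (\<beta> ^ j / fact j * (1 / (z + of_int l) ^ (k + j)))) summable_on UNIV \<times> UNIV"
proof (rule summable_on_comparison_test)
  define L where "L = (\<Sum>\<^sub>\<infinity>l :: int. norm (1 / (z + of_int l) ^ k))"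
  have L: "((\<lambda>l :: int. norm (1 / (z + of_int l) ^ k)) has_sum L) UNIV"
    unfolding L_def using summable_int_power[OF z k] by (rule has_sum_infsum)
  have y: "Im z > 0" using z by (simp add: HH_iff)
  let ?g = "\<lambda>(j, l :: int). (norm \<beta> / Im z) ^ j / fact j * norm (1 / (z + of_int l) ^ k)"
  have "?g summable_on (SIGMA j:UNIV. UNIV)"
  proof (rule summable_on_SigmaI)
    show "((\<lambda>l. ?g (j, l)) has_sum ((norm \<beta> / Im z) ^ j / fact j * L)) UNIV" for j
      using has_sum_cmult_right[OF L, of "(norm \<beta> / Im z) ^ j / fact j"] by simp
    have "L \<ge> 0" using L by (rule has_sum_nonneg) simp
    then show "(\<lambda>j. (norm \<beta> / Im z) ^ j / fact j * L) summable_on UNIV"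
      using y by (intro summable_exp_shift) auto
  qed (use y in auto)
  then show "?g summable_on UNIV \<times> UNIV" .
  fix p :: "nat \<times> int"
  obtain j l where p: "p = (j, l)" by (cases p)
  have "norm \<beta> ^ j / fact j * norm (1 / (z + of_int l) ^ (k + j)) \<le> norm \<beta> ^ j / fact j * ((1 / Im z) ^ j * norm (1 / (z + of_int l) ^ k))"
    by (intro mult_left_mono norm_lipschitz_term_le z) auto
  then show "(case p of (j, l) \<Rightarrow> norm (\<beta> ^ j / fact j * (1 / (z + of_int l) ^ (k + j)))) \<le> ?g p"
    by (simp add: p norm_mult norm_divide norm_power power_divide mult_ac)
qed (auto simp: case_prod_beta')

text \<open>On the imaginary axis the \<open>q\<close>-series has nonnegative terms, so its sum is
  the norm of a lattice sum and is at most \<open>L / y^j\<close> by the Lipschitz formula read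
  backwards. No estimate of the individual coefficients is needed, and the sum over \<open>j\<close>
  is an exponential series.\<close>

lemma twist_norm_majorant:
  assumes y: "y > 0" and k: "k \<ge> 2" and b: "b \<ge> 0"
  shows "(\<lambda>(j, n). b ^ j / fact j * ((2 * pi) ^ (k + j) / fact (k + j - 1) * (real n ^ (k + j - 1) * exp (- (2 * pi * y)) ^ n))) summable_on UNIV \<times> UNIV"
proof -
  define z where "z = Complex 0 y"
  have z: "z \<in> HH" using y by (simp add: z_def HH_iff)
  define L where "L = (\<Sum>\<^sub>\<infinity>l :: int. norm (1 / (z + of_int l) ^ k))"
  have Ls: "((\<lambda>l :: int. norm (1 / (z + of_int l) ^ k)) has_sum L) UNIV"
    unfolding L_def using summable_int_power[OF z k] by (rule has_sum_infsum)
  have L0: "L \<ge> 0" using Ls by (rule has_sum_nonneg) simp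
  define r where "r = exp (- (2 * pi * y))"
  have q: "qq z = of_real r"
  proof -
    have "2 * of_real pi * \<i> * z = of_real (- (2 * pi * y))" by (simp add: z_def complex_eq_iff)
    then show ?thesis unfolding qq_def r_def by (simp only: exp_of_real)
  qed
  have G: "\<exists>S. ((\<lambda>n. (2 * pi) ^ (k + j) / fact (k + j - 1) * (real n ^ (k + j - 1) * r ^ n)) has_sum S) UNIV \<and> S \<le> (1 / y) ^ j * L" for j
  proof -
    define s where "s = k + j - 2"
    have s: "s + 2 = k + j" "Suc s = k + j - 1" using k by (auto simp: s_def)
    have "((\<lambda>n. complex_of_real (real n ^ (k + j - 1) * r ^ n)) has_sum GG (Suc s) z) UNIV"
      using GG_has_sum(1)[OF z, of "Suc s"] unfolding s q by simp
    from has_sum_Re[OF this] has_sum_Im[OF this]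
    have R: "((\<lambda>n. real n ^ (k + j - 1) * r ^ n) has_sum Re (GG (Suc s) z)) UNIV" "((\<lambda>n. 0) has_sum Im (GG (Suc s) z)) (UNIV :: nat set)"
      by (simp_all only: Re_complex_of_real Im_complex_of_real)
    have Im0: "Im (GG (Suc s) z) = 0" using has_sum_unique[OF R(2) has_sum_0_simp] .
    have Re0: "Re (GG (Suc s) z) \<ge> 0" using R(1) by (rule has_sum_nonneg) (simp add: r_def)
    have nG: "norm (GG (Suc s) z) = Re (GG (Suc s) z)" using Im0 Re0 by (simp add: cmod_def)
    have "norm ((- 2 * of_real pi * \<i>) ^ (s + 2) / fact (Suc s) * GG (Suc s) z) \<le> (1 / Im z) ^ j * L"
    proof (rule norm_infsum_le[OF Lipschitz[OF z]])
      show "((\<lambda>l :: int. (1 / Im z) ^ j * norm (1 / (z + of_int l) ^ k)) has_sum (1 / Im z) ^ j * L) UNIV"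
        by (rule has_sum_cmult_right[OF Ls])
      show "norm (1 / (z + of_int l) ^ (s + 2)) \<le> (1 / Im z) ^ j * norm (1 / (z + of_int l) ^ k)" for l
        unfolding s by (rule norm_lipschitz_term_le[OF z])
    qed
    also have "norm ((- 2 * of_real pi * \<i>) ^ (s + 2) / fact (Suc s) * GG (Suc s) z) = (2 * pi) ^ (k + j) / fact (k + j - 1) * Re (GG (Suc s) z)"
      unfolding norm_mult norm_divide norm_power s nG[unfolded s] by (simp add: norm_mult)
    finally have "(2 * pi) ^ (k + j) / fact (k + j - 1) * Re (GG (Suc s) z) \<le> (1 / y) ^ j * L" by (simp add: z_def)
    then show ?thesis using has_sum_cmult_right[OF R(1), of "(2 * pi) ^ (k + j) / fact (k + j - 1)"] by blast
  qed
  define S where "S j = (SOME S. ((\<lambda>n. (2 * pi) ^ (k + j) / fact (k + j - 1) * (real n ^ (k + j - 1) * r ^ n)) has_sum S) UNIV \<and> S \<le> (1 / y) ^ j * L)" for j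
  have S: "((\<lambda>n. (2 * pi) ^ (k + j) / fact (k + j - 1) * (real n ^ (k + j - 1) * r ^ n)) has_sum S j) UNIV" "S j \<le> (1 / y) ^ j * L" for j
    using someI_ex[OF G[of j]] unfolding S_def by auto
  have S0: "S j \<ge> 0" for j using S(1)[of j] by (rule has_sum_nonneg) (simp add: r_def)
  have "(\<lambda>(j, n). b ^ j / fact j * ((2 * pi) ^ (k + j) / fact (k + j - 1) * (real n ^ (k + j - 1) * r ^ n))) summable_on (SIGMA j:UNIV. UNIV)"
  proof (rule summable_on_SigmaI)
    show "((\<lambda>n. case (j, n) of (j, n) \<Rightarrow> b ^ j / fact j * ((2 * pi) ^ (k + j) / fact (k + j - 1) * (real n ^ (k + j - 1) * r ^ n))) has_sum (b ^ j / fact j * S j)) UNIV" for j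
      using has_sum_cmult_right[OF S(1)[of j], of "b ^ j / fact j"] by simp
    show "(\<lambda>j. b ^ j / fact j * S j) summable_on UNIV"
    proof (rule summable_on_comparison_test)
      show "(\<lambda>j. (b / y) ^ j / fact j * L) summable_on UNIV" using b y L0 by (intro summable_exp_shift) auto
      show "b ^ j / fact j * S j \<le> (b / y) ^ j / fact j * L" for j
        using mult_left_mono[OF S(2)[of j], of "b ^ j / fact j"] b by (simp add: power_divide mult_ac)
    qed (use S0 b in auto)
  qed (use b in \<open>auto simp: r_def\<close>)
  then show ?thesis by (simp add: r_def)
qed

text \<open>A majorant of \<open>twist_coeff k \<beta> n\<close> for all \<open>\<beta>\<close> of
  norm at most \<open>b\<close>, so that one bound serves every modulus.\<close>

definition twist_bound :: "nat \<Rightarrow> real \<Rightarrow> nat \<Rightarrow> real" where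
  "twist_bound k b n = (\<Sum>\<^sub>\<infinity>j. norm (twist_term k (of_real b) n j))"

lemma norm_twist_term:
  "norm (twist_term k \<beta> n j) = norm \<beta> ^ j / fact j * ((2 * pi) ^ (k + j) / fact (k + j - 1) * real n ^ (k + j - 1))"
  by (simp add: twist_term_def norm_mult norm_divide norm_power)

lemma twist_summable:
  assumes z: "z \<in> HH" and k: "k \<ge> 2"
  shows "(\<lambda>(j, n). norm (twist_term k \<beta> n j * qq z ^ n)) summable_on UNIV \<times> UNIV"
proof -
  have "Im z > 0" using z by (simp add: HH_iff)
  from twist_norm_majorant[OF this k, of "norm \<beta>"]
  show ?thesis unfolding norm_mult norm_power norm_twist_term norm_qq by (simp only: mult.assoc norm_ge_zero simp_thms)
qed

lemma twist_summable_j: "k \<ge> 2 \<Longrightarrow> (\<lambda>j. norm (twist_term k \<beta> n j)) summable_on UNIV"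
proof -
  assume k: "k \<ge> 2"
  have i: "\<i> \<in> HH" by (simp add: HH_iff)
  have "(\<lambda>p. case p of (j, n) \<Rightarrow> norm (twist_term k \<beta> n j * qq \<i> ^ n)) summable_on range (\<lambda>j. (j, n))"
    using twist_summable[OF i k] by (rule summable_on_subset_banach) auto
  then have "(\<lambda>j. norm (twist_term k \<beta> n j * qq \<i> ^ n)) summable_on UNIV"
    by (subst (asm) summable_on_reindex) (auto simp: inj_on_def o_def)
  then have "(\<lambda>j. norm (twist_term k \<beta> n j * qq \<i> ^ n) * (1 / norm (qq \<i> ^ n))) summable_on UNIV"
    by (rule summable_on_cmult_left)
  moreover have "qq \<i> \<noteq> 0" by (simp add: qq_def)
  ultimately show ?thesis by (simp add: norm_mult)
qed

lemma twist_bound_summable: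
  assumes z: "z \<in> HH" and k: "k \<ge> 2" and b: "b \<ge> 0"
  shows "(\<lambda>n. twist_bound k b n * norm (qq z) ^ n) summable_on UNIV"
proof -
  have "(\<lambda>(n, j). norm (twist_term k (of_real b) n j * qq z ^ n)) summable_on UNIV \<times> UNIV"
    using twist_summable[OF z k, of "of_real b"] by (subst summable_on_swap) (simp add: case_prod_beta')
  then have "(\<lambda>n. \<Sum>\<^sub>\<infinity>j. norm (twist_term k (of_real b) n j * qq z ^ n)) summable_on UNIV"
    using summable_on_Sigma_banach[of "\<lambda>n j. norm (twist_term k (of_real b) n j * qq z ^ n)" UNIV "\<lambda>_. UNIV"] by simp
  then show ?thesis
    unfolding norm_mult twist_bound_def by (simp add: infsum_cmult_left' norm_power)
qed

lemma norm_twist_coeff_le: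
  assumes k: "k \<ge> 2" and b: "norm \<beta> \<le> b"
  shows "norm (twist_coeff k \<beta> n) \<le> twist_bound k b n"
proof -
  have b0: "b \<ge> 0" using b norm_ge_zero order_trans by blast
  have "norm (twist_coeff k \<beta> n) \<le> (\<Sum>\<^sub>\<infinity>j. norm (twist_term k \<beta> n j))"
    unfolding twist_coeff_def by (rule norm_infsum_bound) (rule twist_summable_j[OF k])
  also have "\<dots> \<le> twist_bound k b n"
    unfolding twist_bound_def
  proof (rule infsum_mono[OF twist_summable_j[OF k] twist_summable_j[OF k]])
    show "norm (twist_term k \<beta> n j) \<le> norm (twist_term k (of_real b) n j)" for j
      unfolding norm_twist_term using b b0 by (intro mult_right_mono divide_right_mono power_mono) auto
  qed
  finally show ?thesis .
qed

text \<open>The exponential is expanded, the sums over \<open>l\<close> and \<open>j\<close> are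
  exchanged, the Lipschitz formula is applied for each \<open>j\<close>, and the sums over
  \<open>j\<close> and \<open>n\<close> are exchanged. Both double families are absolutely
  summable.\<close>

lemma twist_expansion:
  assumes z: "z \<in> HH" and k: "k \<ge> 2"
  shows "((\<lambda>l :: int. exp (\<beta> / (z + of_int l)) / (z + of_int l) ^ k) has_sum
     (\<Sum>\<^sub>\<infinity>n. twist_coeff k \<beta> n * qq z ^ n)) UNIV"
    and "(\<lambda>n. twist_coeff k \<beta> n * qq z ^ n) summable_on UNIV"
proof -
  let ?T = "\<lambda>(j, l :: int). \<beta> ^ j / fact j * (1 / (z + of_int l) ^ (k + j))"
  let ?U = "\<lambda>(j, n). twist_term k \<beta> n j * qq z ^ n"
  let ?c = "\<lambda>j. \<beta> ^ j / fact j * ((- 2 * of_real pi * \<i>) ^ (k + j) / fact (k + j - 1) * GG (k + j - 1) z)"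
  have T: "?T summable_on UNIV \<times> UNIV"
    using summable_twist_lattice[OF z k, of \<beta>] unfolding case_prod_beta' by (rule abs_summable_summable)
  have U: "?U summable_on UNIV \<times> UNIV"
    using twist_summable[OF z k, of \<beta>] unfolding case_prod_beta' by (rule abs_summable_summable)
  have Tj: "((\<lambda>l. ?T (j, l)) has_sum ?c j) UNIV" for j
  proof -
    define s where "s = k + j - 2"
    have s: "s + 2 = k + j" "Suc s = k + j - 1" using k by (auto simp: s_def)
    show ?thesis using has_sum_cmult_right[OF Lipschitz[OF z, of s], of "\<beta> ^ j / fact j"] unfolding s by (simp only: prod.case)
  qed
  have Uj: "((\<lambda>n. ?U (j, n)) has_sum ?c j) UNIV" for j
    using has_sum_cmult_right[OF GG_has_sum(1)[OF z, of "k + j - 1"], of "\<beta> ^ j / fact j * ((- 2 * of_real pi * \<i>) ^ (k + j) / fact (k + j - 1))"]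
    unfolding twist_term_def prod.case mult.assoc .
  have "(?c has_sum infsum ?T (UNIV \<times> UNIV)) UNIV"
    by (rule has_sum_SigmaD[OF has_sum_infsum[OF T] Tj])
  moreover have "(?c has_sum infsum ?U (UNIV \<times> UNIV)) UNIV"
    by (rule has_sum_SigmaD[OF has_sum_infsum[OF U] Uj])
  ultimately have eq: "infsum ?T (UNIV \<times> UNIV) = infsum ?U (UNIV \<times> UNIV)" by (rule has_sum_unique)
  have "((\<lambda>(l, j). ?T (j, l)) has_sum infsum ?T (UNIV \<times> UNIV)) (UNIV \<times> UNIV)"
    using has_sum_infsum[OF T] by (subst (asm) has_sum_swap) simp
  then have l: "((\<lambda>l :: int. exp (\<beta> / (z + of_int l)) / (z + of_int l) ^ k) has_sum infsum ?T (UNIV \<times> UNIV)) UNIV"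
  proof (rule has_sum_SigmaD)
    fix l :: int
    define w where "w = z + of_int l"
    have w: "w \<noteq> 0" using z by (auto simp: w_def HH_iff complex_eq_iff)
    have "summable (\<lambda>j. norm ((\<beta> / w) ^ j /\<^sub>R fact j))" by (rule summable_norm_exp)
    then have "((\<lambda>j. (\<beta> / w) ^ j /\<^sub>R fact j) has_sum exp (\<beta> / w)) UNIV"
      using exp_converges[of "\<beta> / w"] by (rule norm_summable_imp_has_sum)
    from has_sum_cmult_left[OF this, of "1 / w ^ k"]
    have "((\<lambda>j. (\<beta> / w) ^ j /\<^sub>R fact j * (1 / w ^ k)) has_sum exp (\<beta> / w) * (1 / w ^ k)) UNIV" .
    then show "((\<lambda>j. case (l, j) of (l, j) \<Rightarrow> ?T (j, l)) has_sum exp (\<beta> / (z + of_int l)) / (z + of_int l) ^ k) UNIV"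
    proof -
      have "(\<beta> / w) ^ j /\<^sub>R fact j * (1 / w ^ k) = \<beta> ^ j / fact j * (1 / w ^ (k + j))" for j
        by (simp add: power_divide power_add scaleR_conv_of_real field_simps)
      then show ?thesis using \<open>((\<lambda>j. (\<beta> / w) ^ j /\<^sub>R fact j * (1 / w ^ k)) has_sum exp (\<beta> / w) * (1 / w ^ k)) UNIV\<close>
        by (simp add: w_def)
    qed
  qed
  have "((\<lambda>(n, j). ?U (j, n)) has_sum infsum ?U (UNIV \<times> UNIV)) (UNIV \<times> UNIV)"
    using has_sum_infsum[OF U] by (subst (asm) has_sum_swap) simp
  then have n: "((\<lambda>n. twist_coeff k \<beta> n * qq z ^ n) has_sum infsum ?U (UNIV \<times> UNIV)) UNIV"
  proof (rule has_sum_SigmaD)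
    fix n
    have "((\<lambda>j. twist_term k \<beta> n j) has_sum twist_coeff k \<beta> n) UNIV"
      unfolding twist_coeff_def by (rule has_sum_infsum[OF abs_summable_summable[OF twist_summable_j[OF k]]])
    from has_sum_cmult_left[OF this, of "qq z ^ n"]
    show "((\<lambda>j. case (n, j) of (n, j) \<Rightarrow> ?U (j, n)) has_sum twist_coeff k \<beta> n * qq z ^ n) UNIV" by simp
  qed
  show "(\<lambda>n. twist_coeff k \<beta> n * qq z ^ n) summable_on UNIV" using n by (rule has_sum_imp_summable)
  show "((\<lambda>l :: int. exp (\<beta> / (z + of_int l)) / (z + of_int l) ^ k) has_sum
     (\<Sum>\<^sub>\<infinity>n. twist_coeff k \<beta> n * qq z ^ n)) UNIV"
    using l unfolding eq infsumI[OF n] .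
qed

section \<open>Fourier coefficients of Poincare series\<close>

text \<open>Writing a row with \<open>c > 0\<close> as \<open>(c, d + c * l)\<close> with
  \<open>d\<close> reduced modulo \<open>c\<close> separates the lattice sum over \<open>l\<close>
  from a sum over residues.\<close>

definition kloost_pairs :: "nat \<Rightarrow> (int \<times> int) set" where
  "kloost_pairs N = {(c, d). 0 < c \<and> int N dvd c \<and> 0 \<le> d \<and> d < c \<and> coprime c d}"

definition pos_rows :: "nat \<Rightarrow> (int \<times> int) set" where
  "pos_rows N = {(c, d). 0 < c \<and> int N dvd c \<and> coprime c d}"

lemma kloost_pairs_subset: "kloost_pairs N \<subseteq> coprime_rows 1"
  by (auto simp: kloost_pairs_def coprime_rows_def)

lemma pos_rows_subset: "pos_rows N \<subseteq> coprime_rows 1"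
  by (auto simp: pos_rows_def coprime_rows_def)

lemma pos_rows_bij: "bij_betw (\<lambda>((c, d), l). (c, d + c * l)) (kloost_pairs N \<times> UNIV) (pos_rows N)"
proof (rule bij_betw_byWitness[where f' = "\<lambda>(c, d). ((c, d mod c), d div c)"])
  have cop: "coprime c (d + c * l) \<longleftrightarrow> coprime c d" for c d l :: int
    by (metis coprime_iff_gcd_eq_1 gcd_add_mult mult.commute add.commute)
  have cop2: "coprime c (d mod c) \<longleftrightarrow> coprime c d" for c d :: int
    by (metis coprime_iff_gcd_eq_1 gcd_red_int gcd.commute)
  show "\<forall>a\<in>kloost_pairs N \<times> UNIV. (case case a of (x, xa) \<Rightarrow> (case x of (c, d) \<Rightarrow> \<lambda>l. (c, d + c * l)) xa of (c, d) \<Rightarrow> ((c, d mod c), d div c)) = a"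
    by (auto simp: kloost_pairs_def)
  show "\<forall>a'\<in>pos_rows N. (case case a' of (c, d) \<Rightarrow> ((c, d mod c), d div c) of (x, xa) \<Rightarrow> (case x of (c, d) \<Rightarrow> \<lambda>l. (c, d + c * l)) xa) = a'"
    by (auto simp: pos_rows_def)
  show "(\<lambda>((c, d), l). (c, d + c * l)) ` (kloost_pairs N \<times> UNIV) \<subseteq> pos_rows N"
    by (auto simp: kloost_pairs_def pos_rows_def cop)
  show "(\<lambda>(c, d). ((c, d mod c), d div c)) ` pos_rows N \<subseteq> kloost_pairs N \<times> UNIV"
    by (auto simp: kloost_pairs_def pos_rows_def cop2)
qed

lemma pterm_uminus:
  assumes "even k" "z \<in> HH" shows "pterm k m (- A) z = pterm k m A z"
proof -
  have "aut_factor (- A) z = - aut_factor A z" by (simp add: aut_factor_def)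
  then show ?thesis using assms by (simp add: pterm_def)
qed

text \<open>Rows with \<open>c < 0\<close> repeat those with \<open>c > 0\<close>, because
  \<open>k\<close> is even, and the two rows with \<open>c = 0\<close> give \<open>q^m\<close>
  each.\<close>

lemma psum_half:
  assumes k: "k \<ge> 4" "even k" and N: "N > 0" and z: "z \<in> HH"
  shows "((\<lambda>r. pterm k m (lift_row r) z) has_sum (psum k m (coprime_rows N) z / 2 - qq z ^ m)) (pos_rows N)"
proof -
  let ?p = "\<lambda>r. pterm k m (lift_row r) z"
  let ?neg = "\<lambda>r :: int \<times> int. - r"
  have neg: "?p (- r) = ?p r" if r: "r \<in> coprime_rows 1" for r
  proof -
    have r': "- r \<in> coprime_rows 1" using r by (cases r) (auto simp: coprime_rows_def)
    note L = lift_rows[OF r] and L' = lift_rows[OF r']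
    have SL: "- lift_row r \<in> SL2Z" using L(1) by (simp add: SL2Z_iff)
    have "bottom_row (- lift_row r) = - bottom_row (lift_row r)" by (simp add: bottom_row_def)
    then have "pterm k m (lift_row (- r)) z = pterm k m (- lift_row r) z"
      using L L' by (intro pterm_cong SL z) simp_all
    then show ?thesis by (simp only: pterm_uminus[OF k(2) z])
  qed
  have p01: "?p (0, 1) = qq z ^ m"
  proof -
    have r: "(0, 1) \<in> coprime_rows 1" by (simp add: coprime_rows_def)
    have "?p (0, 1) = pterm k m (mat 1) z"
      using lift_rows[OF r] SL2Z_closed by (intro pterm_cong z) (simp_all add: bottom_row_def)
    then show ?thesis by (simp add: pterm_def aut_factor_def qq_pow)
  qed
  define S where "S = infsum ?p (pos_rows N)"
  have S: "(?p has_sum S) (pos_rows N)"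
    unfolding S_def using pterm_summable[OF k(1) pos_rows_subset z] by (rule has_sum_infsum)
  have inj: "inj_on ?neg X" for X by (simp add: inj_on_def)
  have S': "(?p has_sum S) (?neg ` pos_rows N)"
    using S by (subst has_sum_reindex[OF inj], subst has_sum_cong[of _ _ ?p]) (use neg pos_rows_subset in \<open>auto simp: o_def\<close>)
  have F: "(?p has_sum (qq z ^ m + qq z ^ m)) {(0, 1), (0, - 1)}"
  proof -
    have "?p (0, - 1) = ?p (0, 1)" using neg[of "(0, 1)"] by (simp add: coprime_rows_def)
    then have "(\<Sum>r\<in>{(0, 1), (0, - 1)}. ?p r) = qq z ^ m + qq z ^ m" using p01 by simp
    then show ?thesis by (intro has_sum_finiteI) auto
  qed
  have un: "coprime_rows N = pos_rows N \<union> (?neg ` pos_rows N \<union> {(0, 1), (0, - 1)})" (is "_ = ?R")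
  proof (intro set_eqI iffI)
    fix r assume r: "r \<in> coprime_rows N"
    obtain c d where cd: "r = (c, d)" by (cases r)
    consider "c > 0" | "c < 0" | "c = 0" by linarith
    then show "r \<in> ?R"
    proof cases
      case 2
      then have "(- c, - d) \<in> pos_rows N" using r by (simp add: cd coprime_rows_def pos_rows_def)
      then have "?neg (- c, - d) \<in> ?neg ` pos_rows N" by (rule imageI)
      then show ?thesis by (simp add: cd)
    next
      case 3
      then have "\<bar>d\<bar> = 1" using r by (simp add: cd coprime_rows_def)
      then have "d = 1 \<or> d = - 1" by linarith
      then show ?thesis using 3 by (auto simp: cd)
    qed (use r in \<open>auto simp: cd coprime_rows_def pos_rows_def\<close>)
  qed (auto simp: coprime_rows_def pos_rows_def)
  have "(?p has_sum (S + (S + (qq z ^ m + qq z ^ m)))) (coprime_rows N)"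
    unfolding un
  proof (intro has_sum_Un_disjoint S S' F)
    show "?neg ` pos_rows N \<inter> {(0, 1), (0, - 1)} = {}" by (auto simp: pos_rows_def)
    show "pos_rows N \<inter> (?neg ` pos_rows N \<union> {(0, 1), (0, - 1)}) = {}" by (auto simp: pos_rows_def)
  qed
  then have "psum k m (coprime_rows N) z = S + (S + (qq z ^ m + qq z ^ m))"
    unfolding psum_def by (rule infsumI)
  then have "S = psum k m (coprime_rows N) z / 2 - qq z ^ m" by (simp add: field_simps)
  with S show ?thesis by simp
qed

definition beta :: "nat \<Rightarrow> int \<Rightarrow> complex" where
  "beta m c = - (2 * of_real pi * \<i> * of_nat m / (of_int c)\<^sup>2)"

definition unit_factor :: "nat \<Rightarrow> int \<times> int \<Rightarrow> complex" where
  "unit_factor m p = exp (2 * of_real pi * \<i> * (of_nat m * of_int (modular_inverse (fst p) (snd p)) / of_int (fst p)))"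

lemma norm_unit_factor [simp]: "norm (unit_factor m p) = 1"
proof -
  have "2 * of_real pi * \<i> * (of_nat m * of_int (modular_inverse (fst p) (snd p)) / of_int (fst p))
      = \<i> * of_real (2 * pi * (m * of_int (modular_inverse (fst p) (snd p)) / of_int (fst p)))"
    by simp
  then show ?thesis unfolding unit_factor_def by (simp only: norm_exp_i_times)
qed

text \<open>If \<open>a\<close> is inverse to \<open>d\<close> modulo \<open>c\<close>, then
  \<open>A z = a / c - 1 / (c^2 (w + l))\<close>. The first part yields the root of unity
  \<open>unit_factor\<close>, the second the exponent with \<open>beta m c\<close>.\<close>

lemma pterm_pair:
  assumes p: "(c, d) \<in> kloost_pairs N" and z: "z \<in> HH"
  defines "w \<equiv> z + of_int d / of_int c"
  shows "pterm k m (lift_row (c, d + c * l)) z =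
    unit_factor m (c, d) / of_int c ^ k * (exp (beta m c / (w + of_int l)) / (w + of_int l) ^ k)"
proof -
  have c: "c > 0" "coprime c d" using p by (auto simp: kloost_pairs_def)
  define a where "a = modular_inverse c d"
  define e where "e = d + c * l"
  have "[a * d = 1] (mod c)" unfolding a_def using c by (intro cong_modular_inverse2) (simp add: coprime_commute)
  moreover have "[a * e = a * d] (mod c)" unfolding cong_iff_dvd_diff e_def by (simp add: algebra_simps)
  ultimately have "[a * e = 1] (mod c)" by (rule cong_trans[rotated])
  then have "c dvd a * e - 1" by (simp add: cong_iff_dvd_diff)
  then obtain b where b: "a * e - 1 = c * b" by (auto elim: dvdE)
  define A where "A = mat2 a b c e"
  have A: "A \<in> SL2Z" "bottom_row A = (c, e)" using b by (auto simp: A_def SL2Z_iff bottom_row_def algebra_simps)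
  have "(c, e) \<in> coprime_rows 1" using row_in_rows[OF A(1)] A(2) by simp
  note L = lift_rows[OF this]
  have "pterm k m (lift_row (c, e)) z = pterm k m A z" by (rule pterm_cong) (use L A z in simp_all)
  also have "\<dots> = exp (2 * of_real pi * \<i> * of_nat m * moebius A z) / aut_factor A z ^ k" by (simp add: pterm_def)
  also have j: "aut_factor A z = of_int c * (w + of_int l)"
    using c by (simp add: A_def aut_factor_def w_def e_def algebra_simps)
  also have "moebius A z = of_int a / of_int c - 1 / ((of_int c)\<^sup>2 * (w + of_int l))"
  proof -
    have nz: "of_int c * (w + of_int l) \<noteq> 0" using aut_factor_neq_0[OF A(1) z] by (simp add: j)
    have "(of_int a * z + of_int b) * of_int c = of_int a * (of_int c * z + of_int e) - (1 :: complex)"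
    proof -
      have "of_int (a * e - 1) = (of_int (c * b) :: complex)" by (simp only: b)
      then show ?thesis by (simp add: algebra_simps)
    qed
    also have "of_int c * z + of_int e = of_int c * (w + of_int l)" using j by (simp add: A_def aut_factor_def)
    finally have "of_int a * z + of_int b = (of_int a * (of_int c * (w + of_int l)) - 1) / of_int c"
      using c by (simp add: field_simps)
    then have "moebius A z = (of_int a * (of_int c * (w + of_int l)) - 1) / of_int c / (of_int c * (w + of_int l))"
      unfolding moebius_def j by (simp add: A_def)
    moreover have "(u * (v * W) - 1) / v / (v * W) = u / v - 1 / (v\<^sup>2 * W)" if "v * W \<noteq> 0" for u v W :: complex
      using that by (simp add: field_simps power2_eq_square)
    ultimately show ?thesis using nz by simp
  qed
  also have "2 * of_real pi * \<i> * of_nat m * (of_int a / of_int c - 1 / ((of_int c)\<^sup>2 * (w + of_int l)))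
      = 2 * of_real pi * \<i> * (of_nat m * of_int a / of_int c) + beta m c / (w + of_int l)"
    by (simp add: beta_def algebra_simps)
  finally show ?thesis
    by (simp add: exp_add unit_factor_def a_def e_def power_mult_distrib)
qed

text \<open>The last factor comes from expanding in \<open>w = z + d / c\<close> instead of
  \<open>z\<close>; together with \<open>unit_factor\<close> it is a summand of a Kloosterman
  sum.\<close>

definition pair_coeff :: "nat \<Rightarrow> nat \<Rightarrow> nat \<Rightarrow> int \<times> int \<Rightarrow> complex" where
  "pair_coeff k m n p = unit_factor m p / of_int (fst p) ^ k * twist_coeff k (beta m (fst p)) n *
     exp (2 * of_real pi * \<i> * (of_nat n * of_int (snd p) / of_int (fst p)))"

lemma pair_sum:
  assumes p: "(c, d) \<in> kloost_pairs N" and z: "z \<in> HH" and k: "k \<ge> 2"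
  shows "((\<lambda>l. pterm k m (lift_row (c, d + c * l)) z) has_sum (\<Sum>\<^sub>\<infinity>n. pair_coeff k m n (c, d) * qq z ^ n)) UNIV"
    and "(\<lambda>n. pair_coeff k m n (c, d) * qq z ^ n) summable_on UNIV"
proof -
  define w where "w = z + of_int d / of_int c"
  have w: "w \<in> HH"
  proof -
    have "w = z + of_real (of_int d / of_int c)" by (simp add: w_def)
    then show ?thesis using z by (simp add: HH_iff)
  qed
  have q: "qq w ^ n = exp (2 * of_real pi * \<i> * (of_nat n * of_int d / of_int c)) * qq z ^ n" for n
  proof -
    have "2 * of_real pi * \<i> * of_nat n * w = 2 * of_real pi * \<i> * (of_nat n * of_int d / of_int c) + 2 * of_real pi * \<i> * of_nat n * z"
      by (simp add: w_def algebra_simps)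
    then show ?thesis unfolding qq_pow[symmetric] by (simp only: exp_add)
  qed
  have eq: "unit_factor m (c, d) / of_int c ^ k * (twist_coeff k (beta m c) n * qq w ^ n) = pair_coeff k m n (c, d) * qq z ^ n" for n
    unfolding q pair_coeff_def by simp
  note T = twist_expansion[OF w k, of "beta m c"]
  have "((\<lambda>n. unit_factor m (c, d) / of_int c ^ k * (twist_coeff k (beta m c) n * qq w ^ n)) has_sum
      (unit_factor m (c, d) / of_int c ^ k * (\<Sum>\<^sub>\<infinity>n. twist_coeff k (beta m c) n * qq w ^ n))) UNIV"
    by (rule has_sum_cmult_right[OF has_sum_infsum[OF T(2)]])
  then have S: "((\<lambda>n. pair_coeff k m n (c, d) * qq z ^ n) has_sum
      (unit_factor m (c, d) / of_int c ^ k * (\<Sum>\<^sub>\<infinity>n. twist_coeff k (beta m c) n * qq w ^ n))) UNIV"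
    unfolding eq .
  then show "(\<lambda>n. pair_coeff k m n (c, d) * qq z ^ n) summable_on UNIV" by (rule has_sum_imp_summable)
  show "((\<lambda>l. pterm k m (lift_row (c, d + c * l)) z) has_sum (\<Sum>\<^sub>\<infinity>n. pair_coeff k m n (c, d) * qq z ^ n)) UNIV"
    unfolding infsumI[OF S] pterm_pair[OF p z] w_def[symmetric]
    by (rule has_sum_cmult_right[OF T(1)])
qed

text \<open>As \<open>0 <= d < c\<close>, the row has weight at most \<open>2 * c\<close>, whence
  \<open>16 = 2^4\<close>. The norm of \<open>beta m c\<close> is at most \<open>2 * pi * m\<close>
  for every \<open>c >= 1\<close>.\<close>

lemma norm_pair_coeff_le:
  assumes p: "p \<in> kloost_pairs N" and k: "k \<ge> 4"
  shows "norm (pair_coeff k m n p) \<le> 16 * (1 / wt p ^ 4) * twist_bound k (2 * pi * m) n"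
proof -
  obtain c d where cd: "p = (c, d)" by (cases p)
  have c: "c > 0" "0 \<le> d" "d < c" using p by (auto simp: kloost_pairs_def cd)
  have c1: "real_of_int c \<ge> 1" using c by simp
  have b: "norm (beta m c) \<le> 2 * pi * m"
  proof -
    have "norm (beta m c) = 2 * pi * m / (real_of_int c)\<^sup>2" by (simp add: beta_def norm_mult norm_divide norm_power)
    also have "\<dots> \<le> 2 * pi * m / 1" using c1 by (intro divide_left_mono) auto
    finally show ?thesis by simp
  qed
  have e: "norm (exp (2 * of_real pi * \<i> * (of_nat n * of_int d / of_int c))) = 1"
  proof -
    have "2 * of_real pi * \<i> * (of_nat n * of_int d / of_int c) = \<i> * of_real (2 * pi * (n * of_int d / of_int c))" by simp
    then show ?thesis by (simp only: norm_exp_i_times)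
  qed
  have "norm (pair_coeff k m n p) = 1 / real_of_int c ^ k * norm (twist_coeff k (beta m c) n)"
    unfolding pair_coeff_def cd fst_conv snd_conv norm_mult e norm_divide norm_power using c by simp
  also have "\<dots> \<le> 16 * (1 / wt p ^ 4) * twist_bound k (2 * pi * m) n"
  proof (rule mult_mono)
    have wt: "wt p \<le> 2 * real_of_int c" "wt p \<ge> 1"
      using c wt_ge_1 subsetD[OF kloost_pairs_subset p] by (auto simp: wt_def cd)
    have "wt p ^ 4 \<le> (2 * real_of_int c) ^ 4" using wt by (intro power_mono) auto
    also have "\<dots> = 16 * real_of_int c ^ 4" by (simp add: power_mult_distrib)
    also have "real_of_int c ^ 4 \<le> real_of_int c ^ k" using c1 k by (intro power_increasing)
    finally have "wt p ^ 4 \<le> 16 * real_of_int c ^ k" by simp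
    then show "1 / real_of_int c ^ k \<le> 16 * (1 / wt p ^ 4)" using wt c1 by (simp add: field_simps)
    show "norm (twist_coeff k (beta m c) n) \<le> twist_bound k (2 * pi * m) n"
      using k b by (intro norm_twist_coeff_le) auto
  qed auto
  finally show ?thesis .
qed

lemma pair_coeff_summable:
  assumes z: "z \<in> HH" and k: "k \<ge> 4"
  shows "(\<lambda>(p, n). norm (pair_coeff k m n p * qq z ^ n)) summable_on (kloost_pairs N \<times> UNIV)"
proof (rule summable_on_comparison_test)
  define B where "B n = twist_bound k (2 * pi * m) n * norm (qq z) ^ n" for n
  have B: "(B has_sum infsum B UNIV) UNIV"
    unfolding B_def using k by (intro has_sum_infsum twist_bound_summable z) auto
  have B0: "B n \<ge> 0" for n unfolding B_def twist_bound_def by (intro mult_nonneg_nonneg infsum_nonneg) auto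
  let ?g = "\<lambda>(p, n). 16 * (1 / wt p ^ 4) * B n"
  have "?g summable_on (SIGMA p:kloost_pairs N. UNIV)"
  proof (rule summable_on_SigmaI)
    show "((\<lambda>n. ?g (p, n)) has_sum (16 * (1 / wt p ^ 4) * infsum B UNIV)) UNIV" for p
      using has_sum_cmult_right[OF B, of "16 * (1 / wt p ^ 4)"] by simp
    have "(\<lambda>p. 1 / wt p ^ 4) summable_on kloost_pairs N"
      using summable_wt kloost_pairs_subset by (rule summable_on_subset_banach)
    then show "(\<lambda>p. 16 * (1 / wt p ^ 4) * infsum B UNIV) summable_on kloost_pairs N"
      by (intro summable_on_cmult_left summable_on_cmult_right)
  qed (use B0 in auto)
  then show "?g summable_on (kloost_pairs N \<times> UNIV)" .
  fix x assume "x \<in> kloost_pairs N \<times> (UNIV :: nat set)"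
  then obtain p n where x: "x = (p, n)" "p \<in> kloost_pairs N" by auto
  have "norm (pair_coeff k m n p) * norm (qq z) ^ n \<le> 16 * (1 / wt p ^ 4) * twist_bound k (2 * pi * m) n * norm (qq z) ^ n"
    using norm_pair_coeff_le[OF x(2) k] by (intro mult_right_mono) auto
  then show "(case x of (p, n) \<Rightarrow> norm (pair_coeff k m n p * qq z ^ n)) \<le> ?g x"
    by (simp add: x norm_mult norm_power B_def mult.assoc)
qed (auto simp: case_prod_beta')

definition poincare_coeff :: "nat \<Rightarrow> nat \<Rightarrow> nat \<Rightarrow> nat \<Rightarrow> complex" where
  "poincare_coeff k N m n = of_bool (n = m) + (\<Sum>\<^sub>\<infinity>p\<in>kloost_pairs N. pair_coeff k m n p)"

lemma pair_coeff_summable_pairs: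
  assumes k: "k \<ge> 4"
  shows "(\<lambda>p. norm (pair_coeff k m n p)) summable_on kloost_pairs N"
proof (rule summable_on_comparison_test)
  have "(\<lambda>p. 1 / wt p ^ 4) summable_on kloost_pairs N"
    using summable_wt kloost_pairs_subset by (rule summable_on_subset_banach)
  then show "(\<lambda>p. 16 * (1 / wt p ^ 4) * twist_bound k (2 * pi * m) n) summable_on kloost_pairs N"
    by (intro summable_on_cmult_left summable_on_cmult_right)
qed (use norm_pair_coeff_le[OF _ k] in auto)

lemma twist_coeff_0: "k \<ge> 2 \<Longrightarrow> twist_coeff k \<beta> 0 = 0"
proof -
  assume k: "k \<ge> 2"
  then have "twist_term k \<beta> 0 j = 0" for j by (simp add: twist_term_def)
  then show ?thesis by (simp add: twist_coeff_def)
qed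

lemma poincare_coeff_0: "k \<ge> 2 \<Longrightarrow> m > 0 \<Longrightarrow> poincare_coeff k N m 0 = 0"
  by (simp add: poincare_coeff_def pair_coeff_def twist_coeff_0)

text \<open>The rows with \<open>c > 0\<close> are grouped by pairs, \<open>pair_sum\<close> expands
  each group, and absolute summability lets the sum over pairs move inside. The \<open>q^m\<close>
  of \<open>psum_half\<close> becomes the \<open>of_bool\<close> in
  \<open>poincare_coeff\<close>.\<close>

lemma poincare_expansion:
  assumes k: "k \<ge> 4" "even k" and N: "N > 0" and z: "z \<in> HH"
  shows "(\<lambda>n. poincare_coeff k N m n * exp (2 * of_real pi * \<i> * of_nat n * z)) sums poincare k N m z"
proof -
  let ?P = "kloost_pairs N"
  let ?V = "\<lambda>(p, n). pair_coeff k m n p * qq z ^ n"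
  have V: "?V summable_on ?P \<times> UNIV"
    using pair_coeff_summable[OF z k(1), of m N] unfolding case_prod_beta' by (rule abs_summable_summable)
  define S where "S = psum k m (coprime_rows N) z / 2 - qq z ^ m"
  have "((\<lambda>r. pterm k m (lift_row r) z) has_sum S) (pos_rows N)"
    unfolding S_def by (rule psum_half[OF k N z])
  then have "((\<lambda>x. pterm k m (lift_row ((\<lambda>((c, d), l). (c, d + c * l)) x)) z) has_sum S) (?P \<times> UNIV)"
    by (rule has_sum_reindex_bij_betw[OF pos_rows_bij, THEN iffD2])
  then have 1: "((\<lambda>p. \<Sum>\<^sub>\<infinity>n. pair_coeff k m n p * qq z ^ n) has_sum S) ?P"
  proof (rule has_sum_SigmaD)
    fix p assume p: "p \<in> ?P"
    obtain c d where cd: "p = (c, d)" by (cases p)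
    show "((\<lambda>y. pterm k m (lift_row (case (p, y) of (x, xa) \<Rightarrow> (case x of (c, d) \<Rightarrow> \<lambda>l. (c, d + c * l)) xa)) z) has_sum
        (\<Sum>\<^sub>\<infinity>n. pair_coeff k m n p * qq z ^ n)) UNIV"
      using pair_sum(1)[OF p[unfolded cd] z, of k m] k by (simp add: cd)
  qed
  have 2: "((\<lambda>p. \<Sum>\<^sub>\<infinity>n. pair_coeff k m n p * qq z ^ n) has_sum infsum ?V (?P \<times> UNIV)) ?P"
  proof (rule has_sum_SigmaD[OF has_sum_infsum[OF V]])
    fix p assume p: "p \<in> ?P"
    obtain c d where cd: "p = (c, d)" by (cases p)
    show "((\<lambda>n. ?V (p, n)) has_sum (\<Sum>\<^sub>\<infinity>n. pair_coeff k m n p * qq z ^ n)) UNIV"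
      using has_sum_infsum[OF pair_sum(2)[OF p[unfolded cd] z, of k m]] k by (simp add: cd)
  qed
  have S: "infsum ?V (?P \<times> UNIV) = S" by (rule has_sum_unique[OF 2 1])
  have "((\<lambda>(n, p). ?V (p, n)) has_sum S) (UNIV \<times> ?P)"
    using has_sum_infsum[OF V] unfolding S by (subst (asm) has_sum_swap) simp
  then have "((\<lambda>n. (\<Sum>\<^sub>\<infinity>p\<in>?P. pair_coeff k m n p) * qq z ^ n) has_sum S) UNIV"
  proof (rule has_sum_SigmaD)
    fix n
    have "((\<lambda>p. pair_coeff k m n p) has_sum (\<Sum>\<^sub>\<infinity>p\<in>?P. pair_coeff k m n p)) ?P"
      by (rule has_sum_infsum[OF abs_summable_summable[OF pair_coeff_summable_pairs[OF k(1)]]])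
    from has_sum_cmult_left[OF this, of "qq z ^ n"]
    show "((\<lambda>p. case (n, p) of (n, p) \<Rightarrow> ?V (p, n)) has_sum (\<Sum>\<^sub>\<infinity>p\<in>?P. pair_coeff k m n p) * qq z ^ n) ?P" by simp
  qed
  then have "(\<lambda>n. (\<Sum>\<^sub>\<infinity>p\<in>?P. pair_coeff k m n p) * qq z ^ n) sums S" by (rule has_sum_imp_sums)
  moreover have "(\<lambda>n. if n = m then qq z ^ n else 0) sums (qq z ^ m)" by (rule sums_single)
  ultimately have "(\<lambda>n. (if n = m then qq z ^ n else 0) + (\<Sum>\<^sub>\<infinity>p\<in>?P. pair_coeff k m n p) * qq z ^ n) sums (qq z ^ m + S)"
    by (rule sums_add[rotated])
  moreover have "(if n = m then qq z ^ n else 0) + (\<Sum>\<^sub>\<infinity>p\<in>?P. pair_coeff k m n p) * qq z ^ n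
      = poincare_coeff k N m n * exp (2 * of_real pi * \<i> * of_nat n * z)" for n
    unfolding qq_pow poincare_coeff_def by (simp add: distrib_right)
  moreover have "qq z ^ m + S = poincare k N m z" using z by (simp add: S_def poincare_def)
  ultimately show ?thesis by simp
qed

section \<open>Bessel functions and Kloosterman sums in the coefficients\<close>

lemma twist_coeff_bessel:
  assumes k: "k \<ge> 2" and c: "c > 0" and mn: "m > 0" "n > 0"
  defines "x \<equiv> 4 * pi * sqrt (real m * real n) / real_of_int c"
  shows "twist_coeff k (beta m c) n = (- 2 * of_real pi * \<i>) ^ k * of_nat n ^ (k - 1) * of_real (bessel_F (k - 1) ((x / 2)\<^sup>2))"
proof -
  define s where "s = k - 1"
  have ks: "k = Suc s" using k by (simp add: s_def)
  have x2: "(x / 2)\<^sup>2 = (2 * pi)\<^sup>2 * real m * real n / (real_of_int c)\<^sup>2"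
    by (simp add: x_def power_divide power_mult_distrib)
  have gen: "b ^ j * X ^ Suc (s + j) * y ^ (s + j) = X ^ Suc s * y ^ s * (b * X * y) ^ j" for b X y :: complex and j
    by (simp add: power_add power_mult_distrib mult_ac)
  have t: "twist_term k (beta m c) n j = (- 2 * of_real pi * \<i>) ^ k * of_nat n ^ (k - 1) * of_real (bessel_coeff (k - 1) j * ((x / 2)\<^sup>2) ^ j)" for j
  proof -
    have "beta m c ^ j * (- 2 * of_real pi * \<i>) ^ (k + j) * of_nat n ^ (k + j - 1) =
        (- 2 * of_real pi * \<i>) ^ k * of_nat n ^ (k - 1) * (beta m c * (- 2 * of_real pi * \<i>) * of_nat n) ^ j"
      using gen[of "beta m c" j "- 2 * of_real pi * \<i>" "of_nat n"] by (simp only: ks add_Suc diff_Suc_1)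
    \<comment> \<open>This product is the negative of the Bessel variable, which creates the
      alternating sign of the Bessel series.\<close>
    also have "beta m c * (- 2 * of_real pi * \<i>) * of_nat n = - of_real ((x / 2)\<^sup>2)"
      unfolding x2 by (simp add: beta_def field_simps power2_eq_square)
    also have "(- complex_of_real ((x / 2)\<^sup>2)) ^ j = (-1) ^ j * of_real (((x / 2)\<^sup>2) ^ j)"
      by (subst power_minus) simp
    finally have "beta m c ^ j * (- 2 * of_real pi * \<i>) ^ (k + j) * of_nat n ^ (k + j - 1) =
        (- 2 * of_real pi * \<i>) ^ k * of_nat n ^ (k - 1) * ((-1) ^ j * of_real (((x / 2)\<^sup>2) ^ j))" .
    then have "beta m c ^ j * (- 2 * of_real pi * \<i>) ^ (k + j) * of_nat n ^ (k + j - 1) / (fact j * fact (k + j - 1)) =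
        (- 2 * of_real pi * \<i>) ^ k * of_nat n ^ (k - 1) * ((-1) ^ j * of_real (((x / 2)\<^sup>2) ^ j)) / (fact j * fact (k + j - 1))"
      by simp
    then show ?thesis
      by (simp add: twist_term_def bessel_coeff_def ks mult_ac)
  qed
  have "(twist_term k (beta m c) n has_sum twist_coeff k (beta m c) n) UNIV"
    unfolding twist_coeff_def by (rule has_sum_infsum[OF abs_summable_summable[OF twist_summable_j[OF k]]])
  then have "twist_term k (beta m c) n sums twist_coeff k (beta m c) n" by (rule has_sum_imp_sums)
  moreover have "(\<lambda>j. bessel_coeff (k - 1) j * ((x / 2)\<^sup>2) ^ j) sums bessel_F (k - 1) ((x / 2)\<^sup>2)"
    unfolding bessel_F_def by (rule summable_sums[OF summable_bessel])
  then have "(\<lambda>j. (- 2 * of_real pi * \<i>) ^ k * of_nat n ^ (k - 1) * complex_of_real (bessel_coeff (k - 1) j * ((x / 2)\<^sup>2) ^ j)) sums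
      ((- 2 * of_real pi * \<i>) ^ k * of_nat n ^ (k - 1) * of_real (bessel_F (k - 1) ((x / 2)\<^sup>2)))"
    by (intro sums_mult sums_of_real)
  ultimately show ?thesis unfolding t[abs_def] by (rule sums_unique2)
qed

text \<open>Inversion permutes the units modulo \<open>c\<close>. The Poincare coefficients attach
  the inverse residue to \<open>m\<close>, the definition of the sum attaches it to the second
  argument.\<close>

lemma kloosterman_swap: "c > 0 \<Longrightarrow> kloosterman m n c = kloosterman n m c"
proof -
  assume c: "c > 0"
  let ?X = "{x \<in> {0..<int c}. coprime x (int c)}"
  have inv: "modular_inverse (int c) x \<in> ?X" if "x \<in> ?X" for x
    using that c modular_inverse_int_nonneg[of "int c" x] modular_inverse_int_less[of "int c" x] by auto
  have inv2: "modular_inverse (int c) (modular_inverse (int c) x) = x" if "x \<in> ?X" for x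
    using that cong_modular_inverse2[of x "int c"] by (intro modular_inverse_int_eqI) auto
  have "kloosterman m n c = (\<Sum>x\<in>?X. exp (2 * of_real pi * \<i> * (of_int (m * x + n * modular_inverse (int c) x) / of_nat c)))"
    by (simp add: kloosterman_def)
  also have "\<dots> = (\<Sum>x\<in>?X. exp (2 * of_real pi * \<i> * (of_int (n * x + m * modular_inverse (int c) x) / of_nat c)))"
    by (rule sum.reindex_bij_witness[of _ "modular_inverse (int c)" "modular_inverse (int c)"])
      (use inv inv2 in \<open>auto simp: add.commute\<close>)
  also have "\<dots> = kloosterman n m c" by (simp add: kloosterman_def)
  finally show ?thesis .
qed

lemma norm_kloosterman_le: "norm (kloosterman m n c) \<le> real c"
proof -
  let ?X = "{x \<in> {0..<int c}. coprime x (int c)}"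
  have "norm (exp (2 * of_real pi * \<i> * (of_int a / of_nat c))) = 1" for a :: int
  proof -
    have "2 * of_real pi * \<i> * (of_int a / of_nat c) = \<i> * of_real (2 * pi * (of_int a / of_nat c))" by simp
    then show ?thesis by (simp only: norm_exp_i_times)
  qed
  then have "norm (kloosterman m n c) \<le> (\<Sum>x\<in>?X. 1)"
    unfolding kloosterman_def by (intro sum_norm_le) simp
  also have "(\<Sum>x\<in>?X. 1) = real (card ?X)" by simp
  also have "\<dots> \<le> real (card {0..<int c})"
    by (intro of_nat_mono card_mono) auto
  finally show ?thesis by simp
qed

section \<open>The Petersson formula\<close>

lemma kloosterman_level:
  assumes "c > 0"
  shows "(\<Sum>d | d \<in> {0..<int c} \<and> coprime d (int c). pair_coeff k m n (int c, d)) =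
    kloosterman m n c / of_nat c ^ k * twist_coeff k (beta m (int c)) n"
proof -
  have "pair_coeff k m n (int c, d) = exp (2 * of_real pi * \<i> * (of_int (int n * d + int m * modular_inverse (int c) d) / of_nat c))
      * (1 / of_nat c ^ k * twist_coeff k (beta m (int c)) n)" for d
  proof -
    have "2 * of_real pi * \<i> * (of_int (int n * d + int m * modular_inverse (int c) d) / of_nat c) =
        2 * of_real pi * \<i> * (of_nat m * of_int (modular_inverse (int c) d) / of_nat c) + 2 * of_real pi * \<i> * (of_nat n * of_int d / of_nat c)"
      by (simp add: add_divide_distrib algebra_simps)
    then show ?thesis by (simp add: pair_coeff_def unit_factor_def exp_add)
  qed
  then have "(\<Sum>d | d \<in> {0..<int c} \<and> coprime d (int c). pair_coeff k m n (int c, d)) =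
      kloosterman n m c * (1 / of_nat c ^ k * twist_coeff k (beta m (int c)) n)"
    by (simp only: kloosterman_def sum_distrib_right)
  then show ?thesis using kloosterman_swap[OF assms, of "int m" "int n"] by simp
qed

text \<open>The moduli are \<open>c = N * (q + 1)\<close>; the shift makes \<open>q = 0\<close> the
  modulus \<open>N\<close> of the main term.\<close>

lemma kloost_pairs_bij:
  assumes N: "N > 0"
  shows "bij_betw (\<lambda>(q, d). (int (N * Suc q), d))
    (SIGMA q:UNIV. {d. d \<in> {0..<int (N * Suc q)} \<and> coprime d (int (N * Suc q))}) (kloost_pairs N)"
proof (rule bij_betw_byWitness[where f' = "\<lambda>(c, d). (nat (c div int N) - 1, d)"])
  have *: "int (N * Suc (nat (c div int N) - 1)) = c" if "0 < c" "int N dvd c" for c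
  proof -
    from that(2) obtain e where e: "c = int N * e" by (auto elim: dvdE)
    then have "e > 0" using that(1) N by (simp add: zero_less_mult_iff)
    then show ?thesis using e N by (simp add: of_nat_diff)
  qed
  show "\<forall>p\<in>kloost_pairs N. (\<lambda>(q, d). (int (N * Suc q), d)) ((\<lambda>(c, d). (nat (c div int N) - 1, d)) p) = p"
    using * by (auto simp: kloost_pairs_def simp del: of_nat_mult mult_Suc_right)
  show "(\<lambda>(c, d). (nat (c div int N) - 1, d)) ` kloost_pairs N \<subseteq>
      (SIGMA q:UNIV. {d. d \<in> {0..<int (N * Suc q)} \<and> coprime d (int (N * Suc q))})"
    using * by (auto simp: kloost_pairs_def coprime_commute simp del: of_nat_mult mult_Suc_right)
  show "\<forall>p\<in>SIGMA q:UNIV. {d. d \<in> {0..<int (N * Suc q)} \<and> coprime d (int (N * Suc q))}.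
      (\<lambda>(c, d). (nat (c div int N) - 1, d)) ((\<lambda>(q, d). (int (N * Suc q), d)) p) = p"
  proof -
    have "nat (int (N * Suc q) div int N) - 1 = q" for q
    proof -
      have "int (N * Suc q) div int N = int (Suc q)" using N by (simp only: of_nat_mult) simp
      then show ?thesis by simp
    qed
    then show ?thesis by (simp del: of_nat_mult mult_Suc_right)
  qed
  show "(\<lambda>(q, d). (int (N * Suc q), d)) ` (SIGMA q:UNIV. {d. d \<in> {0..<int (N * Suc q)} \<and> coprime d (int (N * Suc q))}) \<subseteq> kloost_pairs N"
  proof clarify
    fix q d assume "d \<in> {0..<int (N * Suc q)}" "coprime d (int (N * Suc q))"
    moreover have "int N dvd int (N * Suc q)" by (simp only: of_nat_mult dvd_triv_left)
    moreover have "0 < int (N * Suc q)" using N by (simp only: of_nat_0_less_iff) simp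
    ultimately show "(int (N * Suc q), d) \<in> kloost_pairs N"
      unfolding kloost_pairs_def by (simp add: coprime_commute del: of_nat_mult mult_Suc_right)
  qed
qed

definition petersson_term :: "nat \<Rightarrow> nat \<Rightarrow> nat \<Rightarrow> nat \<Rightarrow> complex" where
  "petersson_term k m n c = 2 * of_real pi * \<i> ^ k * (kloosterman (int m) (int n) c / of_nat c)
     * of_real (bessel_J (real (k - 1)) (4 * pi * sqrt (real m * real n) / real c))"

text \<open>With \<open>r = sqrt (m n)\<close>, the product \<open>(m / r)^(k-1) * n^(k-1)\<close>
  is \<open>r^(k-1)\<close>, the power that completes \<open>bessel_F\<close> to
  \<open>bessel_J\<close>. For even \<open>k\<close> the sign in \<open>(- 2 pi i)^k\<close>
  disappears.\<close>

lemma kloosterman_bessel: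
  assumes k: "k \<ge> 2" "even k" and c: "c > 0" and mn: "m > 0" "n > 0"
  shows "of_real (real m ^ (k - 1) / sqrt (real m * real n) ^ (k - 1)) *
    (kloosterman m n c / of_nat c ^ k * twist_coeff k (beta m (int c)) n) = petersson_term k m n c"
proof -
  define s where "s = k - 1"
  have ks: "k = Suc s" using k by (simp add: s_def)
  define r where "r = sqrt (real m * real n)"
  have r0: "r > 0" using mn by (simp add: r_def)
  have r2: "real m * real n = r * r" using mn by (simp add: r_def)
  define x where "x = 4 * pi * r / real c"
  have x0: "x > 0" using r0 c by (simp add: x_def)
  define G where "G = bessel_F s ((x / 2)\<^sup>2)"
  have tw: "twist_coeff k (beta m (int c)) n = (- 2 * of_real pi * \<i>) ^ k * of_nat n ^ s * of_real G"
    using twist_coeff_bessel[OF k(1), of "int c" m n] c mn by (simp add: G_def x_def r_def s_def)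
  have J: "bessel_J (real s) x = (2 * pi * r / c) ^ s * G"
  proof -
    have "x / 2 = 2 * pi * r / c" by (simp add: x_def)
    then show ?thesis using bessel_J_eq_F[OF x0, of s] by (simp only: G_def)
  qed
  have i: "(- 2 * of_real pi * \<i>) ^ k = of_real ((2 * pi) ^ k) * \<i> ^ k"
  proof -
    have "(- 2 * of_real pi * \<i>) ^ k = (2 * of_real pi * \<i>) ^ k" using k(2) power_minus_even[of k "2 * of_real pi * \<i>"]
      by simp
    also have "\<dots> = of_real ((2 * pi) ^ k) * \<i> ^ k" by (simp add: power_mult_distrib)
    finally show ?thesis .
  qed
  have "real m ^ s * real n ^ s = r ^ s * r ^ s" using r2 by (simp flip: power_mult_distrib)
  then have "real m ^ s / r ^ s * (1 / real c ^ k * (2 * pi) ^ k * real n ^ s * G) = 2 * pi / c * ((2 * pi * r / c) ^ s * G)"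
    using r0 c by (simp add: ks power_divide power_mult_distrib field_simps)
  then have "complex_of_real (real m ^ s / r ^ s * (1 / real c ^ k * (2 * pi) ^ k * real n ^ s * G)) = of_real (2 * pi / c * bessel_J (real s) x)"
    by (simp only: J)
  then have e: "complex_of_real (real m ^ s / r ^ s) * (1 / of_nat c ^ k * of_real ((2 * pi) ^ k) * of_nat n ^ s * of_real G)
     = 2 * of_real pi / of_nat c * of_real (bessel_J (real s) x)" by simp
  have "complex_of_real (real m ^ s / r ^ s) * (kloosterman m n c / of_nat c ^ k * twist_coeff k (beta m (int c)) n) =
      kloosterman m n c * \<i> ^ k * (complex_of_real (real m ^ s / r ^ s) * (1 / of_nat c ^ k * of_real ((2 * pi) ^ k) * of_nat n ^ s * of_real G))"
    unfolding tw i by (simp only: divide_inverse mult_1 mult_ac)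
  also have "\<dots> = petersson_term k m n c"
    unfolding e unfolding petersson_term_def x_def r_def s_def by (simp add: field_simps)
  finally show ?thesis unfolding r_def s_def .
qed

lemma poincare_coeff_bessel:
  assumes k: "k \<ge> 4" "even k" and N: "N > 0" and mn: "m > 0" "n > 0"
  shows "(\<lambda>q. petersson_term k m n (N * Suc q)) sums
    (of_real (real m ^ (k - 1) / sqrt (real m * real n) ^ (k - 1)) * poincare_coeff k N m n - of_bool (m = n))"
proof -
  let ?U = "\<lambda>q. {d. d \<in> {0..<int (N * Suc q)} \<and> coprime d (int (N * Suc q))}"
  let ?C = "complex_of_real (real m ^ (k - 1) / sqrt (real m * real n) ^ (k - 1))"
  let ?g = "\<lambda>p. pair_coeff k m n p"
  let ?L = "\<lambda>q. kloosterman m n (N * Suc q) / of_nat (N * Suc q) ^ k * twist_coeff k (beta m (int (N * Suc q))) n"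
  define T where "T = (\<Sum>\<^sub>\<infinity>p\<in>kloost_pairs N. ?g p)"
  have "?g summable_on kloost_pairs N"
    using pair_coeff_summable_pairs[OF k(1), of m n N] by (rule abs_summable_summable)
  then have "(?g has_sum T) (kloost_pairs N)" unfolding T_def by (rule has_sum_infsum)
  then have "((\<lambda>p. ?g ((\<lambda>(q, d). (int (N * Suc q), d)) p)) has_sum T) (Sigma UNIV ?U)"
    using has_sum_reindex_bij_betw[OF kloost_pairs_bij[OF N], of ?g T] by (simp only:)
  then have "(?L has_sum T) UNIV"
  proof (rule has_sum_SigmaD)
    fix q
    have "finite (?U q)" by (rule finite_subset[of _ "{0..<int (N * Suc q)}"]) auto
    moreover have "sum (\<lambda>d. ?g (int (N * Suc q), d)) (?U q) = ?L q"
      using N by (intro kloosterman_level) simp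
    ultimately show "((\<lambda>d. ?g ((\<lambda>(q, d). (int (N * Suc q), d)) (q, d))) has_sum ?L q) (?U q)"
      by (intro has_sum_finiteI) (simp_all only: prod.case)
  qed
  then have "?L sums T" by (rule has_sum_imp_sums)
  then have "(\<lambda>q. ?C * ?L q) sums (?C * T)" by (rule sums_mult)
  moreover have "?C * ?L q = petersson_term k m n (N * Suc q)" for q
    using k N mn by (intro kloosterman_bessel) simp_all
  ultimately have "(\<lambda>q. petersson_term k m n (N * Suc q)) sums (?C * T)" by (simp only:)
  moreover have "?C * T = ?C * poincare_coeff k N m n - of_bool (m = n)"
  proof -
    have "?C = 1" if "m = n" using that mn by simp
    then show ?thesis unfolding poincare_coeff_def T_def[symmetric]
      by (cases "m = n") (simp_all only: of_bool_eq simp_thms eq_commute[of n m] mult_1 add_diff_cancel_left' add_0 diff_zero)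
  qed
  ultimately show ?thesis by (simp only:)
qed

section \<open>Expansion of the Poincare series in the orthonormal basis\<close>

lemma sum_fun_apply: "(\<Sum>a\<in>t. (\<lambda>z. h a z)) z = (\<Sum>a\<in>t. h a z)"
  by (induction t rule: infinite_finite_induct) (simp_all only: sum.infinite sum.empty sum.insert zero_fun_apply plus_fun_apply not_False_eq_True)

text \<open>A function that is not integrable has Bochner integral 0, so a nonzero value certifies
  integrability.\<close>

lemma petersson_self_integrable:
  assumes "petersson k N f f \<noteq> 0"
  shows "set_integrable lborel (Ford_domain N) (\<lambda>z. f z * cnj (f z) * of_real (Im z ^ k / Im z ^ 2))"
proof (rule ccontr)
  assume "\<not> ?thesis"
  then have "petersson k N f f = 0"
    unfolding petersson_def set_integrable_def set_lebesgue_integral_def by (rule not_integrable_integral_eq)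
  with assms show False by simp
qed

text \<open>Domination by \<open>|f g| <= |f|^2 + |g|^2\<close>.\<close>

lemma petersson_integrable:
  assumes f: "f \<in> cusp_forms k N" "petersson k N f f \<noteq> 0" and g: "g \<in> cusp_forms k N" "petersson k N g g \<noteq> 0"
  shows "set_integrable lborel (Ford_domain N) (\<lambda>z. f z * cnj (g z) * of_real (Im z ^ k / Im z ^ 2))"
proof -
  note [measurable] = cusp_form_measurable[OF f(1)] cusp_form_measurable[OF g(1)]
  let ?D = "Ford_domain N"
  let ?h = "\<lambda>f g z. indicator ?D z *\<^sub>R (f z * cnj (g z) * of_real (Im z ^ k / Im z ^ 2)) :: complex"
  have "integrable lborel (?h f f)" "integrable lborel (?h g g)"
    using petersson_self_integrable[OF f(2)] petersson_self_integrable[OF g(2)] by (simp_all only: set_integrable_def)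
  then have "integrable lborel (\<lambda>z. norm (?h f f z) + norm (?h g g z))"
    by (intro Bochner_Integration.integrable_add integrable_norm)
  then have "integrable lborel (?h f g)"
  proof (rule Bochner_Integration.integrable_bound)
    have [measurable]: "(cnj :: complex \<Rightarrow> complex) \<in> borel_measurable borel"
      by (intro borel_measurable_continuous_onI continuous_intros)
    show "?h f g \<in> borel_measurable lborel" by measurable
    have "norm (?h f g z) \<le> norm (?h f f z) + norm (?h g g z)" for z
    proof -
      have "u * (a * b * w) \<le> u * (a * a * w) + u * (b * b * w)" if "u \<ge> 0" "w \<ge> 0" for a b u w :: real
      proof -
        have "a * b \<le> a * a + b * b"
          using sum_squares_bound[of a b] zero_le_square[of a] zero_le_square[of b] unfolding power2_eq_square by linarith
        then have "(u * w) * (a * b) \<le> (u * w) * (a * a + b * b)" using that by (intro mult_left_mono) auto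
        then show ?thesis by (simp only: algebra_simps)
      qed
      then show ?thesis
        by (simp only: norm_scaleR norm_mult complex_mod_cnj norm_of_real real_norm_def abs_ge_zero)
    qed
    then show "AE z in lborel. norm (?h f g z) \<le> norm (norm (?h f f z) + norm (?h g g z))"
      by (intro AE_I2) (simp only: real_norm_def, rule order_trans[OF _ abs_ge_self])
  qed
  then show ?thesis by (simp only: set_integrable_def)
qed

lemma petersson_sum_right:
  assumes t: "finite t" and int: "\<And>a. a \<in> t \<Longrightarrow> set_integrable lborel (Ford_domain N) (\<lambda>z. f z * cnj (a z) * of_real (Im z ^ k / Im z ^ 2))"
  shows "petersson k N f (\<lambda>z. \<Sum>a\<in>t. r a * a z) = (\<Sum>a\<in>t. cnj (r a) * petersson k N f a)"
proof -
  let ?h = "\<lambda>a z. indicator (Ford_domain N) z *\<^sub>R (f z * cnj (a z) * of_real (Im z ^ k / Im z ^ 2)) :: complex"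
  have "petersson k N f (\<lambda>z. \<Sum>a\<in>t. r a * a z) = (LINT z|lborel. (\<Sum>a\<in>t. cnj (r a) * ?h a z))"
    unfolding petersson_def set_lebesgue_integral_def
    by (intro Bochner_Integration.integral_cong refl)
       (simp only: cnj_sum complex_cnj_mult sum_distrib_left sum_distrib_right scaleR_sum_right mult_scaleR_right mult_ac)
  also have "\<dots> = (\<Sum>a\<in>t. (LINT z|lborel. cnj (r a) * ?h a z))"
    using int by (intro Bochner_Integration.integral_sum integrable_mult_right) (simp only: set_integrable_def)
  also have "\<dots> = (\<Sum>a\<in>t. cnj (r a) * petersson k N f a)"
    unfolding petersson_def set_lebesgue_integral_def by (simp only: integral_mult_right_zero)
  finally show ?thesis .
qed

lemma span_functions:
  assumes "P \<in> module.span (\<lambda>(c :: complex) f (z :: complex). c * f z) F"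
  obtains t r where "finite t" "t \<subseteq> F" "P = (\<lambda>z. \<Sum>a\<in>t. r a * a z)"
proof -
  interpret module "\<lambda>(c :: complex) f (z :: complex). c * f z"
    by unfold_locales (auto simp: fun_eq_iff algebra_simps)
  from assms obtain t r where t: "finite t" "t \<subseteq> F" "P = (\<Sum>a\<in>t. (\<lambda>z. r a * a z))"
    unfolding span_explicit by blast
  have "P = (\<lambda>z. \<Sum>a\<in>t. r a * a z)" unfolding t(3) by (rule ext) (rule sum_fun_apply)
  with t that show ?thesis by blast
qed

lemma powr_half_eq_sqrt_power: "x > 0 \<Longrightarrow> x powr (real s / 2) = sqrt x ^ s"
proof -
  assume x: "x > 0"
  then have "x powr (real s / 2) = (x powr (1 / 2)) powr real s" by (simp add: powr_powr)
  then show ?thesis using x by (simp add: powr_half_sqrt powr_realpow)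
qed

text \<open>The inner product of \<open>f\<close> with the Poincare series is computed twice:
  unfolding gives the \<open>m\<close>-th coefficient of \<open>f\<close> times
  \<open>\<kappa>\<close>, orthonormality gives the conjugate of the coordinate of the series along
  \<open>f\<close>. Comparing \<open>n\<close>-th Fourier coefficients of the resulting expansion
  gives the claim.\<close>

lemma Delta_eq_poincare_coeff:
  assumes F: "hecke_basis k N F" and k: "k \<ge> 6" "even k" and N: "N > 0" and mn: "m > 0" "n > 0"
  shows "Delta k F m n = of_real (real m ^ (k - 1) / sqrt (real m * real n) ^ (k - 1)) * poincare_coeff k N m n"
proof -
  define P where "P = poincare k N m"
  define s where "s = k - 1"
  have ks: "k = Suc s" using k by (simp add: s_def)
  obtain j where j: "k = 2 * j" using k(2) by (auto elim: evenE)
  have j3: "j \<ge> 3" using j k by simp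
  define \<kappa> :: real where "\<kappa> = fact (k - 2) / (4 * pi * m) ^ s"
  have \<kappa>0: "\<kappa> > 0" using mn by (simp add: \<kappa>_def)
  have cf: "f \<in> cusp_forms k N" if "f \<in> F" for f using F that by (auto simp: hecke_basis_def)
  have orth: "petersson k N f g = of_bool (f = g)" if "f \<in> F" "g \<in> F" for f g
    using F that by (simp add: hecke_basis_def)
  have "P \<in> cusp_forms k N" unfolding P_def using k mn N by (intro poincare_cusp_form) auto
  then have "P \<in> module.span (\<lambda>c f z. c * f z) F" using F by (simp add: hecke_basis_def)
  then obtain t r where t: "finite t" "t \<subseteq> F" and P: "P = (\<lambda>z. \<Sum>a\<in>t. r a * a z)"
    by (rule span_functions)
  have "\<forall>f. \<exists>b. f \<in> F \<longrightarrow> b 0 = 0 \<and> (\<forall>z\<in>HH. (\<lambda>n. b n * exp (2 * of_real pi * \<i> * of_nat n * z)) sums f z)"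
    using fourier_exists[OF cf] by metis
  then obtain b where b0: "\<And>f. f \<in> F \<Longrightarrow> b f 0 = 0"
    and b: "\<And>f z. f \<in> F \<Longrightarrow> z \<in> HH \<Longrightarrow> (\<lambda>n. b f n * exp (2 * of_real pi * \<i> * of_nat n * z)) sums f z"
    unfolding choice_iff by blast
  have pet: "petersson k N f P = b f m * of_real \<kappa>" if "f \<in> F" for f
    unfolding P_def \<kappa>_def s_def j
    by (rule petersson_poincare) (use cf[OF that] b[OF that] N j3 mn j in auto)
  have pet2: "petersson k N f P = (if f \<in> t then cnj (r f) else 0)" if "f \<in> F" for f
  proof -
    have "petersson k N f P = (\<Sum>a\<in>t. cnj (r a) * petersson k N f a)"
      unfolding P
    proof (rule petersson_sum_right[OF t(1)])
      fix a assume "a \<in> t"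
      then have "a \<in> F" using t by auto
      then show "set_integrable lborel (Ford_domain N) (\<lambda>z. f z * cnj (a z) * of_real (Im z ^ k / Im z ^ 2))"
        using that by (intro petersson_integrable cf) (simp_all add: orth)
    qed
    also have "\<dots> = (\<Sum>a\<in>t. if a = f then cnj (r a) else 0)"
      by (intro sum.cong refl) (use that t(2) orth in \<open>auto simp: subset_iff\<close>)
    finally show ?thesis using t(1) by simp
  qed
  have r: "r f = cnj (b f m) * of_real \<kappa>" if "f \<in> t" for f
  proof -
    have "cnj (r f) = b f m * of_real \<kappa>" using pet[of f] pet2[of f] that t(2) by auto
    then have "cnj (cnj (r f)) = cnj (b f m * of_real \<kappa>)" by (simp only:)
    then show ?thesis by simp
  qed
  \<comment> \<open>Basis elements outside the support \<open>t\<close> are orthogonal to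
    \<open>P\<close>; this makes the sum over \<open>F\<close> finite.\<close>
  have z: "b f m = 0" if "f \<in> F - t" for f
    using pet[of f] pet2[of f] that \<kappa>0 by auto
  have rho: "rho k l f = of_real (sqrt (fact (k - 2) / (4 * pi) ^ s)) * (b f l / of_real (sqrt l ^ s))" if "f \<in> F" "l > 0" for f l
  proof -
    have "Gamma (real k - 1) = fact (k - 2)"
    proof -
      have "real k - 1 = real (k - 2) + 1" using k by (simp add: of_nat_diff)
      then show ?thesis using Gamma_fact[of "k - 2", where 'a = real] by (simp only: add.commute)
    qed
    moreover have "(4 * pi) powr (real k - 1) = (4 * pi) ^ s" by (simp add: ks powr_realpow)
    moreover have "fourier_coeff k f l = b f l / of_real (real l powr ((real k - 1) / 2))"
      using b0[OF that(1)] b[OF that(1)] by (rule fourier_coeff_eqI)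
    moreover have "real l powr ((real k - 1) / 2) = sqrt l ^ s"
      using powr_half_eq_sqrt_power[of "real l" s] that by (simp add: ks)
    ultimately show ?thesis by (simp add: rho_def)
  qed
  define g where "g = (fact (k - 2) :: real) / (4 * pi) ^ s"
  have g0: "g > 0" by (simp add: g_def)
  have summand: "cnj (rho k m f) * rho k n f = of_real (g / sqrt (real m * real n) ^ s) * (cnj (b f m) * b f n)" if "f \<in> F" for f
  proof -
    have "complex_of_real (sqrt g) * complex_of_real (sqrt g) = of_real g"
      using g0 by (simp flip: of_real_mult)
    then have gen: "cnj (complex_of_real (sqrt g) * (B / of_real u)) * (complex_of_real (sqrt g) * (B' / of_real v))
       = of_real (g / (u * v)) * (cnj B * B')" for B B' u v
      by (simp add: field_simps)
    moreover have "sqrt m ^ s * sqrt n ^ s = sqrt (real m * real n) ^ s"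
      by (simp add: real_sqrt_mult power_mult_distrib)
    ultimately show ?thesis
      unfolding rho[OF that mn(1)] rho[OF that mn(2)] g_def[symmetric] gen by (simp only:)
  qed
  have "Delta k F m n = (\<Sum>\<^sub>\<infinity>f\<in>F. of_real (g / sqrt (real m * real n) ^ s) * (cnj (b f m) * b f n))"
    unfolding Delta_def by (intro infsum_cong) (rule summand)
  also have "\<dots> = (\<Sum>\<^sub>\<infinity>f\<in>t. of_real (g / sqrt (real m * real n) ^ s) * (cnj (b f m) * b f n))"
    by (rule infsum_cong_neutral) (use z t(2) in auto)
  also have "\<dots> = (\<Sum>f\<in>t. of_real (g / sqrt (real m * real n) ^ s) * (cnj (b f m) * b f n))"
    using t(1) by (rule infsum_finite)
  also have "\<dots> = (\<Sum>f\<in>t. of_real (g / \<kappa> / sqrt (real m * real n) ^ s) * (r f * b f n))"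
    using \<kappa>0 by (intro sum.cong refl) (simp add: r field_simps)
  also have "\<dots> = of_real (g / \<kappa> / sqrt (real m * real n) ^ s) * (\<Sum>f\<in>t. r f * b f n)"
    by (simp only: sum_distrib_left)
  also have "(\<Sum>f\<in>t. r f * b f n) = poincare_coeff k N m n"
  proof -
    have "(\<lambda>n. \<Sum>f\<in>t. r f * b f n) = poincare_coeff k N m"
    proof (rule fourier_unique)
      fix z assume z: "z \<in> HH"
      have "(\<lambda>n. \<Sum>f\<in>t. r f * (b f n * exp (2 * of_real pi * \<i> * of_nat n * z))) sums (\<Sum>f\<in>t. r f * f z)"
        using b z t(2) by (intro sums_sum sums_mult) auto
      then show "(\<lambda>n. (\<Sum>f\<in>t. r f * b f n) * exp (2 * of_real pi * \<i> * of_nat n * z)) sums P z"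
        by (simp only: P sum_distrib_right mult.assoc)
      show "(\<lambda>n. poincare_coeff k N m n * exp (2 * of_real pi * \<i> * of_nat n * z)) sums P z"
        unfolding P_def using k N z by (intro poincare_expansion) auto
    next
      have "b f 0 = 0" if "f \<in> t" for f using that t(2) by (intro b0) auto
      then show "(\<Sum>f\<in>t. r f * b f 0) = poincare_coeff k N m 0"
        using poincare_coeff_0[of k m N] k mn by simp
    qed
    then show ?thesis by (rule fun_cong)
  qed
  also have "g / \<kappa> = real m ^ s" by (simp add: g_def \<kappa>_def power_mult_distrib)
  finally show ?thesis by (simp only: s_def)
qed

theorem petersson_formula:
  assumes F: "hecke_basis k N F" and k: "k \<ge> 6" "even k" and N: "N > 0" and mn: "m > 0" "n > 0"
  shows "(\<lambda>q. petersson_term k m n (N * Suc q)) sums (Delta k F m n - of_bool (m = n))"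
  unfolding Delta_eq_poincare_coeff[OF assms] using k N mn by (intro poincare_coeff_bessel) auto

section \<open>Estimates in the transition range\<close>

lemma norm_petersson_term:
  assumes "c > 0"
  shows "norm (petersson_term k m n c) = 2 * pi * (norm (kloosterman (int m) (int n) c) / c) *
    \<bar>bessel_J (real (k - 1)) (4 * pi * sqrt (real m * real n) / real c)\<bar>"
  by (simp add: petersson_term_def norm_mult norm_divide norm_power)

text \<open>The modulus is \<open>p * N\<close> with \<open>p = q + 2\<close>. Of the decay
  \<open>p^(-s)\<close> only \<open>2^(-s) * 4 / p^2\<close> is kept: the first factor carries the
  exponential smallness and the second makes the moduli summable. The trivial bound for Kloosterman
  sums suffices.\<close>

lemma norm_petersson_term_le:
  fixes m n N q s :: nat
  assumes N: "N > 0" and mn: "m > 0" "n > 0" and s: "s \<ge> 2"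
  defines "x \<equiv> 4 * pi * sqrt (real m * real n) / real N"
  shows "norm (petersson_term (Suc s) m n (N * Suc (Suc q))) \<le>
    2 * pi * ((x / 4) ^ s * exp (x\<^sup>2 / 16 / s) / fact s) * (4 / (real q + 2)\<^sup>2)"
proof -
  define p where "p = real q + 2"
  have p: "p \<ge> 2" by (simp add: p_def)
  have x: "x > 0" using N mn by (simp add: x_def)
  have c: "N * Suc (Suc q) > 0" using N by simp
  have xp: "4 * pi * sqrt (real m * real n) / real (N * Suc (Suc q)) = x / p"
    by (simp add: x_def p_def algebra_simps)
  have "norm (kloosterman (int m) (int n) (N * Suc (Suc q))) / real (N * Suc (Suc q)) \<le> 1"
    using norm_kloosterman_le[of "int m" "int n" "N * Suc (Suc q)"] c
    by (subst divide_le_eq_1) (simp only: of_nat_0_less_iff, blast)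
  then have "norm (petersson_term (Suc s) m n (N * Suc (Suc q))) \<le> 2 * pi * 1 * \<bar>bessel_J (real s) (x / p)\<bar>"
    unfolding norm_petersson_term[OF c] xp diff_Suc_1 by (intro mult_right_mono mult_left_mono) auto
  also have "\<bar>bessel_J (real s) (x / p)\<bar> \<le> (x / p / 2) ^ s * (exp ((x / p / 2)\<^sup>2 / (real s + 1)) / fact s)"
    using x p by (intro abs_bessel_J_le) simp
  also have "\<dots> \<le> ((x / 4) ^ s * (4 / p\<^sup>2)) * (exp (x\<^sup>2 / 16 / s) / fact s)"
  proof (intro mult_mono divide_right_mono)
    have "(x / p / 2) ^ s = (x / 4) ^ s * (2 / p) ^ s" by (simp add: mult.commute flip: power_mult_distrib)
    also have "(2 / p) ^ s \<le> (2 / p)\<^sup>2" using p s by (intro power_decreasing) auto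
    also have "(2 / p)\<^sup>2 = 4 / p\<^sup>2" by (simp add: power_divide)
    finally show "(x / p / 2) ^ s \<le> (x / 4) ^ s * (4 / p\<^sup>2)" using x by simp
    have "x / p / 2 \<le> x / 4" using x p by (simp add: field_simps)
    then have "(x / p / 2)\<^sup>2 \<le> (x / 4)\<^sup>2" using x p by (intro power_mono) auto
    then have "(x / p / 2)\<^sup>2 / (real s + 1) \<le> (x / 4)\<^sup>2 / s"
      using s by (intro frac_le) auto
    then show "exp ((x / p / 2)\<^sup>2 / (real s + 1)) \<le> exp (x\<^sup>2 / 16 / s)" by (simp add: power_divide)
  qed (use x p in auto)
  finally show ?thesis by (simp add: p_def mult_ac)
qed

text \<open>Here \<open>x <= 1.01 * s\<close>, and \<open>s^s <= s! * e^s\<close> replaces Stirling.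
  Per unit of \<open>s\<close> the exponents are at most \<open>1 - 1.323\<close> from
  \<open>(x / 4)^s / s!\<close> and \<open>0.07\<close> from the exponential factor, in total
  \<open>- 0.253\<close>.\<close>

lemma tail_majorant_le:
  fixes s :: nat and x :: real
  assumes s: "s \<ge> 1000" and x: "0 < x" "x \<le> real s + real s powr (1 / 3)"
  shows "(x / 4) ^ s * exp (x\<^sup>2 / 16 / s) / fact s \<le> exp (- real s / 4)"
proof -
  have s0: "real s > 0" using s by simp
  have "real s powr (1 / 3) = real s * real s powr (- 2 / 3)"
    using s0 powr_add[of "real s" 1 "- 2 / 3"] by simp
  also have "real s powr (- 2 / 3) \<le> 1000 powr (- 2 / 3)" using s by (intro powr_mono2') auto
  also have "1000 powr (- 2 / 3) = (1 / 100 :: real)"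
  proof -
    have "(1000::real) = 10 powr 3" by simp
    then have "(1000::real) powr (- 2 / 3) = 10 powr (- 2)" by (simp only: powr_powr) simp
    then show ?thesis by (simp add: powr_minus_divide)
  qed
  finally have x': "x \<le> 101 / 100 * s" using x s0 by simp
  have "(x / 4) ^ s \<le> (101 / 400 * s) ^ s" using x x' by (intro power_mono) auto
  also have "\<dots> = (101 / 400) ^ s * real s ^ s" by (rule power_mult_distrib)
  also have "\<dots> \<le> (101 / 400) ^ s * (fact s * exp s)" using power_le_exp[of "real s" s] by (intro mult_left_mono) auto
  finally have a: "(x / 4) ^ s / fact s \<le> (101 / 400) ^ s * exp s" by (simp add: field_simps)
  \<comment> \<open>From \<open>ln (101/100) <= 1/100\<close> and
    \<open>ln 2 >= 2/3\<close>.\<close>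
  have e: "101 / 400 \<le> exp (- 1323 / 1000 :: real)"
  proof -
    have "ln (101 / 400 :: real) = ln (101 / 100) - 2 * ln 2"
      using ln_div[of "101 / 100 :: real" 4] ln_realpow[of "2 :: real" 2] by simp
    also have "\<dots> \<le> 1 / 100 - 2 * (2 / 3)"
      using ln_le_minus_one[of "101 / 100 :: real"] ln2_ge_two_thirds by linarith
    also have "\<dots> \<le> - 1323 / 1000" by simp
    finally have "exp (ln (101 / 400 :: real)) \<le> exp (- 1323 / 1000)" by (simp only: exp_le_cancel_iff)
    then show ?thesis by (simp only: exp_ln)
  qed
  have "(101 / 400) ^ s \<le> exp (- 1323 / 1000 :: real) ^ s" using e by (intro power_mono) auto
  also have "\<dots> = exp (s * (- 1323 / 1000))" by (rule exp_of_nat_mult[symmetric])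
  finally have b: "(101 / 400) ^ s * exp s \<le> exp (s * (- 1323 / 1000)) * exp (real s)" by simp
  have "x\<^sup>2 \<le> (101 / 100 * s)\<^sup>2" using x x' by (intro power_mono) auto
  then have "x\<^sup>2 / 16 / s \<le> (101 / 100 * s)\<^sup>2 / 16 / s" using s0 by (intro divide_right_mono) auto
  also have "\<dots> \<le> 7 / 100 * s" using s0 by (simp add: power2_eq_square)
  finally have c: "exp (x\<^sup>2 / 16 / s) \<le> exp (7 / 100 * real s)" by simp
  have "(x / 4) ^ s / fact s * exp (x\<^sup>2 / 16 / s) \<le> exp (s * (- 1323 / 1000)) * exp (real s) * exp (7 / 100 * real s)"
    using order_trans[OF a b] c x by (intro mult_mono) auto
  also have "\<dots> = exp (- 253 / 1000 * real s)" by (simp flip: exp_add add: algebra_simps)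
  also have "\<dots> \<le> exp (- real s / 4)" by simp
  finally show ?thesis by simp
qed

definition tail_const :: real where
  "tail_const = 2 * pi * (\<Sum>q. 4 / (real q + 2)\<^sup>2)"

lemma summable_tail: "summable (\<lambda>q. 4 / (real q + 2)\<^sup>2)"
proof -
  have "summable (\<lambda>q. inverse ((real q)\<^sup>2))" by (rule inverse_power_summable) simp
  then have "summable (\<lambda>q. inverse ((real (q + 2))\<^sup>2))" by (rule summable_ignore_initial_segment)
  then have "summable (\<lambda>q. 4 * inverse ((real (q + 2))\<^sup>2))" by (rule summable_mult)
  then show ?thesis by (simp add: divide_inverse add.commute)
qed

lemma tail_const_nonneg: "tail_const \<ge> 0"
  unfolding tail_const_def using suminf_nonneg[OF summable_tail] by simp

text \<open>The term \<open>q = 0\<close> of the Petersson formula is the main term; the shifted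
  series is dominated term by term.\<close>

lemma Delta_approx:
  fixes s m n N :: nat
  assumes F: "hecke_basis (Suc s) N F" and s: "s \<ge> 1000" "odd s" and N: "N > 0" and mn: "m > 0" "n > 0"
    and x: "4 * pi * sqrt (real m * real n) / real N \<le> real s + real s powr (1 / 3)"
  shows "norm (Delta (Suc s) F m n - (of_bool (m = n) + petersson_term (Suc s) m n N)) \<le> tail_const * exp (- real s / 4)"
proof -
  let ?x = "4 * pi * sqrt (real m * real n) / real N"
  have x0: "?x > 0" using N mn by simp
  let ?f = "\<lambda>q. petersson_term (Suc s) m n (N * Suc q)"
  let ?g = "\<lambda>q. 2 * pi * exp (- real s / 4) * (4 / (real q + 2)\<^sup>2)"
  have S: "?f sums (Delta (Suc s) F m n - of_bool (m = n))"
    using s by (intro petersson_formula[OF F _ _ N mn]) auto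
  have "norm (?f (Suc q)) \<le> ?g q" for q
  proof -
    have "norm (?f (Suc q)) \<le> 2 * pi * ((?x / 4) ^ s * exp (?x\<^sup>2 / 16 / s) / fact s) * (4 / (real q + 2)\<^sup>2)"
      using s by (intro norm_petersson_term_le N mn) auto
    also have "\<dots> \<le> ?g q"
      using tail_majorant_le[OF s(1) x0 x] by (intro mult_right_mono mult_left_mono) auto
    finally show ?thesis .
  qed
  then have "norm (\<Sum>q. ?f (Suc q)) \<le> (\<Sum>q. ?g q)"
    by (rule norm_suminf_le) (intro summable_mult summable_tail)
  also have "(\<Sum>q. ?g q) = tail_const * exp (- real s / 4)"
    using suminf_mult[OF summable_tail, of "2 * pi * exp (- real s / 4)"] by (simp add: tail_const_def)
  also have "(\<Sum>q. ?f (Suc q)) = Delta (Suc s) F m n - of_bool (m = n) - ?f 0"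
    using suminf_split_head[OF sums_summable[OF S]] sums_unique[OF S] by (simp only:)
  finally show ?thesis by (simp add: diff_diff_eq add.commute)
qed

lemma kloosterman_mod: "kloosterman (m mod int c) (n mod int c) c = kloosterman m n c"
proof (cases "c = 0")
  case False
  have "exp (2 * of_real pi * \<i> * (of_int (m mod int c * x + n mod int c * y) / of_nat c)) =
      exp (2 * of_real pi * \<i> * (of_int (m * x + n * y) / of_nat c))" for x y
  proof -
    have "m * x + n * y = (m mod int c * x + n mod int c * y) + int c * (m div int c * x + n div int c * y)"
    proof -
      have "m * x + n * y = (m div int c * int c + m mod int c) * x + (n div int c * int c + n mod int c) * y"
        by (simp only: div_mult_mod_eq)
      then show ?thesis by (simp only: algebra_simps)
    qed
    then have "of_int (m * x + n * y) / of_nat c = of_int (m mod int c * x + n mod int c * y) / (of_nat c :: complex)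
        + of_int (m div int c * x + n div int c * y)"
      using False by (simp only:) (simp add: field_simps)
    then have "2 * of_real pi * \<i> * (of_int (m * x + n * y) / of_nat c) =
        2 * of_real pi * \<i> * (of_int (m mod int c * x + n mod int c * y) / of_nat c)
        + of_int (2 * (m div int c * x + n div int c * y)) * (of_real pi * \<i>)"
      by (simp only:) (simp add: algebra_simps)
    moreover have "exp (of_int (2 * l) * (of_real pi * \<i>)) = (1 :: complex)" for l
      using exp_integer_2pi[of "of_int l"] by (simp add: mult_ac)
    ultimately show ?thesis by (simp only: exp_add mult_1_right)
  qed
  then show ?thesis by (simp only: kloosterman_def)
qed simp

text \<open>Periodicity in both arguments leaves finitely many values. Inserting 1 keeps the set
  nonempty, so that its minimum is meaningful.\<close>

lemma kloosterman_lower_bound: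
  assumes "N > 0"
  shows "\<exists>\<epsilon>>0. \<forall>m n. kloosterman m n N \<noteq> 0 \<longrightarrow> norm (kloosterman m n N) \<ge> \<epsilon>"
proof -
  let ?V = "(\<lambda>(m, n). norm (kloosterman m n N)) ` ({0..<int N} \<times> {0..<int N}) - {0}"
  have fin: "finite (insert 1 ?V)" by simp
  show ?thesis
  proof (intro exI[of _ "Min (insert 1 ?V)"] conjI allI impI)
    show "Min (insert 1 ?V) > 0" using fin by (subst Min_gr_iff) auto
    fix m n assume nz: "kloosterman m n N \<noteq> 0"
    have "norm (kloosterman m n N) \<in> ?V"
      using nz assms kloosterman_mod[of m N n]
      by (auto intro!: image_eqI[of _ _ "(m mod int N, n mod int N)"])
    then show "norm (kloosterman m n N) \<ge> Min (insert 1 ?V)" using fin by (intro Min_le) auto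
  qed
qed

text \<open>The constants and the threshold for \<open>k\<close> are chosen before \<open>F\<close>,
  \<open>m\<close> and \<open>n\<close>, so the estimates are uniform in these and depend on
  \<open>N\<close> alone.\<close>

theorem theorem2p3:
  fixes N :: nat
  assumes "N > 0"
  shows
    "(\<exists>C::real. \<forall>\<^sub>F k::nat in at_top. even k \<longrightarrow>
        (\<forall>F m n. hecke_basis k N F \<longrightarrow> m > 0 \<longrightarrow> n > 0 \<longrightarrow>
          \<bar>4 * pi * sqrt (real m * real n) / real N - (real k - 1)\<bar> < (real k - 1) powr (1 / 3) \<longrightarrow>
          norm (Delta k F m n
                - (of_bool (m = n)
                   + 2 * of_real pi * \<i> ^ k * (kloosterman (int m) (int n) N / of_nat N)
                     * of_real (bessel_J (real k - 1) (4 * pi * sqrt (real m * real n) / real N))))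
            \<le> C * (exp ((real k - 1) * (1 - 4 / 9 - ln (9 / 5))) / (real k - 1) powr (1 / 3))))
     \<and>
     (\<exists>c>0::real. \<forall>\<^sub>F k::nat in at_top. even k \<longrightarrow>
        (\<forall>F m n. hecke_basis k N F \<longrightarrow> m > 0 \<longrightarrow> n > 0 \<longrightarrow>
          \<bar>4 * pi * sqrt (real m * real n) / real N - (real k - 1)\<bar> < (real k - 1) powr (1 / 3) \<longrightarrow>
          kloosterman (int m) (int n) N \<noteq> 0 \<longrightarrow>
          norm (Delta k F m n - of_bool (m = n)) \<ge> c * (real k - 1) powr (- 1 / 3)))"
proof (intro conjI)
  have main: "norm (Delta k F m n - (of_bool (m = n) + petersson_term k m n N)) \<le> tail_const * exp (- (real k - 1) / 4)"
    if "k \<ge> 1001" "even k" "hecke_basis k N F" "m > 0" "n > 0"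
      "\<bar>4 * pi * sqrt (real m * real n) / real N - (real k - 1)\<bar> < (real k - 1) powr (1 / 3)" for k F m n
  proof -
    obtain s where s: "k = Suc s" using \<open>k \<ge> 1001\<close> by (cases k) auto
    show ?thesis using Delta_approx[of s N F m n] that assms by (auto simp: s)
  qed
  have pt: "petersson_term k m n N = 2 * of_real pi * \<i> ^ k * (kloosterman (int m) (int n) N / of_nat N)
      * of_real (bessel_J (real k - 1) (4 * pi * sqrt (real m * real n) / real N))" if "k \<ge> 1001" for k m n
    using that by (simp add: petersson_term_def of_nat_diff)
  have "\<forall>\<^sub>F k::nat in at_top. (real k - 1) powr (1 / 3) * exp (- (real k - 1) / 4) \<le> exp ((real k - 1) * (- 1 / 9))"
    by real_asymp
  moreover have "\<forall>\<^sub>F k::nat in at_top. k \<ge> 1001" by (rule eventually_ge_at_top)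
  ultimately have "\<forall>\<^sub>F k::nat in at_top. even k \<longrightarrow>
        (\<forall>F m n. hecke_basis k N F \<longrightarrow> m > 0 \<longrightarrow> n > 0 \<longrightarrow>
          \<bar>4 * pi * sqrt (real m * real n) / real N - (real k - 1)\<bar> < (real k - 1) powr (1 / 3) \<longrightarrow>
          norm (Delta k F m n
                - (of_bool (m = n)
                   + 2 * of_real pi * \<i> ^ k * (kloosterman (int m) (int n) N / of_nat N)
                     * of_real (bessel_J (real k - 1) (4 * pi * sqrt (real m * real n) / real N))))
            \<le> tail_const * (exp ((real k - 1) * (1 - 4 / 9 - ln (9 / 5))) / (real k - 1) powr (1 / 3)))"
  proof (eventually_elim, intro impI allI)
    fix k F m n
    assume e: "(real k - 1) powr (1 / 3) * exp (- (real k - 1) / 4) \<le> exp ((real k - 1) * (- 1 / 9))" and k: "k \<ge> 1001"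
      and asm: "even k" "hecke_basis k N F" "m > 0" "n > 0"
        "\<bar>4 * pi * sqrt (real m * real n) / real N - (real k - 1)\<bar> < (real k - 1) powr (1 / 3)"
    \<comment> \<open>This gives \<open>1 - 4/9 - ln (9/5) >= - 1/9\<close>. The gap between
      \<open>- 1/4\<close> and \<open>- 1/9\<close> absorbs the factor
      \<open>(k - 1)^(1/3)\<close>.\<close>
    have "ln (9 / 5 :: real) \<le> 2 / 3"
    proof -
      have "9 / 5 \<le> exp (2 / 3 :: real)"
        using exp_lower_Taylor_quadratic[of "2 / 3 :: real"] by (simp add: power2_eq_square)
      then have "ln (9 / 5 :: real) \<le> ln (exp (2 / 3))" by (subst ln_le_cancel_iff) auto
      then show ?thesis by simp
    qed
    then have "exp ((real k - 1) * (- 1 / 9)) \<le> exp ((real k - 1) * (1 - 4 / 9 - ln (9 / 5)))"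
      using k by (subst exp_le_cancel_iff, intro mult_left_mono) auto
    moreover have "(real k - 1) powr (1 / 3) > 0" using k by simp
    ultimately have "exp (- (real k - 1) / 4) \<le> exp ((real k - 1) * (1 - 4 / 9 - ln (9 / 5))) / (real k - 1) powr (1 / 3)"
      using e by (simp only: pos_le_divide_eq mult.commute)
    then have "tail_const * exp (- (real k - 1) / 4) \<le> tail_const * (exp ((real k - 1) * (1 - 4 / 9 - ln (9 / 5))) / (real k - 1) powr (1 / 3))"
      using tail_const_nonneg by (rule mult_left_mono)
    with main[OF k asm] show "norm (Delta k F m n
                - (of_bool (m = n)
                   + 2 * of_real pi * \<i> ^ k * (kloosterman (int m) (int n) N / of_nat N)
                     * of_real (bessel_J (real k - 1) (4 * pi * sqrt (real m * real n) / real N))))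
            \<le> tail_const * (exp ((real k - 1) * (1 - 4 / 9 - ln (9 / 5))) / (real k - 1) powr (1 / 3))"
      unfolding pt[OF k] by (rule order_trans)
  qed
  then show "\<exists>C::real. \<forall>\<^sub>F k::nat in at_top. even k \<longrightarrow>
        (\<forall>F m n. hecke_basis k N F \<longrightarrow> m > 0 \<longrightarrow> n > 0 \<longrightarrow>
          \<bar>4 * pi * sqrt (real m * real n) / real N - (real k - 1)\<bar> < (real k - 1) powr (1 / 3) \<longrightarrow>
          norm (Delta k F m n
                - (of_bool (m = n)
                   + 2 * of_real pi * \<i> ^ k * (kloosterman (int m) (int n) N / of_nat N)
                     * of_real (bessel_J (real k - 1) (4 * pi * sqrt (real m * real n) / real N))))
            \<le> C * (exp ((real k - 1) * (1 - 4 / 9 - ln (9 / 5))) / (real k - 1) powr (1 / 3)))"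
    by (rule exI[of _ tail_const])
  obtain \<epsilon> where \<epsilon>: "\<epsilon> > 0" "\<And>m n. kloosterman m n N \<noteq> 0 \<Longrightarrow> norm (kloosterman m n N) \<ge> \<epsilon>"
    using kloosterman_lower_bound[OF assms] by auto
  \<comment> \<open>The last division by 2 leaves half of the lower bound for the main term to
    absorb the remaining moduli.\<close>
  define c where "c = 2 * pi * (\<epsilon> / N) * (exp (- 11) / 2) / 2"
  have c0: "c > 0" using \<epsilon> assms by (simp add: c_def)
  have "\<forall>\<^sub>F k::nat in at_top. tail_const * exp (- (real k - 1) / 4) \<le> c * (real k - 1) powr (- 1 / 3)"
  proof -
    have "((\<lambda>k::nat. exp (- (real k - 1) / 4) / (real k - 1) powr (- 1 / 3)) \<longlongrightarrow> 0) at_top" by real_asymp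
    \<comment> \<open>Adding 1 keeps the denominator positive, since \<open>tail_const\<close> is
      only known to be nonnegative.\<close>
    moreover have "0 < c / (tail_const + 1)" using c0 tail_const_nonneg by simp
    ultimately have "\<forall>\<^sub>F k::nat in at_top. exp (- (real k - 1) / 4) / (real k - 1) powr (- 1 / 3) < c / (tail_const + 1)"
      by (rule order_tendstoD)
    moreover have "\<forall>\<^sub>F k::nat in at_top. k \<ge> 2" by (rule eventually_ge_at_top)
    ultimately show ?thesis
    proof eventually_elim
      fix k :: nat
      assume a: "exp (- (real k - 1) / 4) / (real k - 1) powr (- 1 / 3) < c / (tail_const + 1)" and k: "k \<ge> 2"
      have "(real k - 1) powr (- 1 / 3) > 0" using k by simp
      then have "(tail_const + 1) * exp (- (real k - 1) / 4) < c * (real k - 1) powr (- 1 / 3)"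
        using a tail_const_nonneg by (simp add: divide_simps mult.commute)
      then show "tail_const * exp (- (real k - 1) / 4) \<le> c * (real k - 1) powr (- 1 / 3)"
        using exp_gt_zero[of "- (real k - 1) / 4"] unfolding distrib_right by linarith
    qed
  qed
  moreover have "\<forall>\<^sub>F k::nat in at_top. k \<ge> 1000001" by (rule eventually_ge_at_top)
  ultimately have "\<forall>\<^sub>F k::nat in at_top. even k \<longrightarrow>
        (\<forall>F m n. hecke_basis k N F \<longrightarrow> m > 0 \<longrightarrow> n > 0 \<longrightarrow>
          \<bar>4 * pi * sqrt (real m * real n) / real N - (real k - 1)\<bar> < (real k - 1) powr (1 / 3) \<longrightarrow>
          kloosterman (int m) (int n) N \<noteq> 0 \<longrightarrow>
          norm (Delta k F m n - of_bool (m = n)) \<ge> c * (real k - 1) powr (- 1 / 3))"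
  proof (eventually_elim, intro impI allI)
    fix k F m n
    assume e: "tail_const * exp (- (real k - 1) / 4) \<le> c * (real k - 1) powr (- 1 / 3)" and k: "k \<ge> 1000001"
      and asm: "even k" "hecke_basis k N F" "m > 0" "n > 0"
        "\<bar>4 * pi * sqrt (real m * real n) / real N - (real k - 1)\<bar> < (real k - 1) powr (1 / 3)"
      and nz: "kloosterman (int m) (int n) N \<noteq> 0"
    have k': "k \<ge> 1001" using k by simp
    have rk: "real (k - 1) = real k - 1" using k by simp
    let ?x = "4 * pi * sqrt (real m * real n) / real N"
    have "exp (- 11) / 2 * (real k - 1) powr (- 1 / 3) \<le> \<bar>bessel_J (real (k - 1)) ?x\<bar>"
    proof -
      have "\<bar>?x - real (k - 1)\<bar> < real (k - 1) powr (1 / 3)" "k - 1 \<ge> 1000000" using asm(5) k unfolding rk by simp_all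
      from bessel_J_transition_ge[OF this(2,1)] show ?thesis unfolding rk by (rule order_trans[OF _ abs_ge_self])
    qed
    then have "2 * pi * (\<epsilon> / N) * (exp (- 11) / 2 * (real k - 1) powr (- 1 / 3)) \<le> norm (petersson_term k m n N)"
      unfolding norm_petersson_term[OF assms] using \<epsilon>(1) \<epsilon>(2)[OF nz]
      by (intro mult_mono divide_right_mono) auto
    then have "2 * (c * (real k - 1) powr (- 1 / 3)) \<le> norm (petersson_term k m n N)"
      by (simp add: c_def)
    also have "petersson_term k m n N = (Delta k F m n - of_bool (m = n)) - (Delta k F m n - (of_bool (m = n) + petersson_term k m n N))"
      by simp
    also have "norm \<dots> \<le> norm (Delta k F m n - of_bool (m = n)) + norm (Delta k F m n - (of_bool (m = n) + petersson_term k m n N))"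
      by (rule norm_triangle_ineq4)
    also have "\<dots> \<le> norm (Delta k F m n - of_bool (m = n)) + c * (real k - 1) powr (- 1 / 3)"
      using main[OF k' asm] e by simp
    finally show "norm (Delta k F m n - of_bool (m = n)) \<ge> c * (real k - 1) powr (- 1 / 3)" by simp
  qed
  then show "\<exists>c>0::real. \<forall>\<^sub>F k::nat in at_top. even k \<longrightarrow>
        (\<forall>F m n. hecke_basis k N F \<longrightarrow> m > 0 \<longrightarrow> n > 0 \<longrightarrow>
          \<bar>4 * pi * sqrt (real m * real n) / real N - (real k - 1)\<bar> < (real k - 1) powr (1 / 3) \<longrightarrow>
          kloosterman (int m) (int n) N \<noteq> 0 \<longrightarrow>
          norm (Delta k F m n - of_bool (m = n)) \<ge> c * (real k - 1) powr (- 1 / 3))"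
    using c0 by (intro exI[of _ c] conjI)
qed

end
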